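(* Let $\nu: A^+\to\mathbb{C}^\times$ be a quasi-character satisfying Godement's criterion, i.e. $\mathrm{Re}\,\nu(h_{\alpha_i})<-2$ for $i=1,2$. Then the constant term $E^\sharp_\nu(g)$ converges absolutely for all $g\in KA'N$, where $A'$ is the cone $$A'=\{a\in A^+ : a^{\alpha_i}<1,\ i=1,2\}.$$
   Context: Lie algebra. Fix an integer $m\ge 3$. $\mathfrak{g}$ is the complex Kac--Moody algebra with generalized Cartan matrix $\begin{pmatrix}2&-m\\-m&2\end{pmatrix}$, with Cartan subalgebra $\mathfrak{h}$, simple roots $\alpha_1,\alpha_2\in\mathfrak{h}^*$, simple coroots $h_{\alpha_1},h_{\alpha_2}\in\mathfrak{h}$ (bases of $\mathfrak{h}^*$ and $\mathfrak{h}$), simple root vectors $e_i,f_i$ ($i=1,2$), sets of positive and negative roots $\Phi_+,\Phi_-$, and Weyl group $W$ generated by the simple reflections $r_1,r_2$. A root is real if it is $W$-conjugate to a simple root; for a real root $\alpha=w\alpha_i$, $h_\alpha=w h_{\alpha_i}$ is its coroot. $\rho=\frac{\alpha_1+\alpha_2}{2-m}$, so $\rho(h_{\alpha_i})=1$. Module and lattice. $V=V^\lambda$ is a fixed integrable irreducible highest weight $\mathfrak{g}$-module with highest weight vector $v_\lambda$. $\mathcal{U}^-_{\mathbb{Z}}$ is the $\mathbb{Z}$-algebra generated by the $f_i^n/n!$ ($n\ge0$), $V_{\mathbb{Z}}=\mathcal{U}^-_{\mathbb{Z}}v_\lambda$ (a lattice stable under all $e_i^n/n!$, $f_i^n/n!$),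 and $V_{\mathbb{R}}=\mathbb{R}\otimes V_{\mathbb{Z}}$. The depth of a weight $\lambda-k_1\alpha_1-k_2\alpha_2$ is $k_1+k_2$. $\Psi=\{v_1,v_2,\dots\}$ is a fixed basis of $V_{\mathbb{Z}}$ (hence of $V_{\mathbb R}$) of weight vectors, ordered by non-decreasing depth and such that the basis vectors in each weight space form an interval. $\langle\,,\rangle$ is the positive definite Hermitian contravariant form on $V$ ($e_i$ and $f_i$ adjoint, $\langle v_\lambda,v_\lambda\rangle=1$). Group. $\chi_{\alpha_i}(s)=\exp(se_i)$ and $\chi_{-\alpha_i}(s)=\exp(sf_i)$ in $\mathrm{Aut}(V_{\mathbb{R}})$, $s\in\mathbb{R}$. For $t\ne0$, $w_{\alpha_i}(t)=\chi_{\alpha_i}(t)\chi_{-\alpha_i}(-t^{-1})\chi_{\alpha_i}(t)$ and $h_{\alpha_i}(t)=w_{\alpha_i}(t)w_{\alpha_i}(1)^{-1}$. For a real root $\alpha=w\alpha_i$, $\chi_\alpha(s)=w\chi_{\alpha_i}(s)w^{-1}$. $G^0_{\mathbb{R}}$ is the group generated by all $\chi_{\pm\alpha_i}(s)$, and $G_{\mathbb{R}}$ is its completion for the topology having the pointwise stabilizers of $\{v_1,\dots,v_t\}$, $t\ge1$, as a base of neighborhoods of the identity. Subgroups of $G_{\mathbb{R}}$: $B$ is the projective limit over $t$ of the images in $\mathrm{Aut}(\mathrm{Span}(v_1,\dots,v_t))$ of the subgroup of $G^0_{\mathbb{R}}$ of elements upper triangular with respect to $\Psi$; $N\subset B$ is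 the completion of the subgroup generated by all $\chi_\alpha(s)$ with $\alpha$ a positive real root; $K$ is the subgroup preserving $\langle\,,\rangle$; $A^+=\langle h_{\alpha_i}(s): s>0,\ i=1,2\rangle$. There is the Iwasawa decomposition $G_{\mathbb{R}}=KA^+N$ with unique expression $g=k_ga_gn_g$. The map $(x_1,x_2)\mapsto h_{\alpha_1}(x_1)h_{\alpha_2}(x_2)$ identifies $\mathbb{R}_{>0}^2$ with $A^+$. For $\mu\in\mathfrak{h}^*$ and $a=h_{\alpha_1}(x_1)h_{\alpha_2}(x_2)$, $a^\mu=x_1^{\mu(h_{\alpha_1})}x_2^{\mu(h_{\alpha_2})}$; a quasi-character $\nu$ of $A^+$ is identified with $\nu\in\mathfrak{h}^*$ via $\nu(a)=a^\nu$. $\Gamma=G_{\mathbb{Z}}=\{\gamma\in G_{\mathbb{R}}:\gamma V_{\mathbb{Z}}\subseteq V_{\mathbb{Z}}\}=G_{\mathbb R}\cap\mathrm{Aut}(V_{\mathbb Z})$. Measure. $N/(\Gamma\cap N)$ is the projective limit over $t$ of the compact nilmanifolds $N_t/\Gamma_t$, where $N_t$ and $\Gamma_t$ are the images of $N$ and $\Gamma\cap N$ in $\mathrm{Aut}(\mathrm{Span}(v_1,\dots,v_t))$; $dn$ is the projective limit of the compatible invariant probability measures, a left $N$-invariant probability measure. Constant term. With $\Phi_\nu(g)=a_g^\nu$ and $E_\nu(g)=\sum_{\gamma\in\Gamma/(\Gamma\cap B)}\Phi_\nu(g\gamma)$, the constant term is $$E^\sharp_\nu(g)=\int_{N/(\Gamma\cap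 N)}E_\nu(gn)\,dn .$$ It is left $K$-invariant and right $N$-invariant, so it is determined by its values on $A^+$: $E^\sharp_\nu(g)=E^\sharp_\nu(a_g)$. By a formal calculation using the Gindikin--Karpelevich formula, for $a\in A^+$ it is given by the series $$E^\sharp_\nu(a)=\sum_{w\in W}a^{w(\nu+\rho)-\rho}\,c(\nu,w),\qquad c(\nu,w)=\prod_{\alpha\in\Phi_+\cap w^{-1}\Phi_-}\frac{\xi(-(\nu+\rho)(h_\alpha))}{\xi(1-(\nu+\rho)(h_\alpha))},$$ where $\xi(s)=\pi^{-s/2}\Gamma(s/2)\prod_p(1-p^{-s})^{-1}$ is the completed Riemann zeta function (here $\Gamma(\cdot)$ is the gamma function). Absolute convergence of the constant term refers to this series over $W$. *)

theory Defs
  imports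
    "HOL-Analysis.Analysis"
    "HOL-Algebra.Generated_Groups"
    "HOL-Computational_Algebra.Primes"
begin

section \<open>The realization of the Cartan matrix\<close>

text \<open>
  The Cartan matrix is invertible for \<open>m \<ge> 3\<close>, so the simple coroots form a basis of the Cartan
  subalgebra. Both the Cartan subalgebra and its dual are written in coordinates with respect to
  this basis: \<open>h\<close> stands for \<open>\<Sum>i. h $ i \<cdot> h\<^sub>i\<close>, and a linear functional \<open>\<mu>\<close> stands for the vector of
  its values \<open>\<mu> $ i = \<mu>(h\<^sub>i)\<close>.
\<close>

definition cartan_matrix :: "nat \<Rightarrow> 2 \<Rightarrow> 2 \<Rightarrow> complex" where
  "cartan_matrix m i j = (if i = j then 2 else - of_nat m)"

definition pairing :: "complex^2 \<Rightarrow> complex^2 \<Rightarrow> complex" where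
  "pairing \<mu> h = (\<Sum>i\<in>UNIV. \<mu> $ i * h $ i)"

definition simple_root :: "nat \<Rightarrow> 2 \<Rightarrow> complex^2" where
  "simple_root m j = (\<chi> i. cartan_matrix m i j)"

definition simple_coroot :: "2 \<Rightarrow> complex^2" where
  "simple_coroot i = axis i 1"

definition rho :: "nat \<Rightarrow> complex^2" where
  "rho m = (1 / (2 - of_nat m)) *s (simple_root m 1 + simple_root m 2)"

section \<open>The Weyl group\<close>

definition bijection_group :: "('a \<Rightarrow> 'a) monoid" where
  "bijection_group = \<lparr>carrier = {g. bij g}, monoid.mult = (\<circ>), one = id\<rparr>"

text \<open>The Weyl group is realized on the Cartan subalgebra; it acts on the dual contragrediently,
  by \<open>(w \<mu>)(h) = \<mu>(w\<^sup>-\<^sup>1 h)\<close>.\<close>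

definition reflection :: "nat \<Rightarrow> 2 \<Rightarrow> complex^2 \<Rightarrow> complex^2" where
  "reflection m i h = h - pairing (simple_root m i) h *s simple_coroot i"

definition weyl_group :: "nat \<Rightarrow> (complex^2 \<Rightarrow> complex^2) set" where
  "weyl_group m = generate bijection_group (range (reflection m))"

definition weyl_dual :: "(complex^2 \<Rightarrow> complex^2) \<Rightarrow> complex^2 \<Rightarrow> complex^2" where
  "weyl_dual w \<mu> = (\<chi> i. pairing \<mu> (inv_into UNIV w (simple_coroot i)))"

text \<open>The coroot \<open>w h\<^sub>i\<close> of a real root \<open>w \<alpha>\<^sub>i\<close>; it does not depend on the choice of \<open>w\<close> and \<open>i\<close>.\<close>

definition coroot :: "nat \<Rightarrow> complex^2 \<Rightarrow> complex^2" where
  "coroot m \<alpha> = (THE h. \<exists>w\<in>weyl_group m. \<exists>i.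
      \<alpha> = weyl_dual w (simple_root m i) \<and> h = w (simple_coroot i))"

section \<open>Kac--Moody algebra, module and lattice\<close>

record 'g km_algebra =
  gscale :: "complex \<Rightarrow> 'g \<Rightarrow> 'g"
  bracket :: "'g \<Rightarrow> 'g \<Rightarrow> 'g"
  cartan :: "complex^2 \<Rightarrow> 'g"
  egen :: "2 \<Rightarrow> 'g"
  fgen :: "2 \<Rightarrow> 'g"

record ('g, 'v) km_module = "'g km_algebra" +
  vscale :: "complex \<Rightarrow> 'v \<Rightarrow> 'v"
  act :: "'g \<Rightarrow> 'v \<Rightarrow> 'v"
  hw :: "complex^2"
  hwv :: 'v
  herm :: "'v \<Rightarrow> 'v \<Rightarrow> complex"
  Psi :: "nat \<Rightarrow> 'v"

locale lie_algebra = vector_space scale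
  for scale :: "complex \<Rightarrow> 'g::ab_group_add \<Rightarrow> 'g" +
  fixes br :: "'g \<Rightarrow> 'g \<Rightarrow> 'g"
  assumes linear_left: "Vector_Spaces.linear scale scale (\<lambda>x. br x y)"
    and linear_right: "Vector_Spaces.linear scale scale (br x)"
    and alternating: "br x x = 0"
    and jacobi: "br x (br y z) + br y (br z x) + br z (br x y) = 0"

text \<open>Kac's characterization: the algebra is generated by the Cartan subalgebra and the Chevalley
  generators, the Chevalley relations hold, and no nonzero ideal meets the Cartan subalgebra
  trivially.\<close>

locale kac_moody_algebra =
  fixes m :: nat and L :: "('g::ab_group_add, 'z) km_algebra_scheme"
  assumes lie: "lie_algebra (gscale L) (bracket L)"
    and cartan_linear: "Vector_Spaces.linear (*s) (gscale L) (cartan L)"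
    and cartan_inj: "inj (cartan L)"
    and cartan_cartan: "bracket L (cartan L h) (cartan L h') = 0"
    and cartan_e: "bracket L (cartan L h) (egen L i)
      = gscale L (pairing (simple_root m i) h) (egen L i)"
    and cartan_f: "bracket L (cartan L h) (fgen L i)
      = gscale L (- pairing (simple_root m i) h) (fgen L i)"
    and e_f: "bracket L (egen L i) (fgen L j) = (if i = j then cartan L (simple_coroot i) else 0)"
    and generated: "\<lbrakk>module.subspace (gscale L) S; \<And>x y. x \<in> S \<Longrightarrow> y \<in> S \<Longrightarrow> bracket L x y \<in> S;
      range (cartan L) \<subseteq> S; range (egen L) \<subseteq> S; range (fgen L) \<subseteq> S\<rbrakk> \<Longrightarrow> S = UNIV"
    and no_ideal: "\<lbrakk>module.subspace (gscale L) I; \<And>x y. y \<in> I \<Longrightarrow> bracket L x y \<in> I;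
      I \<inter> range (cartan L) = {0}\<rbrakk> \<Longrightarrow> I = {0}"

definition roots :: "('g::ab_group_add, 'z) km_algebra_scheme \<Rightarrow> (complex^2) set" where
  "roots L = {\<alpha>. \<alpha> \<noteq> 0 \<and>
      (\<exists>x. x \<noteq> 0 \<and> (\<forall>h. bracket L (cartan L h) x = gscale L (pairing \<alpha> h) x))}"

definition pos_roots :: "nat \<Rightarrow> ('g::ab_group_add, 'z) km_algebra_scheme \<Rightarrow> (complex^2) set" where
  "pos_roots m L = {\<alpha> \<in> roots L. \<exists>k :: 2 \<Rightarrow> nat. \<alpha> = (\<Sum>i\<in>UNIV. of_nat (k i) *s simple_root m i)}"

definition neg_roots :: "nat \<Rightarrow> ('g::ab_group_add, 'z) km_algebra_scheme \<Rightarrow> (complex^2) set" where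
  "neg_roots m L = {\<alpha> \<in> roots L. \<exists>k :: 2 \<Rightarrow> nat. \<alpha> = - (\<Sum>i\<in>UNIV. of_nat (k i) *s simple_root m i)}"

definition weight_space ::
    "('g::ab_group_add, 'v::ab_group_add, 'z) km_module_scheme \<Rightarrow> complex^2 \<Rightarrow> 'v set" where
  "weight_space M \<mu> = {v. \<forall>h. act M (cartan M h) v = vscale M (pairing \<mu> h) v}"

definition weight_below :: "nat \<Rightarrow> ('g, 'v, 'z) km_module_scheme \<Rightarrow> (2 \<Rightarrow> nat) \<Rightarrow> complex^2" where
  "weight_below m M k = hw M - (\<Sum>i\<in>UNIV. of_nat (k i) *s simple_root m i)"

text \<open>The image in \<open>End V\<close> of the integral form generated by the divided powers \<open>f\<^sub>i\<^sup>n / n!\<close>.\<close>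

inductive_set U_minus_Z :: "('g, 'v::ab_group_add, 'z) km_module_scheme \<Rightarrow> ('v \<Rightarrow> 'v) set"
  for M where
  one: "id \<in> U_minus_Z M"
| divided_power: "(\<lambda>v. vscale M (1 / fact n) ((act M (fgen M i) ^^ n) v)) \<in> U_minus_Z M"
| diff: "T \<in> U_minus_Z M \<Longrightarrow> T' \<in> U_minus_Z M \<Longrightarrow> (\<lambda>v. T v - T' v) \<in> U_minus_Z M"
| mult: "T \<in> U_minus_Z M \<Longrightarrow> T' \<in> U_minus_Z M \<Longrightarrow> T \<circ> T' \<in> U_minus_Z M"

definition V_Z :: "('g, 'v::ab_group_add, 'z) km_module_scheme \<Rightarrow> 'v set" where
  "V_Z M = (\<lambda>T. T (hwv M)) ` U_minus_Z M"

text \<open>Since \<open>V\<^sub>Z\<close> is a lattice in \<open>V\<close>, the real form \<open>\<real> \<otimes> V\<^sub>Z\<close> is the real span of \<open>V\<^sub>Z\<close> in \<open>V\<close>.\<close>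

definition V_R :: "('g, 'v::ab_group_add, 'z) km_module_scheme \<Rightarrow> 'v set" where
  "V_R M = module.span (\<lambda>r::real. vscale M (of_real r)) (V_Z M)"

text \<open>The requirement \<open>hw M \<noteq> 0\<close> only excludes the trivial module, for which the group is trivial and
  \<open>(x\<^sub>1, x\<^sub>2) \<mapsto> h\<^sub>1(x\<^sub>1) h\<^sub>2(x\<^sub>2)\<close> does not identify \<open>\<real>\<^sub>>\<^sub>0\<^sup>2\<close> with \<open>A\<^sup>+\<close>. Generation of \<open>V\<close> by the highest weight
  vector is part of irreducibility. Highest weight vector, contravariant form and basis are
  fixed together with the module; the basis \<open>v\<^sub>1, v\<^sub>2, \<dots>\<close> is indexed from \<open>0\<close>.\<close>

locale kac_moody_setting = kac_moody_algebra m M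
  for m :: nat and M :: "('g::ab_group_add, 'v::ab_group_add, 'z) km_module_scheme" +
  assumes m_ge_3: "m \<ge> 3"
    and vector_space: "vector_space (vscale M)"
    and act_linear_left: "Vector_Spaces.linear (gscale M) (vscale M) (\<lambda>x. act M x v)"
    and act_linear_right: "Vector_Spaces.linear (vscale M) (vscale M) (act M x)"
    and act_bracket: "act M (bracket M x y) v = act M x (act M y v) - act M y (act M x v)"
    and irreducible: "\<lbrakk>module.subspace (vscale M) S; \<And>x v. v \<in> S \<Longrightarrow> act M x v \<in> S\<rbrakk>
      \<Longrightarrow> S = {0} \<or> S = UNIV"
    and integrable_diag: "module.span (vscale M) (\<Union>\<mu>. weight_space M \<mu>) = UNIV"
    and integrable_e: "\<exists>n. (act M (egen M i) ^^ n) v = 0"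
    and integrable_f: "\<exists>n. (act M (fgen M i) ^^ n) v = 0"
    and hwv_nonzero: "hwv M \<noteq> 0"
    and hwv_weight: "hwv M \<in> weight_space M (hw M)"
    and hwv_e: "act M (egen M i) (hwv M) = 0"
    and hw_nonzero: "hw M \<noteq> 0"
    and herm_linear: "Vector_Spaces.linear (vscale M) (*) (\<lambda>v. herm M v v')"
    and herm_sym: "herm M v' v = cnj (herm M v v')"
    and herm_pos: "v \<noteq> 0 \<Longrightarrow> Re (herm M v v) > 0"
    and herm_contra: "herm M (act M (egen M i) v) v' = herm M v (act M (fgen M i) v')"
    and herm_hwv: "herm M (hwv M) (hwv M) = 1"
    and Psi_inj: "inj (Psi M)"
    and Psi_independent: "\<not> module.dependent (\<lambda>k::int. vscale M (of_int k)) (range (Psi M))"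
    and Psi_span: "module.span (\<lambda>k::int. vscale M (of_int k)) (range (Psi M)) = V_Z M"
    and Psi_weight: "\<exists>k. Psi M n \<in> weight_space M (weight_below m M k)"
    and Psi_depth: "\<lbrakk>n \<le> n'; Psi M n \<in> weight_space M (weight_below m M k);
      Psi M n' \<in> weight_space M (weight_below m M k')\<rbrakk> \<Longrightarrow> k 1 + k 2 \<le> k' 1 + k' 2"
    and Psi_interval: "\<lbrakk>n \<le> n'; n' \<le> n''; Psi M n \<in> weight_space M \<mu>;
      Psi M n'' \<in> weight_space M \<mu>\<rbrakk> \<Longrightarrow> Psi M n' \<in> weight_space M \<mu>"

section \<open>The group\<close>

text \<open>Exponential of a locally nilpotent operator: on each vector only finitely many terms are
  nonzero.\<close>

definition op_exp :: "(complex \<Rightarrow> 'v::ab_group_add \<Rightarrow> 'v) \<Rightarrow> ('v \<Rightarrow> 'v) \<Rightarrow> 'v \<Rightarrow> 'v" where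
  "op_exp sc T v = (\<Sum>n | (T ^^ n) v \<noteq> 0. sc (1 / fact n) ((T ^^ n) v))"

text \<open>A real automorphism of \<open>V\<^sub>R\<close> is represented by its complex linear extension to
  \<open>V = \<complex> \<otimes> V\<^sub>R\<close>.\<close>

definition Aut_V_R :: "('g, 'v::ab_group_add, 'z) km_module_scheme \<Rightarrow> ('v \<Rightarrow> 'v) set" where
  "Aut_V_R M = {g. Vector_Spaces.linear (vscale M) (vscale M) g \<and> bij g \<and> g ` V_R M = V_R M}"

definition chi_pos ::
    "('g, 'v::ab_group_add, 'z) km_module_scheme \<Rightarrow> 2 \<Rightarrow> real \<Rightarrow> 'v \<Rightarrow> 'v" where
  "chi_pos M i s = op_exp (vscale M) (\<lambda>v. vscale M (of_real s) (act M (egen M i) v))"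

definition chi_neg ::
    "('g, 'v::ab_group_add, 'z) km_module_scheme \<Rightarrow> 2 \<Rightarrow> real \<Rightarrow> 'v \<Rightarrow> 'v" where
  "chi_neg M i s = op_exp (vscale M) (\<lambda>v. vscale M (of_real s) (act M (fgen M i) v))"

definition w_elt :: "('g, 'v::ab_group_add, 'z) km_module_scheme \<Rightarrow> 2 \<Rightarrow> real \<Rightarrow> 'v \<Rightarrow> 'v" where
  "w_elt M i t = chi_pos M i t \<circ> chi_neg M i (- inverse t) \<circ> chi_pos M i t"

definition h_elt :: "('g, 'v::ab_group_add, 'z) km_module_scheme \<Rightarrow> 2 \<Rightarrow> real \<Rightarrow> 'v \<Rightarrow> 'v" where
  "h_elt M i t = w_elt M i t \<circ> inv_into UNIV (w_elt M i 1)"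

definition G0 :: "('g, 'v::ab_group_add, 'z) km_module_scheme \<Rightarrow> ('v \<Rightarrow> 'v) set" where
  "G0 M = generate bijection_group ({chi_pos M i s |i s. True} \<union> {chi_neg M i s |i s. True})"

text \<open>A word in the simple reflections, and its lift to the group through the elements \<open>w\<^sub>i(1)\<close>.
  Different lifts of the same Weyl group element change \<open>\<chi>\<^sub>\<alpha>(s)\<close> at most to \<open>\<chi>\<^sub>\<alpha>(-s)\<close>.\<close>

definition weyl_word :: "nat \<Rightarrow> 2 list \<Rightarrow> complex^2 \<Rightarrow> complex^2" where
  "weyl_word m is = foldr (\<lambda>i g. reflection m i \<circ> g) is id"

definition weyl_lift ::
    "('g, 'v::ab_group_add, 'z) km_module_scheme \<Rightarrow> 2 list \<Rightarrow> 'v \<Rightarrow> 'v" where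
  "weyl_lift M is = foldr (\<lambda>i g. w_elt M i 1 \<circ> g) is id"

definition chi_real ::
    "('g, 'v::ab_group_add, 'z) km_module_scheme \<Rightarrow> 2 list \<Rightarrow> 2 \<Rightarrow> real \<Rightarrow> 'v \<Rightarrow> 'v" where
  "chi_real M is i s = weyl_lift M is \<circ> chi_pos M i s \<circ> inv_into UNIV (weyl_lift M is)"

definition N0 ::
    "nat \<Rightarrow> ('g::ab_group_add, 'v::ab_group_add, 'z) km_module_scheme \<Rightarrow> ('v \<Rightarrow> 'v) set" where
  "N0 m M = generate bijection_group
     {chi_real M is i s |is i s. weyl_dual (weyl_word m is) (simple_root m i) \<in> pos_roots m M}"

text \<open>In the topology given by the pointwise stabilizers of finite initial segments of the basis,
  i.e. that of pointwise convergence with \<open>V\<^sub>R\<close> discrete, the automorphism group of \<open>V\<^sub>R\<close> is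
  complete (for the two-sided uniformity). Hence the completion of a subgroup is its closure.\<close>

definition completion ::
    "('g, 'v::ab_group_add, 'z) km_module_scheme \<Rightarrow> ('v \<Rightarrow> 'v) set \<Rightarrow> ('v \<Rightarrow> 'v) set" where
  "completion M H = {g \<in> Aut_V_R M. \<forall>t. \<exists>g'\<in>H. \<forall>n<t. g (Psi M n) = g' (Psi M n)}"

definition G_R :: "('g, 'v::ab_group_add, 'z) km_module_scheme \<Rightarrow> ('v \<Rightarrow> 'v) set" where
  "G_R M = completion M (G0 M)"

definition N_grp ::
    "nat \<Rightarrow> ('g::ab_group_add, 'v::ab_group_add, 'z) km_module_scheme \<Rightarrow> ('v \<Rightarrow> 'v) set" where
  "N_grp m M = completion M (N0 m M)"

definition K_grp :: "('g, 'v::ab_group_add, 'z) km_module_scheme \<Rightarrow> ('v \<Rightarrow> 'v) set" where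
  "K_grp M = {g \<in> G_R M. \<forall>v v'. herm M (g v) (g v') = herm M v v'}"

definition A_plus :: "('g, 'v::ab_group_add, 'z) km_module_scheme \<Rightarrow> ('v \<Rightarrow> 'v) set" where
  "A_plus M = generate bijection_group {h_elt M i s |i s. s > 0}"

definition A_coord :: "('g, 'v::ab_group_add, 'z) km_module_scheme \<Rightarrow> ('v \<Rightarrow> 'v) \<Rightarrow> real \<times> real" where
  "A_coord M a = (THE (x1, x2). x1 > 0 \<and> x2 > 0 \<and> a = h_elt M 1 x1 \<circ> h_elt M 2 x2)"

definition A_power ::
    "('g, 'v::ab_group_add, 'z) km_module_scheme \<Rightarrow> ('v \<Rightarrow> 'v) \<Rightarrow> complex^2 \<Rightarrow> complex" where
  "A_power M a \<mu> = (case A_coord M a of (x1, x2) \<Rightarrow>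
     of_real x1 powr pairing \<mu> (simple_coroot 1) * of_real x2 powr pairing \<mu> (simple_coroot 2))"

text \<open>The component \<open>a\<^sub>g\<close> of the Iwasawa decomposition \<open>g = k\<^sub>g a\<^sub>g n\<^sub>g\<close>.\<close>

definition iwasawa_A ::
    "nat \<Rightarrow> ('g::ab_group_add, 'v::ab_group_add, 'z) km_module_scheme \<Rightarrow> ('v \<Rightarrow> 'v) \<Rightarrow> ('v \<Rightarrow> 'v)" where
  "iwasawa_A m M g = (THE a. a \<in> A_plus M \<and> (\<exists>k\<in>K_grp M. \<exists>n\<in>N_grp m M. g = k \<circ> a \<circ> n))"

text \<open>The powers \<open>a\<^sup>\<alpha>\<close> for a simple root \<open>\<alpha>\<close> are positive real numbers, hence equal to their real
  part.\<close>

definition A_cone :: "nat \<Rightarrow> ('g, 'v::ab_group_add, 'z) km_module_scheme \<Rightarrow> ('v \<Rightarrow> 'v) set" where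
  "A_cone m M = {a \<in> A_plus M. \<forall>i. Re (A_power M a (simple_root m i)) < 1}"

definition KAN_cone ::
    "nat \<Rightarrow> ('g::ab_group_add, 'v::ab_group_add, 'z) km_module_scheme \<Rightarrow> ('v \<Rightarrow> 'v) set" where
  "KAN_cone m M = {k \<circ> a \<circ> n |k a n. k \<in> K_grp M \<and> a \<in> A_cone m M \<and> n \<in> N_grp m M}"

section \<open>The constant term\<close>

text \<open>The Euler product, and so this formula for the completed zeta function, is meaningful for
  \<open>Re s > 1\<close>. Under Godement's criterion it is only evaluated there.\<close>

definition completed_zeta :: "complex \<Rightarrow> complex" where
  "completed_zeta s = of_real pi powr (- s / 2) * Gamma (s / 2) *
     prodinf (\<lambda>p::nat. if prime p then inverse (1 - of_nat p powr (- s)) else 1)"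

text \<open>All roots in \<open>\<Phi>\<^sub>+ \<inter> w\<^sup>-\<^sup>1 \<Phi>\<^sub>-\<close> are real, and there are finitely many of them.\<close>

definition c_fun ::
    "nat \<Rightarrow> ('g::ab_group_add, 'z) km_algebra_scheme \<Rightarrow> complex^2 \<Rightarrow> (complex^2 \<Rightarrow> complex^2) \<Rightarrow> complex"
  where
  "c_fun m L \<nu> w = (\<Prod>\<alpha> \<in> {\<alpha> \<in> pos_roots m L. weyl_dual w \<alpha> \<in> neg_roots m L}.
     completed_zeta (- pairing (\<nu> + rho m) (coroot m \<alpha>)) /
     completed_zeta (1 - pairing (\<nu> + rho m) (coroot m \<alpha>)))"

text \<open>The term for \<open>w\<close> of the series for the constant term at \<open>g\<close>, which by left \<open>K\<close>- and right
  \<open>N\<close>-invariance is the series at \<open>a\<^sub>g\<close>. Absolute convergence of the constant term means that of this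
  series over the Weyl group.\<close>

definition constant_term_summand ::
    "nat \<Rightarrow> ('g::ab_group_add, 'v::ab_group_add, 'z) km_module_scheme \<Rightarrow> complex^2 \<Rightarrow> ('v \<Rightarrow> 'v) \<Rightarrow>
     (complex^2 \<Rightarrow> complex^2) \<Rightarrow> complex" where
  "constant_term_summand m M \<nu> g w =
     A_power M (iwasawa_A m M g) (weyl_dual w (\<nu> + rho m) - rho m) * c_fun m M \<nu> w"

definition constant_term_converges_absolutely ::
    "nat \<Rightarrow> ('g::ab_group_add, 'v::ab_group_add, 'z) km_module_scheme \<Rightarrow> complex^2 \<Rightarrow> ('v \<Rightarrow> 'v) \<Rightarrow> bool"
  where
  "constant_term_converges_absolutely m M \<nu> g \<longleftrightarrow>
     (\<lambda>w. norm (constant_term_summand m M \<nu> g w)) summable_on weyl_group m"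

end

theory Submission
  imports Defs
begin

text \<open>Write \<open>H = log a\<close> for the element of the real Cartan subalgebra with \<open>a\<^sup>\<mu> = exp (\<mu>(H))\<close>. The term of the series at
  \<open>w\<close> has modulus \<open>exp (Re (\<nu> + \<rho>)(w\<^sup>-\<^sup>1 H) - \<rho>(H)) \<bar>c(\<nu>, w)\<bar>\<close>, and the point is that the exponential is
  doubly exponentially small in the length of \<open>w\<close>, while \<open>c(\<nu>, w)\<close> is at most exponentially large.

  The condition \<open>a \<in> A'\<close> says that \<open>H\<close> is antidominant. As \<open>m \<ge> 3\<close>, this forces the coordinates of \<open>H\<close>
  in the basis of simple coroots to be positive, and each further simple reflection of a reduced word replaces
  a coordinate \<open>x\<close> by \<open>m y - x\<close>, at least twice the other coordinate \<open>y\<close>. So the coordinate sum of \<open>w\<^sup>-\<^sup>1 H\<close> grows like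
  \<open>2\<^sup>n\<close> with the length \<open>n\<close> (\<open>orbit_growth\<close>). Godement's criterion gives \<open>Re (\<nu> + \<rho>)(h\<^sub>i) < -1\<close>. The Weyl group is
  infinite dihedral, with at most two elements of each length (\<open>weyl_group_eq_alternating\<close>).

  The factors of \<open>c(\<nu>, w)\<close> are \<open>\<xi>(s) / \<xi>(1 + s)\<close> with \<open>s = -(\<nu> + \<rho>)(h\<^sub>\<alpha>)\<close>. They are bounded by a constant as soon as
  \<open>Re s\<close> is bounded below by some \<open>\<sigma> > 1\<close> (\<open>norm_completed_zeta_quotient_bounded\<close>), which holds because the
  coroot of a positive real root is a nonnegative integral combination of simple coroots (\<open>coroot_rt\<close>). The number
  of factors is at most the length of \<open>w\<close> and all of them belong to real roots (\<open>inversion_set\<close>). This is where the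
  structure of the Kac--Moody algebra enters: its triangular decomposition (\<open>span_monomials\<close>), the Serre relations
  (\<open>serre_relation\<close>) and with them the invariance of the roots under the Weyl group (\<open>roots_dual_reflection\<close>).

  Finally, the series at \<open>g = k a n\<close> is formed with the components of the Iwasawa decomposition and with the
  coordinates of \<open>a\<close>, and both have to be shown to be unique. The coordinates are read off from the action
  of \<open>a\<close> on the weight spaces of \<open>V\<close> (\<open>torus_action\<close>), where \<open>h\<^sub>i(t)\<close> acts on the weight space of \<open>\<mu>\<close> as
  \<open>t\<close> to the power \<open>\<mu>(h\<^sub>i)\<close>; the component \<open>a\<close> is read off from the Gram matrix of \<open>g v\<close> and \<open>g f\<^sub>j v\<close>, for the
  highest weight vector \<open>v\<close> (\<open>iwasawa_unique\<close>).\<close>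

section \<open>Linear endomorphisms of a complex vector space\<close>

lemma linear_compow:
  assumes "Vector_Spaces.linear sc sc T"
  shows "Vector_Spaces.linear sc sc (T ^^ n)"
proof (induction n)
  case 0
  have "vector_space sc" using assms by (simp add: Vector_Spaces.linear_def)
  then show ?case using vector_space.linear_id[of sc] by (simp add: id_def)
next
  case (Suc n)
  then show ?case using Vector_Spaces.linear_compose[OF Suc assms] by (simp add: o_def)
qed

locale complex_space = vector_space sc
  for sc :: "complex \<Rightarrow> 'v::ab_group_add \<Rightarrow> 'v"
begin

abbreviation lin :: "('v \<Rightarrow> 'v) \<Rightarrow> bool" where
  "lin T \<equiv> Vector_Spaces.linear sc sc T"

lemma linI:
  assumes "\<And>x y. T (x + y) = T x + T y" "\<And>c x. T (sc c x) = sc c (T x)"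
  shows "lin T"
  using assms vector_space_axioms by (simp add: Vector_Spaces.linear_iff)

lemma lin_add: "lin T \<Longrightarrow> T (x + y) = T x + T y"
  and lin_scale: "lin T \<Longrightarrow> T (sc c x) = sc c (T x)"
  by (simp_all add: Vector_Spaces.linear_iff)

lemma lin_zero: "lin T \<Longrightarrow> T 0 = 0"
  using lin_scale[of T 0 0] by simp

lemma lin_neg: "lin T \<Longrightarrow> T (- x) = - T x"
  using lin_scale[of T "-1" x] by simp

lemma lin_diff: "lin T \<Longrightarrow> T (x - y) = T x - T y"
  using lin_add[of T x "- y"] lin_neg[of T y] by simp

lemma lin_sum: "lin T \<Longrightarrow> T (sum g A) = (\<Sum>a\<in>A. T (g a))"
  by (induction A rule: infinite_finite_induct) (auto simp: lin_add lin_zero)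

lemma lin_inv:
  assumes "lin T" "bij T"
  shows "lin (inv_into UNIV T)"
proof (rule linI)
  fix x y c
  have [simp]: "T (inv_into UNIV T z) = z" for z using assms(2) by (simp add: bij_is_surj surj_f_inv_f)
  have [simp]: "inv_into UNIV T (T z) = z" for z using assms(2) by (simp add: bij_is_inj)
  have "T (inv_into UNIV T x + inv_into UNIV T y) = x + y" using lin_add[OF assms(1)] by simp
  then show "inv_into UNIV T (x + y) = inv_into UNIV T x + inv_into UNIV T y" by (metis \<open>\<And>z. inv_into UNIV T (T z) = z\<close>)
  have "T (sc c (inv_into UNIV T x)) = sc c x" using lin_scale[OF assms(1)] by simp
  then show "inv_into UNIV T (sc c x) = sc c (inv_into UNIV T x)" by (metis \<open>\<And>z. inv_into UNIV T (T z) = z\<close>)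
qed

lemma lin_eq_on_span:
  assumes "lin S" "lin T" "\<And>x. x \<in> B \<Longrightarrow> S x = T x" "v \<in> span B"
  shows "S v = T v"
  using assms(4)
  by (induction rule: span_induct_alt)
     (auto simp: lin_zero lin_add lin_scale assms(1-3))

end

section \<open>Exponentials of locally nilpotent operators\<close>

context complex_space
begin

lemma compow_eq_0_mono:
  assumes "lin T" "(T ^^ n) v = 0" "n \<le> k"
  shows "(T ^^ k) v = 0"
proof -
  have "(T ^^ k) v = (T ^^ (k - n)) ((T ^^ n) v)"
    using funpow_add[of "k - n" n T] assms(3) by simp
  then show ?thesis using assms lin_zero[OF linear_compow[OF assms(1)]] by simp
qed

lemma op_exp_eq_sum:
  assumes "lin T" "(T ^^ N) v = 0"
  shows "op_exp sc T v = (\<Sum>n<N. sc (1 / fact n) ((T ^^ n) v))"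
proof -
  have "{n. (T ^^ n) v \<noteq> 0} \<subseteq> {..<N}"
    using compow_eq_0_mono[OF assms] not_le by blast
  then show ?thesis unfolding op_exp_def by (intro sum.mono_neutral_left) auto
qed

lemma locally_nilpotent_uniform:
  assumes "lin T" "\<And>v. \<exists>n. (T ^^ n) v = 0" "finite A"
  obtains N where "\<And>v. v \<in> A \<Longrightarrow> (T ^^ N) v = 0"
proof -
  from assms(2) obtain d where d: "\<And>v. (T ^^ d v) v = 0" by metis
  show ?thesis
    using compow_eq_0_mono[OF assms(1) d] assms(3) by (intro that[of "Max (d ` A)"]) simp
qed

lemma op_exp_intertwine:
  assumes "lin X" "lin T" "lin T'" "\<And>v. X (T v) = T' (X v)"
    and "\<And>v. \<exists>n. (T ^^ n) v = 0"
  shows "X (op_exp sc T v) = op_exp sc T' (X v)"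
proof -
  have pow: "X ((T ^^ n) v) = (T' ^^ n) (X v)" for n
    by (induction n) (simp_all add: assms(4))
  obtain N where N: "(T ^^ N) v = 0" using assms(5) by blast
  then have N': "(T' ^^ N) (X v) = 0" using pow[of N] lin_zero[OF assms(1)] by simp
  show ?thesis
    by (simp add: op_exp_eq_sum[OF assms(2) N] op_exp_eq_sum[OF assms(3) N'] lin_sum[OF assms(1)]
        lin_scale[OF assms(1)] pow)
qed

lemma op_exp_linear:
  assumes "lin T" "\<And>v. \<exists>n. (T ^^ n) v = 0"
  shows "lin (op_exp sc T)"
proof (rule linI)
  note lp = linear_compow[OF assms(1)]
  fix x y c
  obtain N where N: "\<And>v. v \<in> {x, y, x + y} \<Longrightarrow> (T ^^ N) v = 0"
    using locally_nilpotent_uniform[OF assms, of "{x, y, x + y}"] by auto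
  show "op_exp sc T (x + y) = op_exp sc T x + op_exp sc T y"
    using N by (simp add: op_exp_eq_sum[OF assms(1), where N = N] lin_add[OF lp] scale_right_distrib
        sum.distrib)
  show "op_exp sc T (sc c x) = sc c (op_exp sc T x)"
    using op_exp_intertwine[of "sc c" T T] assms
    by (simp add: lin_scale linI scale_right_distrib mult.commute)
qed

text \<open>Collecting the double sum by the power of \<open>T\<close> leaves the alternating sums of binomial coefficients, which vanish
  except in degree \<open>0\<close>.\<close>

lemma op_exp_neg_inverse:
  assumes "lin T" "\<And>v. \<exists>n. (T ^^ n) v = 0"
  shows "op_exp sc T (op_exp sc (\<lambda>v. - T v) v) = v"
proof -
  note lp = linear_compow[OF assms(1)]
  have neg: "lin (\<lambda>v. - T v)"
    by (rule linI) (simp_all add: lin_add lin_scale assms(1))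
  have negpow: "((\<lambda>v. - T v) ^^ n) v = sc ((-1) ^ n) ((T ^^ n) v)" for n
    by (induction n) (simp_all add: lin_scale[OF assms(1)])
  obtain N where N: "(T ^^ N) v = 0" using assms(2) by blast
  have z: "(T ^^ n) v = 0" if "n \<ge> N" for n using compow_eq_0_mono[OF assms(1) N that] .
  have "op_exp sc (\<lambda>v. - T v) v = (\<Sum>k<N. sc ((-1) ^ k / fact k) ((T ^^ k) v))"
    using op_exp_eq_sum[OF neg, of N v] N by (simp add: negpow)
  then have "op_exp sc T (op_exp sc (\<lambda>v. - T v) v)
      = (\<Sum>k<N. sc ((-1) ^ k / fact k) (op_exp sc T ((T ^^ k) v)))"
    by (simp add: lin_sum[OF op_exp_linear[OF assms]] lin_scale[OF op_exp_linear[OF assms]])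
  also have "\<dots> = (\<Sum>k<N. \<Sum>j<N. sc ((-1) ^ k / (fact k * fact j)) ((T ^^ (k + j)) v))"
  proof (rule sum.cong[OF refl])
    fix k assume "k \<in> {..<N}"
    have "(T ^^ N) ((T ^^ k) v) = 0" using z[of "N + k"] by (simp add: funpow_add)
    from op_exp_eq_sum[OF assms(1) this]
    show "sc ((-1) ^ k / fact k) (op_exp sc T ((T ^^ k) v))
      = (\<Sum>j<N. sc ((-1) ^ k / (fact k * fact j)) ((T ^^ (k + j)) v))"
      by (simp add: scale_sum_right funpow_add add.commute[of k])
  qed
  also have "\<dots> = (\<Sum>(k, j)\<in>{..<N} \<times> {..<N}. sc ((-1) ^ k / (fact k * fact j)) ((T ^^ (k + j)) v))"
    by (simp add: sum.cartesian_product)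
  also have "\<dots> = (\<Sum>(k, j)\<in>{(k, j). k + j < N}. sc ((-1) ^ k / (fact k * fact j)) ((T ^^ (k + j)) v))"
    by (intro sum.mono_neutral_right) (auto, metis not_le z)
  also have "\<dots> = (\<Sum>n<N. \<Sum>k\<le>n. sc ((-1) ^ k / (fact k * fact (n - k))) ((T ^^ (k + (n - k))) v))"
    by (rule sum.triangle_reindex)
  also have "\<dots> = (\<Sum>n<N. sc (\<Sum>k\<le>n. (-1) ^ k / (fact k * fact (n - k))) ((T ^^ n) v))"
    by (intro sum.cong refl) (simp add: scale_sum_left)
  also have "\<dots> = (\<Sum>n<N. if n = 0 then v else 0)"
  proof (intro sum.cong refl)
    fix n assume "n \<in> {..<N}"
    have "(\<Sum>k\<le>n. (-1) ^ k / (fact k * fact (n - k))) = (\<Sum>k\<le>n. of_nat (n choose k) * (-1) ^ k * 1 ^ (n - k)) / (fact n :: complex)"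
      by (simp add: sum_divide_distrib binomial_fact field_simps)
    also have "\<dots> = (-1 + 1) ^ n / fact n"
      by (subst binomial_ring) simp
    finally have "(\<Sum>k\<le>n. (-1) ^ k / (fact k * fact (n - k))) = (if n = 0 then 1 else (0::complex))"
      by (simp add: power_0_left)
    then show "sc (\<Sum>k\<le>n. (-1) ^ k / (fact k * fact (n - k))) ((T ^^ n) v) = (if n = 0 then v else 0)"
      by simp
  qed
  also have "\<dots> = v" using N by (cases N) auto
  finally show ?thesis .
qed

lemma op_exp_bij:
  assumes "lin T" "\<And>v. \<exists>n. (T ^^ n) v = 0"
  shows "bij (op_exp sc T)"
proof -
  have neg: "lin (\<lambda>v. - T v)"
    by (rule linI) (simp_all add: lin_add lin_scale assms(1))
  have "((\<lambda>v. - T v) ^^ n) v = sc ((-1) ^ n) ((T ^^ n) v)" for n v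
    by (induction n) (simp_all add: lin_scale[OF assms(1)])
  then have nil: "\<exists>n. ((\<lambda>v. - T v) ^^ n) v = 0" for v
    using assms(2)[of v] by (metis scale_zero_right)
  show ?thesis
    using op_exp_neg_inverse[OF neg nil] op_exp_neg_inverse[OF assms]
    by (intro o_bij[of "op_exp sc (\<lambda>v. - T v)"]) (auto simp: fun_eq_iff)
qed

end

section \<open>Weight spaces\<close>

lemma pairing_add_left: "pairing (a + b) h = pairing a h + pairing b h"
  and pairing_diff_left: "pairing (a - b) h = pairing a h - pairing b h"
  and pairing_scale_left: "pairing (c *s a) h = c * pairing a h"
  and pairing_minus_left: "pairing (- a) h = - pairing a h"
  and pairing_zero_left: "pairing 0 h = 0"
  and pairing_add_right: "pairing a (h + h') = pairing a h + pairing a h'"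
  and pairing_diff_right: "pairing a (h - h') = pairing a h - pairing a h'"
  and pairing_scale_right: "pairing a (c *s h) = c * pairing a h"
  and pairing_minus_right: "pairing a (- h) = - pairing a h"
  by (simp_all add: pairing_def algebra_simps sum.distrib sum_subtractf sum_distrib_left sum_negf)

lemmas pairing_simps = pairing_add_left pairing_diff_left pairing_scale_left pairing_minus_left
  pairing_zero_left pairing_add_right pairing_diff_right pairing_scale_right pairing_minus_right

lemma pairing_coroot: "pairing a (simple_coroot i) = a $ i"
proof -
  have "pairing a (simple_coroot i) = (\<Sum>j\<in>UNIV. if i = j then a $ j else 0)"
    by (simp add: pairing_def simple_coroot_def axis_def if_distrib cong: if_cong)
  then show ?thesis by simp
qed

lemma weight_eqI: "(\<And>h. pairing a h = pairing b h) \<Longrightarrow> a = b"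
  by (metis pairing_coroot vec_eq_iff)

locale weight_module = complex_space sc
  for sc :: "complex \<Rightarrow> 'v::ab_group_add \<Rightarrow> 'v" +
  fixes hh :: "complex^2 \<Rightarrow> 'v \<Rightarrow> 'v"
  assumes hh_lin: "lin (hh x)"
begin

definition wspace :: "complex^2 \<Rightarrow> 'v set" where
  "wspace \<mu> = {v. \<forall>x. hh x v = sc (pairing \<mu> x) v}"

lemma wspaceI: "(\<And>x. hh x v = sc (pairing \<mu> x) v) \<Longrightarrow> v \<in> wspace \<mu>"
  and wspaceD: "v \<in> wspace \<mu> \<Longrightarrow> hh x v = sc (pairing \<mu> x) v"
  by (auto simp: wspace_def)

lemma wspace_subspace: "subspace (wspace \<mu>)"
  unfolding subspace_def wspace_def
  by (auto simp: lin_add[OF hh_lin] lin_scale[OF hh_lin] lin_zero[OF hh_lin] scale_right_distrib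
      mult.commute)

lemma wspace_independent:
  assumes "finite I" "\<And>\<mu>. \<mu> \<in> I \<Longrightarrow> x \<mu> \<in> wspace \<mu>" "(\<Sum>\<mu>\<in>I. x \<mu>) = 0" "\<mu> \<in> I"
  shows "x \<mu> = 0"
  using assms
proof (induction I arbitrary: x \<mu> rule: finite_induct)
  case (insert \<mu>\<^sub>0 I)
  \<comment> \<open>Applying \<open>h - \<mu>\<^sub>0(h)\<close> to the relation removes the \<open>\<mu>\<^sub>0\<close> component.\<close>
  have *: "x \<mu> = 0" if "\<mu> \<in> I" for \<mu>
  proof -
    have "\<mu> \<noteq> \<mu>\<^sub>0" using insert that by auto
    then obtain h where h: "pairing \<mu> h \<noteq> pairing \<mu>\<^sub>0 h" using weight_eqI by blast
    define y where "y \<kappa> = sc (pairing \<kappa> h - pairing \<mu>\<^sub>0 h) (x \<kappa>)" for \<kappa>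
    have "0 = hh h (\<Sum>\<kappa>\<in>insert \<mu>\<^sub>0 I. x \<kappa>) - sc (pairing \<mu>\<^sub>0 h) (\<Sum>\<kappa>\<in>insert \<mu>\<^sub>0 I. x \<kappa>)"
      using insert.prems(2) by (simp add: lin_zero[OF hh_lin])
    also have "\<dots> = (\<Sum>\<kappa>\<in>insert \<mu>\<^sub>0 I. y \<kappa>)"
      unfolding lin_sum[OF hh_lin] scale_sum_right sum_subtractf[symmetric] y_def
      using insert.prems(1) by (intro sum.cong refl) (simp add: wspaceD scale_left_diff_distrib)
    also have "\<dots> = (\<Sum>\<kappa>\<in>I. y \<kappa>)" using insert.hyps by (simp add: y_def)
    finally have "(\<Sum>\<kappa>\<in>I. y \<kappa>) = 0" by simp
    moreover have "y \<kappa> \<in> wspace \<kappa>" if "\<kappa> \<in> I" for \<kappa>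
      unfolding y_def using insert.prems(1) that by (auto intro: subspace_scale wspace_subspace)
    ultimately have "y \<mu> = 0" using insert.IH that by blast
    then show ?thesis using h by (simp add: y_def)
  qed
  then have "x \<mu>\<^sub>0 = 0" using insert.prems(2) insert.hyps by simp
  with * insert.prems(3) show ?case by blast
qed simp

lemma span_decompose:
  assumes "x \<in> span S" "\<And>s. s \<in> S \<Longrightarrow> \<exists>\<mu>. s \<in> wspace \<mu>"
  shows "\<exists>I y. finite I \<and> (\<forall>\<mu>. y \<mu> \<in> span (S \<inter> wspace \<mu>)) \<and> x = (\<Sum>\<mu>\<in>I. y \<mu>)"
  using assms(1)
proof (induction rule: span_induct_alt)
  case base
  then show ?case by (intro exI[of _ "{}"] exI[of _ "\<lambda>_. 0"]) (simp add: span_zero)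
next
  case (step c s x)
  then obtain I y where I: "finite I" "\<And>\<mu>. y \<mu> \<in> span (S \<inter> wspace \<mu>)" "x = (\<Sum>\<mu>\<in>I. y \<mu>)"
    by blast
  obtain \<kappa> where \<kappa>: "s \<in> wspace \<kappa>" using assms(2) step by blast
  define z where "z \<mu> = (if \<mu> \<in> I then y \<mu> else 0) + (if \<mu> = \<kappa> then sc c s else 0)" for \<mu>
  have "sc c s \<in> span (S \<inter> wspace \<kappa>)"
    using \<kappa> step(1) by (intro span_scale span_base) auto
  then have "z \<mu> \<in> span (S \<inter> wspace \<mu>)" for \<mu>
    unfolding z_def using I(2)[of \<mu>] by (intro span_add) (simp_all add: span_zero)
  moreover have "(\<Sum>\<mu>\<in>insert \<kappa> I. if \<mu> \<in> I then y \<mu> else 0) = x"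
    unfolding I(3) using I(1) by (intro sum.mono_neutral_cong_right) auto
  then have "sc c s + x = (\<Sum>\<mu>\<in>insert \<kappa> I. z \<mu>)"
    using I(1) by (simp add: z_def sum.distrib add.commute del: sum.insert)
  ultimately show ?case using I(1) by (intro exI[of _ "insert \<kappa> I"] exI[of _ z]) auto
qed

text \<open>Grouping a linear combination of weight vectors by weight and comparing with \<open>x\<close>, all groups but the one of
  weight \<open>\<mu>\<close> vanish by independence of the weight spaces. This is how weights of a module are determined from
  spanning weight vectors: its nonzero weight spaces are met by the spanning set.\<close>

lemma span_weight_component:
  assumes "x \<in> span S" "\<And>s. s \<in> S \<Longrightarrow> \<exists>\<mu>. s \<in> wspace \<mu>" "x \<in> wspace \<mu>"
  shows "x \<in> span (S \<inter> wspace \<mu>)"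
proof -
  obtain I y where I: "finite I" "\<And>\<kappa>. y \<kappa> \<in> span (S \<inter> wspace \<kappa>)" "x = (\<Sum>\<kappa>\<in>I. y \<kappa>)"
    using span_decompose[OF assms(1,2)] by blast
  have y: "y \<kappa> \<in> wspace \<kappa>" for \<kappa>
    using I(2)[of \<kappa>] span_minimal[OF _ wspace_subspace, of "S \<inter> wspace \<kappa>"] by blast
  define z where "z \<kappa> = (if \<kappa> \<in> I then y \<kappa> else 0) - (if \<kappa> = \<mu> then x else 0)" for \<kappa>
  have "(\<Sum>\<kappa>\<in>insert \<mu> I. if \<kappa> \<in> I then y \<kappa> else 0) = x"
    unfolding I(3) using I(1) by (intro sum.mono_neutral_cong_right) auto
  then have "(\<Sum>\<kappa>\<in>insert \<mu> I. z \<kappa>) = 0"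
    using I(1) by (simp add: z_def sum_subtractf del: sum.insert)
  then have "z \<mu> = 0"
    using I(1) y assms(3)
    by (intro wspace_independent[of "insert \<mu> I" z \<mu>])
       (auto simp: z_def intro: subspace_diff subspace_0 subspace_neg wspace_subspace)
  then have "x = (if \<mu> \<in> I then y \<mu> else 0)" by (simp add: z_def)
  then show ?thesis using I(2)[of \<mu>] by (auto simp: span_zero split: if_splits)
qed

lemma span_weight_component_nonzero:
  assumes "x \<in> span S" "\<And>s. s \<in> S \<Longrightarrow> \<exists>\<mu>. s \<in> wspace \<mu>" "x \<in> wspace \<mu>" "x \<noteq> 0"
  obtains s where "s \<in> S" "s \<in> wspace \<mu>" "s \<noteq> 0"
proof -
  have "\<not> S \<inter> wspace \<mu> \<subseteq> {0}"
  proof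
    assume "S \<inter> wspace \<mu> \<subseteq> {0}"
    then have "span (S \<inter> wspace \<mu>) \<subseteq> {0}" by (intro span_minimal) auto
    then show False using span_weight_component[OF assms(1-3)] assms(4) by auto
  qed
  then show ?thesis using that by auto
qed

lemma wspace_disjoint:
  assumes "v \<in> wspace \<mu>" "v \<in> wspace \<kappa>" "v \<noteq> 0"
  shows "\<mu> = \<kappa>"
  using assms by (intro weight_eqI) (metis scale_right_imp_eq wspaceD)

text \<open>The operator is defined on a maximal independent set of weight vectors. It acts as prescribed on all of a weight space
  because this space is spanned by the members of the set that it contains.\<close>

lemma diagonal_operator_exists:
  assumes "span (\<Union>\<mu>. wspace \<mu>) = UNIV"
  obtains D where "lin D" "\<And>\<mu> v. v \<in> wspace \<mu> \<Longrightarrow> D v = sc (d \<mu>) v"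
proof -
  obtain B where B: "B \<subseteq> (\<Union>\<mu>. wspace \<mu>)" "independent B" "(\<Union>\<mu>. wspace \<mu>) \<subseteq> span B"
    by (rule maximal_independent_subset[of "\<Union>\<mu>. wspace \<mu>"]) blast
  have "\<forall>b\<in>B. \<exists>\<mu>. b \<in> wspace \<mu>" using B(1) by blast
  then obtain wt where wt: "\<And>b. b \<in> B \<Longrightarrow> b \<in> wspace (wt b)" by metis
  interpret vector_space_pair sc sc by unfold_locales
  obtain D where D: "lin D" "\<And>b. b \<in> B \<Longrightarrow> D b = sc (d (wt b)) b"
    using linear_independent_extend[OF B(2), of "\<lambda>b. sc (d (wt b)) b"] by blast
  show ?thesis
  proof (rule that[OF D(1)])
    fix \<mu> v assume v: "v \<in> wspace \<mu>"
    have "v \<in> span B" using B(3) v by blast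
    then have "v \<in> span (B \<inter> wspace \<mu>)" using span_weight_component[OF _ _ v] wt by blast
    moreover have "lin (sc (d \<mu>))" by (rule linI) (simp_all add: scale_right_distrib mult.commute)
    moreover have "D b = sc (d \<mu>) b" if "b \<in> B \<inter> wspace \<mu>" for b
    proof -
      have "b \<noteq> 0" using that B(2) dependent_zero by blast
      then have "wt b = \<mu>" using wspace_disjoint wt that by blast
      then show ?thesis using D(2) that by blast
    qed
    ultimately show "D v = sc (d \<mu>) v" using lin_eq_on_span[OF D(1)] by blast
  qed
qed

end

section \<open>The action of a simple reflection on an integrable module\<close>

text \<open>The operators by which a triple \<open>e\<^sub>i\<close>, \<open>f\<^sub>i\<close>, \<open>h\<^sub>i\<close> and the whole Cartan subalgebra act on a
  representation, with \<open>al\<close> the simple root and \<open>c\<close> the simple coroot. It is used for the highest weight module and for the adjoint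
  representation. Exchanging \<open>e\<close> with \<open>f\<close> and reversing the sign of \<open>h\<close>, or rescaling \<open>e\<close> and \<open>f\<close> inversely, gives such
  a triple again.\<close>

locale sl2_module = weight_module sc hh
  for sc :: "complex \<Rightarrow> 'v::ab_group_add \<Rightarrow> 'v" and hh +
  fixes e f :: "'v \<Rightarrow> 'v" and al c :: "complex^2"
  assumes e_lin: "lin e" and f_lin: "lin f"
    and hh_e: "hh x (e v) = e (hh x v) + sc (pairing al x) (e v)"
    and hh_f: "hh x (f v) = f (hh x v) - sc (pairing al x) (f v)"
    and e_f: "e (f v) = f (e v) + hh c v"
    and al_c: "pairing al c = 2"
begin

lemmas lins = lin_add[OF e_lin] lin_scale[OF e_lin] lin_diff[OF e_lin] lin_neg[OF e_lin]
  lin_add[OF f_lin] lin_scale[OF f_lin] lin_diff[OF f_lin] lin_neg[OF f_lin]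
  lin_add[OF hh_lin] lin_scale[OF hh_lin] lin_diff[OF hh_lin] lin_neg[OF hh_lin]

lemma swap: "sl2_module sc (\<lambda>x v. - hh x v) f e al c"
  by unfold_locales
    (auto intro!: linI simp: lins e_lin f_lin hh_e hh_f e_f al_c)

lemma rescale: "t \<noteq> 0 \<Longrightarrow> sl2_module sc hh (\<lambda>v. sc t (e v)) (\<lambda>v. sc (inverse t) (f v)) al c"
  by unfold_locales
    (auto intro!: linI simp: lins e_lin f_lin hh_e hh_f e_f al_c scale_right_distrib
      scale_right_diff_distrib mult.commute)

lemma e_wspace: "v \<in> wspace \<mu> \<Longrightarrow> e v \<in> wspace (\<mu> + al)"
  by (intro wspaceI) (simp add: hh_e wspaceD lins pairing_simps scale_left_distrib)

lemma f_wspace: "v \<in> wspace \<mu> \<Longrightarrow> f v \<in> wspace (\<mu> - al)"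
  by (intro wspaceI) (simp add: hh_f wspaceD lins pairing_simps scale_left_diff_distrib)

lemma e_pow_wspace: "v \<in> wspace \<mu> \<Longrightarrow> (e ^^ n) v \<in> wspace (\<mu> + of_nat n *s al)"
  by (induction n)
    (auto dest: e_wspace simp: algebra_simps vector_sadd_rdistrib)

lemma e_pow_hh: "(e ^^ n) (hh x v) = hh x ((e ^^ n) v) - sc (of_nat n * pairing al x) ((e ^^ n) v)"
proof (induction n)
  case (Suc n)
  show ?case by (simp add: Suc.IH lins hh_e scale_left_distrib distrib_right)
qed simp

lemma e_pow_f:
  "(e ^^ n) (f v) = f ((e ^^ n) v) + sc (of_nat n) (hh c ((e ^^ (n - 1)) v))
     - sc (of_nat n * (of_nat n - 1)) ((e ^^ (n - 1)) v)"
proof (induction n)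
  case (Suc n)
  show ?case
  proof (cases n)
    case (Suc k)
    have "e (hh c ((e ^^ k) v)) = hh c ((e ^^ n) v) - sc 2 ((e ^^ n) v)"
      using hh_e[of c "(e ^^ k) v"] by (simp add: Suc al_c)
    moreover have "sc (of_nat n + 1) x = sc (of_nat n) x + x" for x
      by (simp add: scale_left_distrib)
    moreover have "sc ((of_nat n + 1) * of_nat n) x
        = sc (of_nat n * (of_nat n - 1)) x + sc (of_nat n) (sc 2 x)" for x
      by (simp add: algebra_simps flip: scale_left_distrib)
    ultimately show ?thesis
      using Suc.IH unfolding Suc
      by (simp add: lins e_f scale_right_diff_distrib del: scale_scale)
  qed (simp add: e_f)
qed simp

end

locale integrable_sl2_module = sl2_module +
  assumes e_nil: "\<exists>n. (e ^^ n) v = 0" and f_nil: "\<exists>n. (f ^^ n) v = 0"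
begin

lemma swap_integrable: "integrable_sl2_module sc (\<lambda>x v. - hh x v) f e al c"
  using swap by (simp add: integrable_sl2_module_def integrable_sl2_module_axioms_def e_nil f_nil)

lemma rescale_integrable:
  assumes "t \<noteq> 0"
  shows "integrable_sl2_module sc hh (\<lambda>v. sc t (e v)) (\<lambda>v. sc (inverse t) (f v)) al c"
proof -
  have "((\<lambda>v. sc s (T v)) ^^ n) v = sc (s ^ n) ((T ^^ n) v)" if "lin T" for T s n v
    by (induction n) (simp_all add: lin_scale[OF that])
  then have "\<exists>n. ((\<lambda>v. sc s (T v)) ^^ n) v = 0" if "lin T" "\<exists>n. (T ^^ n) v = 0" for T s v
    using that by (metis scale_zero_right)
  then show ?thesis
    using rescale[OF assms] e_nil f_nil e_lin f_lin
    by (simp add: integrable_sl2_module_def integrable_sl2_module_axioms_def)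
qed

lemma scale_fact_Suc: "sc (1 / fact (Suc n)) (sc (of_nat (Suc n) * a) x) = sc (1 / fact n) (sc a x)"
proof -
  have "of_nat (Suc n) \<noteq> (0::complex)" by (rule of_nat_neq_0)
  then show ?thesis by (simp add: field_simps del: of_nat_Suc)
qed

text \<open>Summed over \<open>n\<close>, the commutation rules for \<open>e\<^sup>n\<close> express that conjugation by \<open>exp e\<close> is \<open>exp (ad e)\<close>: it maps
  \<open>x\<close> to \<open>x - \<alpha>(x) e\<close> and \<open>f\<close> to \<open>f + h - e\<close>.\<close>

lemma op_exp_e_hh:
  "op_exp sc e (hh x v) = hh x (op_exp sc e v) - sc (pairing al x) (e (op_exp sc e v))"
proof -
  obtain N where N: "(e ^^ N) v = 0" using e_nil by blast
  have N2: "(e ^^ Suc N) v = 0" "(e ^^ Suc N) (hh x v) = 0"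
    using N by (simp_all add: lin_zero[OF e_lin] e_pow_hh lin_zero[OF hh_lin])
  have "op_exp sc e (hh x v) = (\<Sum>n<Suc N. sc (1 / fact n) (hh x ((e ^^ n) v)))
      - (\<Sum>n<Suc N. sc (1 / fact n) (sc (of_nat n * pairing al x) ((e ^^ n) v)))"
    by (simp add: op_exp_eq_sum[OF e_lin N2(2)] e_pow_hh scale_right_diff_distrib sum_subtractf)
  also have "(\<Sum>n<Suc N. sc (1 / fact n) (hh x ((e ^^ n) v))) = hh x (op_exp sc e v)"
    by (simp only: op_exp_eq_sum[OF e_lin N2(1)] lin_sum[OF hh_lin] lin_scale[OF hh_lin])
  also have "(\<Sum>n<Suc N. sc (1 / fact n) (sc (of_nat n * pairing al x) ((e ^^ n) v)))
      = (\<Sum>n<N. sc (pairing al x) (e (sc (1 / fact n) ((e ^^ n) v))))"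
    by (simp only: sum.lessThan_Suc_shift scale_fact_Suc lins)
      (simp add: mult.commute)
  also have "\<dots> = sc (pairing al x) (e (op_exp sc e v))"
    by (simp only: op_exp_eq_sum[OF e_lin N] lin_sum[OF e_lin] scale_sum_right)
  finally show ?thesis .
qed

lemma op_exp_e_e: "op_exp sc e (e v) = e (op_exp sc e v)"
  using op_exp_intertwine[of e e e v] e_lin e_nil by simp

lemma op_exp_e_f:
  "op_exp sc e (f v) = f (op_exp sc e v) + hh c (op_exp sc e v) - e (op_exp sc e v)"
proof -
  obtain N where N: "(e ^^ N) v = 0" using e_nil by blast
  have N1: "(e ^^ Suc N) v = 0" "(e ^^ Suc (Suc N)) v = 0"
    using N by (simp_all add: lin_zero[OF e_lin])
  then have N2: "(e ^^ Suc (Suc N)) (f v) = 0"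
    by (simp only: e_pow_f diff_Suc_1) (simp add: lin_zero[OF hh_lin] lin_zero[OF f_lin])
  let ?S = "\<lambda>g. \<Sum>n<Suc (Suc N). sc (1 / fact n) (g n)"
  have "op_exp sc e (f v) = ?S (\<lambda>n. f ((e ^^ n) v)) + ?S (\<lambda>n. sc (of_nat n) (hh c ((e ^^ (n - 1)) v)))
      - ?S (\<lambda>n. sc (of_nat n * (of_nat n - 1)) ((e ^^ (n - 1)) v))"
    by (simp only: op_exp_eq_sum[OF e_lin N2] e_pow_f scale_right_diff_distrib scale_right_distrib
        sum_subtractf sum.distrib)
  also have "?S (\<lambda>n. f ((e ^^ n) v)) = f (op_exp sc e v)"
    by (simp only: op_exp_eq_sum[OF e_lin N1(2)] lin_sum[OF f_lin] lin_scale[OF f_lin])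
  also have "?S (\<lambda>n. sc (of_nat n) (hh c ((e ^^ (n - 1)) v)))
      = (\<Sum>n<Suc N. hh c (sc (1 / fact n) ((e ^^ n) v)))"
    using scale_fact_Suc[of _ 1]
    by (simp only: sum.lessThan_Suc_shift[of _ "Suc N"] diff_Suc_1 lins mult_1_right scale_one) simp
  also have "\<dots> = hh c (op_exp sc e v)"
    by (simp only: op_exp_eq_sum[OF e_lin N1(1)] lin_sum[OF hh_lin])
  also have "?S (\<lambda>n. sc (of_nat n * (of_nat n - 1)) ((e ^^ (n - 1)) v))
      = (\<Sum>n<N. e (sc (1 / fact n) ((e ^^ n) v)))"
  proof -
    have "of_nat (Suc (Suc n)) - 1 = (of_nat (Suc n) * 1 :: complex)" for n by simp
    then show ?thesis
      by (simp only: sum.lessThan_Suc_shift[of _ "Suc N"] sum.lessThan_Suc_shift[of _ N] scale_fact_Suc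
          diff_Suc_1 funpow.simps o_apply lins) simp
  qed
  also have "\<dots> = e (op_exp sc e v)"
    by (simp only: op_exp_eq_sum[OF e_lin N] lin_sum[OF e_lin])
  finally show ?thesis .
qed

abbreviation "expE \<equiv> op_exp sc e"
abbreviation "expF \<equiv> op_exp sc (\<lambda>v. - f v)"

definition weyl_op :: "'a \<Rightarrow> 'a" where "weyl_op = expE \<circ> expF \<circ> expE"

text \<open>The triple \<open>-f\<close>, \<open>-e\<close>, \<open>-h\<close> turns the rules for \<open>exp e\<close> into those for \<open>exp (-f)\<close>.\<close>

lemma neg_swap: "integrable_sl2_module sc (\<lambda>x v. - hh x v) (\<lambda>v. - f v) (\<lambda>v. - e v) al c"
  using integrable_sl2_module.rescale_integrable[OF swap_integrable, of "-1"] by simp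

lemma expE_lin: "lin expE" and expE_bij: "bij expE"
  using op_exp_linear[OF e_lin e_nil] op_exp_bij[OF e_lin e_nil] .

lemma expF_lin: "lin expF" and expF_bij: "bij expF"
  using integrable_sl2_module.expE_lin[OF neg_swap] integrable_sl2_module.expE_bij[OF neg_swap] .

lemma weyl_op_lin: "lin weyl_op"
  unfolding weyl_op_def by (rule Vector_Spaces.linear_compose[OF expE_lin Vector_Spaces.linear_compose[OF expF_lin expE_lin], unfolded o_assoc])

lemma weyl_op_bij: "bij weyl_op"
  unfolding weyl_op_def by (intro bij_comp expE_bij expF_bij)

lemma expF_hh: "expF (hh x v) = hh x (expF v) - sc (pairing al x) (f (expF v))"
  using integrable_sl2_module.op_exp_e_hh[OF neg_swap, of x v]
  by (simp add: lin_neg[OF expF_lin] algebra_simps)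

lemma expF_e: "expF (e v) = e (expF v) + hh c (expF v) - f (expF v)"
  using integrable_sl2_module.op_exp_e_f[OF neg_swap, of v]
  by (simp add: lin_neg[OF expF_lin] algebra_simps)

text \<open>The three conjugations map \<open>x\<close> to \<open>x - \<alpha>(x) e\<close>, then to \<open>x - \<alpha>(x) (e + h)\<close>, then to
  \<open>x - \<alpha>(x) h\<close>. So conjugation by the Weyl group element acts on the Cartan subalgebra as the simple reflection.\<close>

lemma weyl_op_hh: "weyl_op (hh x v) = hh x (weyl_op v) - sc (pairing al x) (hh c (weyl_op v))"
proof -
  let ?a = "pairing al x" and ?u = "expE v"
  note L = lin_add[OF expE_lin] lin_diff[OF expE_lin] lin_scale[OF expE_lin]
    lin_add[OF expF_lin] lin_diff[OF expF_lin] lin_scale[OF expF_lin]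
  have "weyl_op (hh x v) = expE (expF (hh x ?u - sc ?a (e ?u)))"
    by (simp add: weyl_op_def op_exp_e_hh)
  also have "\<dots> = expE (hh x (expF ?u) - sc ?a (e (expF ?u)) - sc ?a (hh c (expF ?u)))"
    by (simp add: L expF_hh expF_e scale_right_diff_distrib scale_right_distrib)
  also have "\<dots> = hh x (weyl_op v) - sc ?a (e (weyl_op v)) - sc ?a (e (weyl_op v))
      - sc ?a (hh c (weyl_op v) - sc 2 (e (weyl_op v)))"
    by (simp add: L op_exp_e_hh op_exp_e_e al_c weyl_op_def)
  also have "\<dots> = hh x (weyl_op v) - sc ?a (hh c (weyl_op v))"
    by (simp add: scale_right_diff_distrib flip: scale_left_distrib diff_diff_add)
       (simp add: algebra_simps flip: scale_left_distrib)
  finally show ?thesis .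
qed

definition reflect :: "complex^2 \<Rightarrow> complex^2" where
  "reflect \<mu> = \<mu> - pairing \<mu> c *s al"

lemma reflect_reflect: "reflect (reflect \<mu>) = \<mu>"
  by (simp add: reflect_def pairing_simps al_c vector_ssub_ldistrib flip: vector_sadd_rdistrib)

lemma weyl_op_wspace: "v \<in> wspace \<mu> \<Longrightarrow> weyl_op v \<in> wspace (reflect \<mu>)"
proof (rule wspaceI)
  fix x assume v: "v \<in> wspace \<mu>"
  have *: "sc (pairing \<mu> x) (weyl_op v) = hh x (weyl_op v) - sc (pairing al x) (hh c (weyl_op v))" for x
    using weyl_op_hh[of x v] wspaceD[OF v, of x] by (simp add: lin_scale[OF weyl_op_lin])
  have "sc (pairing \<mu> c) (weyl_op v) = hh c (weyl_op v) - (hh c (weyl_op v) + hh c (weyl_op v))"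
    using *[of c] scale_left_distrib[of 1 1 "hh c (weyl_op v)"] by (simp add: al_c)
  then have "hh c (weyl_op v) = - sc (pairing \<mu> c) (weyl_op v)" by simp
  then show "hh x (weyl_op v) = sc (pairing (reflect \<mu>) x) (weyl_op v)"
    using *[of x] by (simp add: reflect_def pairing_simps scale_left_diff_distrib mult.commute)
qed

lemma weyl_op_wspace_iff: "weyl_op v \<in> wspace (reflect \<mu>) \<longleftrightarrow> v \<in> wspace \<mu>"
proof
  assume v: "weyl_op v \<in> wspace (reflect \<mu>)"
  have "weyl_op (hh x v) = weyl_op (sc (pairing \<mu> x) v)" for x
    using weyl_op_hh[of x v] wspaceD[OF v] al_c
    by (simp add: lin_scale[OF weyl_op_lin] reflect_def pairing_simps algebra_simps flip: scale_left_diff_distrib)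
       (simp add: algebra_simps flip: scale_left_distrib scale_left_diff_distrib)
  then show "v \<in> wspace \<mu>" using weyl_op_bij by (intro wspaceI) (metis bij_is_inj inj_eq)
qed (rule weyl_op_wspace)

lemma inv_weyl_op_wspace: "v \<in> wspace \<mu> \<Longrightarrow> inv_into UNIV weyl_op v \<in> wspace (reflect \<mu>)"
  using weyl_op_wspace_iff[of "inv_into UNIV weyl_op v" "reflect \<mu>"]
  by (simp add: reflect_reflect bij_is_surj[OF weyl_op_bij] surj_f_inv_f)

lemma expE_wspace:
  assumes "v \<in> wspace \<mu>"
  obtains N y where "expE v = v + (\<Sum>n<N. y n)" "\<And>n. y n \<in> wspace (\<mu> + of_nat (Suc n) *s al)"
proof -
  obtain N where N: "(e ^^ N) v = 0" using e_nil by blast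
  then have N1: "(e ^^ Suc N) v = 0" by (simp add: lin_zero[OF e_lin])
  have "expE v = v + (\<Sum>n<N. sc (1 / fact (Suc n)) ((e ^^ Suc n) v))"
    by (subst op_exp_eq_sum[OF e_lin N1], subst sum.lessThan_Suc_shift) (simp del: fact_Suc)
  moreover have "sc (1 / fact (Suc n)) ((e ^^ Suc n) v) \<in> wspace (\<mu> + of_nat (Suc n) *s al)" for n
    using e_pow_wspace[OF assms, of "Suc n"] by (intro subspace_scale[OF wspace_subspace])
  ultimately show ?thesis by (rule that)
qed

text \<open>Let \<open>D = r\<^sup>h\<close> be the diagonal operator with \<open>r\<^sup>2 = t\<close>. Conjugation by \<open>D\<close> turns \<open>e\<close> into \<open>t e\<close> and \<open>f\<close> into
  \<open>t\<^sup>-\<^sup>1 f\<close>, hence \<open>w(1)\<close> into \<open>w(t)\<close>, while conjugation by \<open>w(1)\<close> inverts \<open>D\<close>. Therefore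
  \<open>w(t) w(1)\<^sup>-\<^sup>1 = D w(1) D\<^sup>-\<^sup>1 w(1)\<^sup>-\<^sup>1 = D\<^sup>2\<close>.\<close>

lemma torus_action:
  assumes span: "span (\<Union>\<mu>. wspace \<mu>) = UNIV" and t: "(t::real) > 0" and v: "v \<in> wspace \<mu>"
  shows "integrable_sl2_module.weyl_op sc (\<lambda>v. sc (of_real t) (e v)) (\<lambda>v. sc (inverse (of_real t)) (f v))
           (inv_into UNIV weyl_op v) = sc (of_real t powr pairing \<mu> c) v"
proof -
  define r :: complex where "r = of_real (sqrt t)"
  have r0: "r \<noteq> 0" using t by (simp add: r_def)
  have r2: "r * r = of_real t" using t by (simp add: r_def flip: of_real_mult)
  have rpow: "r powr z * r powr z = of_real t powr z" for z
    using t by (simp add: r_def powr_def Ln_of_real ln_sqrt flip: exp_add distrib_left of_real_add)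
  obtain D where D: "lin D" "\<And>\<kappa> v. v \<in> wspace \<kappa> \<Longrightarrow> D v = sc (r powr pairing \<kappa> c) v"
    using diagonal_operator_exists[OF span, of "\<lambda>\<kappa>. r powr pairing \<kappa> c"] by metis
  let ?e = "\<lambda>v. sc (of_real t) (e v)" and ?f = "\<lambda>v. sc (inverse (of_real t)) (f v)"
  interpret R: integrable_sl2_module sc hh ?e ?f al c
    using rescale_integrable[of "of_real t"] t by simp
  have p2: "r powr (z + 2) = of_real t * r powr z" "r powr (z - 2) = inverse (of_real t) * r powr z" for z
    using r0 powr_nat'[of r 2] r2 by (simp_all add: powr_add powr_diff powr_numeral power2_eq_square field_simps)
  have De: "D (e x) = ?e (D x)" for x
  proof (rule lin_eq_on_span[of "\<lambda>x. D (e x)" "\<lambda>x. ?e (D x)" "\<Union>\<mu>. wspace \<mu>"])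
    show "lin (\<lambda>x. D (e x))" "lin (\<lambda>x. ?e (D x))"
      by (auto intro!: linI simp: lins lin_add[OF D(1)] lin_scale[OF D(1)] scale_right_distrib mult.commute)
    show "D (e y) = ?e (D y)" if mem: "y \<in> (\<Union>\<mu>. wspace \<mu>)" for y
    proof -
      obtain \<kappa> where y: "y \<in> wspace \<kappa>" using mem by blast
      show ?thesis using D(2)[OF y] D(2)[OF e_wspace[OF y]] by (simp add: lins pairing_simps al_c p2)
    qed
  qed (simp add: span)
  have Df: "D (- f x) = - ?f (D x)" for x
  proof (rule lin_eq_on_span[of "\<lambda>x. D (- f x)" "\<lambda>x. - ?f (D x)" "\<Union>\<mu>. wspace \<mu>"])
    show "lin (\<lambda>x. D (- f x))" "lin (\<lambda>x. - ?f (D x))"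
      by (auto intro!: linI simp: lins lin_add[OF D(1)] lin_scale[OF D(1)] lin_diff[OF D(1)] lin_neg[OF D(1)]
          scale_right_distrib mult.commute)
    show "D (- f y) = - ?f (D y)" if mem: "y \<in> (\<Union>\<mu>. wspace \<mu>)" for y
    proof -
      obtain \<kappa> where y: "y \<in> wspace \<kappa>" using mem by blast
      show ?thesis using D(2)[OF y] D(2)[OF f_wspace[OF y]]
        by (simp add: lins lin_neg[OF D(1)] pairing_simps al_c p2)
    qed
  qed (simp add: span)
  have nilF: "\<exists>n. ((\<lambda>v. - f v) ^^ n) x = 0" for x
    using integrable_sl2_module.e_nil[OF neg_swap] .
  have linF: "lin (\<lambda>v. - f v)" "lin (\<lambda>v. - ?f v)"
    using linI lins R.lins by (auto intro!: linI)
  have Dw: "D (weyl_op x) = R.weyl_op (D x)" for x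
    unfolding weyl_op_def R.weyl_op_def o_apply
    by (simp only: op_exp_intertwine[OF D(1) e_lin R.e_lin De e_nil]
        op_exp_intertwine[OF D(1) linF Df nilF])
  define u where "u = inv_into UNIV weyl_op v"
  have wu: "weyl_op u = v" by (simp add: u_def bij_is_surj[OF weyl_op_bij] surj_f_inv_f)
  have u: "u \<in> wspace (reflect \<mu>)" unfolding u_def by (rule inv_weyl_op_wspace[OF v])
  define p where "p = r powr pairing \<mu> c"
  have p0: "p \<noteq> 0" using r0 by (simp add: p_def)
  have "r powr pairing (reflect \<mu>) c = inverse p"
    by (simp add: reflect_def pairing_simps al_c p_def powr_minus)
  then have "sc p v = sc (inverse p) (R.weyl_op u)"
    using Dw[of u] D(2)[OF u] D(2)[OF v] by (simp add: wu p_def lin_scale[OF R.weyl_op_lin])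
  then have "sc p (sc p v) = sc p (sc (inverse p) (R.weyl_op u))" by simp
  then have "R.weyl_op u = sc (p * p) v" using p0 by simp
  then show ?thesis unfolding u_def p_def rpow .
qed

end

section \<open>The group of bijections\<close>

lemma bijection_group_simps:
  "carrier bijection_group = {g. bij g}" "x \<otimes>\<^bsub>bijection_group\<^esub> y = x \<circ> y" "\<one>\<^bsub>bijection_group\<^esub> = id"
  by (simp_all add: bijection_group_def)

lemma group_bijection_group: "group bijection_group"
proof (rule groupI)
  fix x :: "'a \<Rightarrow> 'a" assume "x \<in> carrier bijection_group"
  then show "\<exists>y\<in>carrier bijection_group. y \<otimes>\<^bsub>bijection_group\<^esub> x = \<one>\<^bsub>bijection_group\<^esub>"
    by (intro bexI[of _ "inv_into UNIV x"]) (auto simp: bijection_group_simps bij_imp_bij_inv bij_is_inj)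
qed (auto simp: bijection_group_simps bij_comp o_assoc)

lemma m_inv_bijection_group:
  assumes "bij x"
  shows "inv\<^bsub>bijection_group\<^esub> x = inv_into UNIV x"
  using assms by (intro group.inv_equality[OF group_bijection_group])
    (auto simp: bijection_group_simps bij_imp_bij_inv bij_is_inj)

lemma generate_bijection_group_induct [consumes 1, case_names gen one inv mult]:
  assumes "g \<in> generate bijection_group S"
    and "\<And>s. s \<in> S \<Longrightarrow> bij s \<and> P s"
    and "P id" "\<And>g. bij g \<Longrightarrow> P g \<Longrightarrow> P (inv_into UNIV g)"
    and "\<And>g h. P g \<Longrightarrow> P h \<Longrightarrow> P (g \<circ> h)"
  shows "P g"
  using assms(1)
proof (induction rule: generate.induct)
  case (inv h)
  then show ?case using assms(2)[OF inv] assms(4) by (simp add: m_inv_bijection_group)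
next
  case one
  show ?case unfolding bijection_group_simps by (rule assms(3))
next
  case (incl h)
  then show ?case using assms(2) by blast
next
  case (eng g h)
  show ?case unfolding bijection_group_simps by (intro assms(5) eng.IH)
qed

section \<open>The Weyl group\<close>

lemma cartan_matrix_sym: "cartan_matrix m i j = cartan_matrix m j i"
  by (simp add: cartan_matrix_def)

lemma simple_root_nth: "simple_root m j $ i = cartan_matrix m i j"
  by (simp add: simple_root_def)

text \<open>Arithmetic in the index type is modulo 2, so \<open>i + 1\<close> denotes the other index.\<close>

lemma three_eq_one: "(3::2) = 1"
proof -
  have "(3::2) \<noteq> 2"
  proof
    assume "(3::2) = 2"
    then have "(2::2) + 1 = 2 + 0" by simp
    then have "(1::2) = 0" by (simp only: add_left_cancel)
    then show False by simp
  qed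
  then show ?thesis using exhaust_2[of 3] by blast
qed

lemma other_index: "(i :: 2) + 1 \<noteq> i" "i + 1 + 1 = i" "j \<noteq> i \<longleftrightarrow> j = i + 1"
proof -
  have c: "(1::2) + 1 = 2" "(2::2) + 1 = 1" "(1::2) \<noteq> 2" by (simp_all add: three_eq_one)
  show "i + 1 \<noteq> i" "i + 1 + 1 = i" using exhaust_2[of i] c by metis+
  show "j \<noteq> i \<longleftrightarrow> j = i + 1" using exhaust_2[of i] exhaust_2[of j] c by metis
qed

lemma sum_2_index: "(\<Sum>j\<in>UNIV. g j) = g (i :: 2) + g (i + 1)"
  using exhaust_2[of i] by (auto simp: UNIV_2 three_eq_one add.commute)

definition dual_reflection :: "nat \<Rightarrow> 2 \<Rightarrow> complex^2 \<Rightarrow> complex^2" where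
  "dual_reflection m i \<mu> = \<mu> - \<mu> $ i *s simple_root m i"

definition dual_word :: "nat \<Rightarrow> 2 list \<Rightarrow> complex^2 \<Rightarrow> complex^2" where
  "dual_word m is = foldr (\<lambda>i g. dual_reflection m i \<circ> g) is id"

lemma reflection_reflection: "reflection m i (reflection m i h) = h"
proof -
  have "pairing (simple_root m i) (reflection m i h) = - pairing (simple_root m i) h"
    by (simp add: reflection_def pairing_simps pairing_coroot simple_root_nth cartan_matrix_def)
  then have "reflection m i (reflection m i h) = reflection m i h + pairing (simple_root m i) h *s simple_coroot i"
    by (simp add: reflection_def[of m i "reflection m i h"])
  then show ?thesis by (simp add: reflection_def)
qed

lemma reflection_bij: "bij (reflection m i)" and inv_reflection: "inv_into UNIV (reflection m i) = reflection m i"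
  by (auto intro!: involuntory_imp_bij inv_equality simp: reflection_reflection)

lemma pairing_reflection: "pairing (dual_reflection m i \<mu>) h = pairing \<mu> (reflection m i h)"
  by (simp add: dual_reflection_def reflection_def pairing_simps pairing_coroot mult.commute)

lemma dual_reflection_dual_reflection: "dual_reflection m i (dual_reflection m i \<mu>) = \<mu>"
  by (rule weight_eqI) (simp add: pairing_reflection reflection_reflection)

lemma weyl_word_simps:
  "weyl_word m [] = id" "weyl_word m (i # is) = reflection m i \<circ> weyl_word m is"
  by (simp_all add: weyl_word_def)

lemma dual_word_simps:
  "dual_word m [] = id" "dual_word m (i # is) = dual_reflection m i \<circ> dual_word m is"
  by (simp_all add: dual_word_def)

lemma weyl_word_append: "weyl_word m (is @ js) = weyl_word m is \<circ> weyl_word m js"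
  by (induction "is") (simp_all only: append.simps weyl_word_simps o_assoc id_o)

lemma dual_word_append: "dual_word m (is @ js) = dual_word m is \<circ> dual_word m js"
  by (induction "is") (simp_all only: append.simps dual_word_simps o_assoc id_o)

lemma dual_word_rev_cancel: "dual_word m is (dual_word m (rev is) \<mu>) = \<mu>"
  by (induction "is" arbitrary: \<mu>)
    (auto simp: dual_word_simps dual_word_append dual_reflection_dual_reflection)

lemma dual_word_linear:
  "dual_word m is (\<mu> + \<kappa>) = dual_word m is \<mu> + dual_word m is \<kappa>"
  "dual_word m is (c *s \<mu>) = c *s dual_word m is \<mu>"
  by (induction "is")
    (auto simp: dual_word_simps dual_reflection_def vec_eq_iff algebra_simps)

lemma weyl_word_bij: "bij (weyl_word m is)"
  by (induction "is") (simp_all only: weyl_word_simps bij_id bij_comp reflection_bij)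

lemma inv_weyl_word_Cons:
  "inv_into UNIV (weyl_word m (i # is)) = inv_into UNIV (weyl_word m is) \<circ> reflection m i"
  by (simp only: weyl_word_simps o_inv_distrib reflection_bij weyl_word_bij inv_reflection)

lemma pairing_dual_word: "pairing (dual_word m is \<mu>) h = pairing \<mu> (inv_into UNIV (weyl_word m is) h)"
  by (induction "is" arbitrary: h) (auto simp: weyl_word_simps(1) dual_word_simps inv_weyl_word_Cons pairing_reflection)

text \<open>The contragredient action of a product of simple reflections is the product, in the same order, of the dual
  reflections.\<close>

lemma weyl_dual_word: "weyl_dual (weyl_word m is) = dual_word m is"
proof
  fix \<mu>
  have "weyl_dual (weyl_word m is) \<mu> $ i = dual_word m is \<mu> $ i" for i
    using pairing_dual_word[of m "is" \<mu> "simple_coroot i"] by (simp add: weyl_dual_def pairing_coroot)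
  then show "weyl_dual (weyl_word m is) \<mu> = dual_word m is \<mu>" by (simp add: vec_eq_iff)
qed

primrec alternating_word :: "2 \<Rightarrow> nat \<Rightarrow> 2 list" where
  "alternating_word i 0 = []"
| "alternating_word i (Suc n) = i # alternating_word (i + 1) n"

lemma length_alternating_word: "length (alternating_word i n) = n"
  by (induction n arbitrary: i) auto

text \<open>Equal adjacent letters cancel because the simple reflections are involutions.\<close>

lemma weyl_word_alternating: "\<exists>i n. weyl_word m is = weyl_word m (alternating_word i n)"
proof (induction "is")
  case Nil
  then show ?case by (intro exI[of _ 1] exI[of _ 0]) simp
next
  case (Cons j "is")
  then obtain i n where IH: "weyl_word m is = weyl_word m (alternating_word i n)" by blast
  show ?case
  proof (cases n)
    case 0
    then have "weyl_word m (j # is) = weyl_word m (alternating_word j 1)"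
      using IH by (simp add: weyl_word_simps)
    then show ?thesis by blast
  next
    case (Suc k)
    show ?thesis
    proof (cases "j = i")
      case True
      then have "weyl_word m (j # is) = weyl_word m (alternating_word (i + 1) k)"
        using IH Suc by (simp add: weyl_word_simps fun_eq_iff reflection_reflection)
      then show ?thesis by blast
    next
      case False
      then have "i = j + 1" using other_index(3) by blast
      then have "weyl_word m (j # is) = weyl_word m (alternating_word j (Suc n))"
        using IH by (simp add: weyl_word_simps)
      then show ?thesis by blast
    qed
  qed
qed

lemma inv_weyl_word: "inv_into UNIV (weyl_word m is) = weyl_word m (rev is)"
proof (induction "is")
  case Nil
  show ?case by (simp only: weyl_word_simps rev.simps inv_id)
next
  case (Cons i "is")
  show ?case by (simp only: inv_weyl_word_Cons Cons.IH rev.simps weyl_word_append) (simp only: weyl_word_simps o_id)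
qed

lemma weyl_group_eq_words: "weyl_group m = range (weyl_word m)"
proof
  show "weyl_group m \<subseteq> range (weyl_word m)"
  proof
    fix w assume "w \<in> weyl_group m"
    then have w: "w \<in> generate bijection_group (range (reflection m))" by (simp add: weyl_group_def)
    show "w \<in> range (weyl_word m)"
    proof (rule generate_bijection_group_induct[where P = "\<lambda>w. w \<in> range (weyl_word m)", OF w])
      fix s assume "s \<in> range (reflection m)"
      then obtain i where "s = reflection m i" by blast
      then have "s = weyl_word m [i]" by (simp only: weyl_word_simps o_id)
      then show "bij s \<and> s \<in> range (weyl_word m)" using weyl_word_bij by blast
    next
      show "id \<in> range (weyl_word m)" using weyl_word_simps(1) rangeI[of "weyl_word m" "[]"] by simp
    next
      fix g assume "g \<in> range (weyl_word m)"
      then show "inv_into UNIV g \<in> range (weyl_word m)" using inv_weyl_word by blast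
    next
      fix g h assume "g \<in> range (weyl_word m)" "h \<in> range (weyl_word m)"
      then obtain "is" js where "g = weyl_word m is" "h = weyl_word m js" by blast
      then have "g \<circ> h = weyl_word m (is @ js)" by (simp only: weyl_word_append)
      then show "g \<circ> h \<in> range (weyl_word m)" by simp
    qed
  qed
  show "range (weyl_word m) \<subseteq> weyl_group m"
  proof
    fix w assume "w \<in> range (weyl_word m)"
    then obtain "is" where "w = weyl_word m is" by blast
    moreover have "weyl_word m is \<in> weyl_group m" for "is"
    proof (induction "is")
      case Nil
      show ?case using generate.one[of bijection_group] unfolding weyl_group_def weyl_word_simps bijection_group_simps .
    next
      case (Cons i "is")
      have "reflection m i \<in> weyl_group m" unfolding weyl_group_def by (intro generate.incl) auto
      with Cons show ?case
        using generate.eng[of "reflection m i" bijection_group "range (reflection m)" "weyl_word m is"]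
        by (simp only: weyl_group_def weyl_word_simps bijection_group_simps)
    qed
    ultimately show "w \<in> weyl_group m" by simp
  qed
qed

lemma weyl_group_eq_alternating:
  "weyl_group m = (\<Union>i. range (\<lambda>n. weyl_word m (alternating_word i n)))"
  unfolding weyl_group_eq_words using weyl_word_alternating[of m] by blast

section \<open>The root lattice and coroots\<close>

text \<open>The element of the root lattice space with the same coordinates with respect to the simple roots as \<open>h\<close> has with
  respect to the simple coroots.\<close>

definition rt :: "nat \<Rightarrow> complex^2 \<Rightarrow> complex^2" where
  "rt m h = (\<Sum>i\<in>UNIV. h $ i *s simple_root m i)"

lemma rt_nth: "rt m h $ i = pairing (simple_root m i) h"
  by (simp add: rt_def pairing_def simple_root_nth UNIV_2 cartan_matrix_sym[of m i] mult.commute)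

lemma rt_linear: "rt m (h + h') = rt m h + rt m h'" "rt m (c *s h) = c *s rt m h" "rt m (- h) = - rt m h"
  "rt m (h - h') = rt m h - rt m h'"
  by (simp_all add: vec_eq_iff rt_nth pairing_simps)

lemma rt_coroot: "rt m (simple_coroot i) = simple_root m i"
  by (simp add: vec_eq_iff rt_nth pairing_coroot simple_root_nth cartan_matrix_sym)

lemma rt_reflection: "rt m (reflection m i h) = dual_reflection m i (rt m h)"
  by (simp add: reflection_def dual_reflection_def rt_linear rt_coroot rt_nth)

lemma rt_weyl_word: "rt m (weyl_word m is h) = dual_word m is (rt m h)"
  by (induction "is") (auto simp: weyl_word_simps dual_word_simps rt_reflection)

lemma rt_inj:
  assumes m: "m \<ge> 3" and eq: "rt m h = rt m h'"
  shows "h = h'"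
proof -
  define d where "d = h - h'"
  have "rt m d $ i = 0" for i using eq by (simp add: d_def rt_linear)
  from this[of 1] this[of 2] have e: "2 * d $ 1 = of_nat m * d $ 2" "2 * d $ 2 = of_nat m * d $ 1"
    by (simp_all add: rt_nth pairing_def UNIV_2 simple_root_nth cartan_matrix_def)
  then have "(4 - of_nat m * of_nat m) * d $ 1 = 0" "(4 - of_nat m * of_nat m) * d $ 2 = 0"
    by algebra+
  moreover have "(4 - of_nat m * of_nat m :: complex) \<noteq> 0"
  proof
    assume "(4 - of_nat m * of_nat m :: complex) = 0"
    then have "(of_nat (m * m) :: complex) = of_nat 4" by simp
    then have "m * m = 4" by (simp only: of_nat_eq_iff)
    moreover have "m * m \<ge> 3 * 3" using m by (intro mult_mono) auto
    ultimately show False by simp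
  qed
  ultimately have "d $ 1 = 0" "d $ 2 = 0" by auto
  then have "d = 0" by (metis (full_types) exhaust_2 vec_eq_iff zero_index)
  then show ?thesis by (simp add: d_def)
qed

text \<open>Since the Cartan matrix is symmetric, the linear bijection from the Cartan subalgebra to its dual with
  \<open>h\<^sub>i \<mapsto> \<alpha>\<^sub>i\<close> commutes with the Weyl group. Hence it maps the coroot of each real root to this root.\<close>

lemma coroot_rt:
  assumes "m \<ge> 3" "rt m h = dual_word m is (simple_root m i)"
  shows "coroot m (rt m h) = h"
proof -
  have h: "h = weyl_word m is (simple_coroot i)"
    by (rule rt_inj[OF assms(1)]) (simp add: rt_weyl_word rt_coroot assms(2))
  show ?thesis
    unfolding coroot_def
  proof (rule the_equality)
    show "\<exists>w\<in>weyl_group m. \<exists>j. rt m h = weyl_dual w (simple_root m j) \<and> h = w (simple_coroot j)"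
      using assms(2) h by (auto simp: weyl_group_eq_words weyl_dual_word)
    fix h' assume "\<exists>w\<in>weyl_group m. \<exists>j. rt m h = weyl_dual w (simple_root m j) \<and> h' = w (simple_coroot j)"
    then obtain js j where "rt m h = dual_word m js (simple_root m j)" "h' = weyl_word m js (simple_coroot j)"
      by (auto simp: weyl_group_eq_words weyl_dual_word)
    then have "rt m h' = rt m h" by (simp add: rt_weyl_word rt_coroot)
    then show "h' = h" by (rule rt_inj[OF assms(1)])
  qed
qed

section \<open>Growth along the Weyl group orbit of an antidominant element\<close>

text \<open>Let \<open>x\<close> and \<open>y\<close> be the coordinates of an element of the Cartan subalgebra, where \<open>x\<close> is the one changed
  by the next reflection. The reflection makes it \<open>m y - x \<ge> 2 y\<close> when \<open>y \<ge> x\<close>.\<close>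

lemma orbit_growth_step:
  assumes "m \<ge> 3" "h $ i = of_real x" "h $ (i + 1) = of_real y" "0 < x" "x \<le> y"
  shows "\<exists>a b. inv_into UNIV (weyl_word m (alternating_word i n)) h $ i = of_real a
    \<and> inv_into UNIV (weyl_word m (alternating_word i n)) h $ (i + 1) = of_real b
    \<and> a > 0 \<and> b > 0 \<and> a + b \<ge> 2 ^ n * y"
  using assms(2-5)
proof (induction n arbitrary: i h x y)
  case 0
  then show ?case by - (rule exI[of _ x], rule exI[of _ y], simp add: weyl_word_simps(1))
next
  case (Suc n)
  define h' where "h' = reflection m i h"
  have h'1: "h' $ (i + 1) = of_real y"
    using Suc.prems other_index(1)[of i] by (simp add: h'_def reflection_def simple_coroot_def axis_def)
  have h'2: "h' $ (i + 1 + 1) = of_real (real m * y - x)"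
    using Suc.prems other_index(1)[of i]
    by (simp add: h'_def reflection_def simple_coroot_def axis_def other_index(2) pairing_def
        simple_root_nth sum_2_index[of _ i] cartan_matrix_def)
  have "3 * y \<le> real m * y" using assms(1) Suc.prems by (intro mult_right_mono) auto
  then have ge: "real m * y - x \<ge> 2 * y" using Suc.prems by linarith
  have "inv_into UNIV (weyl_word m (alternating_word i (Suc n))) h
      = inv_into UNIV (weyl_word m (alternating_word (i + 1) n)) h'"
    by (simp add: inv_weyl_word_Cons h'_def)
  moreover obtain a b where ab:
    "inv_into UNIV (weyl_word m (alternating_word (i + 1) n)) h' $ (i + 1) = of_real a"
    "inv_into UNIV (weyl_word m (alternating_word (i + 1) n)) h' $ (i + 1 + 1) = of_real b"
    "a > 0" "b > 0" "a + b \<ge> 2 ^ n * (real m * y - x)"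
    using Suc.IH[OF h'1 h'2] Suc.prems ge by auto
  moreover have "2 ^ Suc n * y \<le> b + a"
  proof -
    have "2 ^ n * (2 * y) \<le> 2 ^ n * (real m * y - x)" using ge by (rule mult_left_mono) simp
    moreover have "2 ^ Suc n * y = 2 ^ n * (2 * y)" by simp
    ultimately show ?thesis using ab(5) by linarith
  qed
  ultimately show ?case
    by - (rule exI[of _ b], rule exI[of _ a], auto simp: other_index(2))
qed

text \<open>Antidominance of \<open>H\<close> makes both coordinates positive: if one of them were not, the two inequalities would make both
  negative and contradict each other. It also ensures that after one reflection the changed coordinate is the
  larger one, from where on the coordinates double.\<close>

lemma orbit_growth:
  assumes m: "m \<ge> 3" and H: "\<And>i. H $ i = of_real (l i)"
    and neg: "\<And>i. 2 * l i < real m * l (i + 1)"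
  obtains \<kappa> where "\<kappa> > 0" and
    "\<And>i n. \<exists>a b. inv_into UNIV (weyl_word m (alternating_word i n)) H $ i = of_real a
    \<and> inv_into UNIV (weyl_word m (alternating_word i n)) H $ (i + 1) = of_real b
    \<and> a > 0 \<and> b > 0 \<and> a + b \<ge> 2 ^ n * \<kappa>"
proof
  have neg1: "2 * l (i + 1) < real m * l i" for i
    using neg[of "i + 1"] by (simp add: other_index(2))
  have pos: "l i > 0" for i
  proof (rule ccontr)
    assume "\<not> l i > 0"
    moreover from this have "real m * l i \<le> 0" by (simp add: mult_nonneg_nonpos)
    ultimately have le: "l i \<le> 0" "l (i + 1) < 0" using neg1[of i] by auto
    then have "real m * l (i + 1) \<le> 2 * l (i + 1)" "real m * l i \<le> 2 * l i"
      using m by (auto intro: mult_right_mono_neg)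
    then show False using neg[of i] neg1[of i] by linarith
  qed
  define \<kappa> where "\<kappa> = min (l 1) (l 2) / 2"
  show "\<kappa> > 0" using pos[of 1] pos[of 2] by (simp add: \<kappa>_def)
  fix i n
  have \<kappa>: "\<kappa> \<le> l i / 2" "\<kappa> \<le> l (i + 1) / 2"
    using exhaust_2[of i] by (auto simp: \<kappa>_def three_eq_one)
  show "\<exists>a b. inv_into UNIV (weyl_word m (alternating_word i n)) H $ i = of_real a
    \<and> inv_into UNIV (weyl_word m (alternating_word i n)) H $ (i + 1) = of_real b
    \<and> a > 0 \<and> b > 0 \<and> a + b \<ge> 2 ^ n * \<kappa>"
  proof (cases n)
    case 0
    then show ?thesis using \<kappa> pos[of i] pos[of "i + 1"]
      by - (rule exI[of _ "l i"], rule exI[of _ "l (i + 1)"], auto simp: weyl_word_simps(1) H)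
  next
    case (Suc k)
    define h' where "h' = reflection m i H"
    have h'1: "h' $ (i + 1) = of_real (l (i + 1))"
      using other_index(1)[of i] by (simp add: h'_def reflection_def simple_coroot_def axis_def H)
    have h'2: "h' $ (i + 1 + 1) = of_real (real m * l (i + 1) - l i)"
      using other_index(1)[of i]
      by (simp add: h'_def reflection_def simple_coroot_def axis_def other_index(2) pairing_def
          simple_root_nth sum_2_index[of _ i] cartan_matrix_def H)
    have "3 * l (i + 1) \<le> real m * l (i + 1)" using m pos[of "i + 1"] by (intro mult_right_mono) auto
    then have ge: "l (i + 1) \<le> real m * l (i + 1) - l i" using neg[of i] pos[of "i + 1"] by linarith
    have "inv_into UNIV (weyl_word m (alternating_word i n)) H
        = inv_into UNIV (weyl_word m (alternating_word (i + 1) k)) h'"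
      by (simp add: inv_weyl_word_Cons h'_def Suc)
    moreover obtain a b where
      "inv_into UNIV (weyl_word m (alternating_word (i + 1) k)) h' $ (i + 1) = of_real a"
      "inv_into UNIV (weyl_word m (alternating_word (i + 1) k)) h' $ (i + 1 + 1) = of_real b"
      "a > 0" "b > 0" "a + b \<ge> 2 ^ k * (real m * l (i + 1) - l i)"
      using orbit_growth_step[OF m h'1 h'2] pos[of "i + 1"] ge by blast
    moreover have "2 ^ n * \<kappa> \<le> 2 ^ k * (real m * l (i + 1) - l i)" using ge \<kappa>(2) by (simp add: Suc)
    ultimately show ?thesis
      by - (rule exI[of _ b], rule exI[of _ a], auto simp: other_index(2))
  qed
qed

section \<open>Bounds for quotients of the completed zeta function\<close>

text \<open>In Gauss's limit formula the quotient becomes a product of factors \<open>1 + (1/2) / (z + k)\<close>. On the half plane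
  their moduli are largest at \<open>z = 1/2\<close>, where the quotient is \<open>\<Gamma>(1/2) / \<Gamma>(1) = \<surd>\<pi>\<close>.\<close>

lemma norm_Gamma_quotient_le:
  fixes z :: complex
  assumes z: "Re z \<ge> 1 / 2"
  shows "norm (Gamma z / Gamma (z + 1 / 2)) \<le> sqrt pi"
proof -
  have nz: "Re z + real k > 0" for k using z by linarith
  then have nz': "z + of_nat k \<noteq> 0" "z + 1 / 2 + of_nat k \<noteq> 0" for k
    by (auto simp: complex_eq_iff dest: spec[of _ k]) (metis add.commute less_irrefl nz, 
      metis add.commute less_irrefl nz add_pos_pos zero_less_divide_1_iff zero_less_numeral add.assoc)
  have "z + 1 / 2 \<notin> \<int>\<^sub>\<le>\<^sub>0" using z by (auto elim!: nonpos_Ints_cases simp: complex_eq_iff)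
  then have lim: "(\<lambda>n. norm (Gamma_series z n / Gamma_series (z + 1 / 2) n))
      \<longlonglongrightarrow> norm (Gamma z / Gamma (z + 1 / 2))"
    by (intro tendsto_intros) (simp add: Gamma_eq_zero_iff)
  have lim': "(\<lambda>n. Gamma_series (1 / 2) n / Gamma_series 1 n) \<longlonglongrightarrow> Gamma (1 / 2) / Gamma (1 :: real)"
    by (intro tendsto_intros) (simp add: Gamma_eq_zero_iff)
  have "norm (Gamma_series z n / Gamma_series (z + 1 / 2) n) \<le> Gamma_series (1 / 2) n / Gamma_series (1::real) n"
    if n: "n > 0" for n
  proof -
    define E P Q where "E = exp (z * of_real (ln (of_nat n)))" and "P = (\<Prod>k\<le>n. z + of_nat k)"
      and "Q = (\<Prod>k\<le>n. z + 1 / 2 + of_nat k)"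
    have "exp ((z + 1 / 2) * of_real (ln (of_nat n))) = E * of_real (exp (ln n / 2))"
      by (simp add: E_def distrib_right exp_add flip: exp_of_real)
    then have G1: "Gamma_series (z + 1 / 2) n = fact n * (E * of_real (exp (ln n / 2))) / Q"
      by (simp add: Gamma_series_def Q_def pochhammer_prod atLeastLessThanSuc_atLeastAtMost atMost_atLeast0)
    have G2: "Gamma_series z n = fact n * E / P"
      by (simp add: Gamma_series_def E_def P_def pochhammer_prod atLeastLessThanSuc_atLeastAtMost atMost_atLeast0)
    have QP: "(\<Prod>k\<le>n. (z + 1 / 2 + of_nat k) / (z + of_nat k)) = Q / P"
      by (simp add: P_def Q_def prod_dividef)
    have "E \<noteq> 0" by (simp add: E_def)
    then have "Gamma_series z n / Gamma_series (z + 1 / 2) n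
        = of_real (exp (- (ln n / 2))) * (\<Prod>k\<le>n. (z + 1 / 2 + of_nat k) / (z + of_nat k))"
      unfolding G1 G2 QP by (simp add: exp_minus divide_simps)
    then have "norm (Gamma_series z n / Gamma_series (z + 1 / 2) n)
        = exp (- (ln n / 2)) * (\<Prod>k\<le>n. norm ((z + 1 / 2 + of_nat k) / (z + of_nat k)))"
      by (simp only: norm_mult prod_norm norm_of_real abs_exp_cancel)
    also have "\<dots> \<le> exp (- (ln n / 2)) * (\<Prod>k\<le>n. (1 + real k) / (1 / 2 + real k))"
    proof (intro mult_left_mono prod_mono conjI norm_ge_zero)
      fix k
      have le: "1 / 2 + real k \<le> norm (z + of_nat k)"
        using complex_Re_le_cmod[of "z + of_nat k"] z by simp
      have "norm ((z + 1 / 2 + of_nat k) / (z + of_nat k)) = norm (1 + (1 / 2) / (z + of_nat k))"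
      proof -
        have "z + 1 / 2 + of_nat k = (z + of_nat k) + 1 / 2" by simp
        then show ?thesis using nz'(1)[of k] by (metis add_divide_distrib divide_self)
      qed
      also have "\<dots> \<le> 1 + norm ((1 / 2) / (z + of_nat k))"
        by (metis norm_one norm_triangle_ineq)
      also have "norm ((1 / 2) / (z + of_nat k)) \<le> (1 / 2) / (1 / 2 + real k)"
        unfolding norm_divide norm_one norm_numeral
        using le of_nat_0_le_iff[of k, where ?'a = real]
        by (intro divide_left_mono mult_pos_pos; linarith)
      also have "1 + (1 / 2) / (1 / 2 + real k) = (1 + real k) / (1 / 2 + real k)"
        by (simp add: field_simps)
      finally show "norm ((z + 1 / 2 + of_nat k) / (z + of_nat k)) \<le> (1 + real k) / (1 / 2 + real k)"
        by simp
    qed simp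
    also have "\<dots> = Gamma_series (1 / 2) n / Gamma_series 1 n"
    proof -
      define r P Q where "r = exp (ln (real n) / 2)" and "P = (\<Prod>k\<le>n. 1 / 2 + real k)"
        and "Q = (\<Prod>k\<le>n. 1 + real k)"
      have "exp (1 * of_real (ln (real n))) = r * r"
        by (simp add: r_def flip: exp_add del: exp_ln)
      then have G1: "Gamma_series 1 n = fact n * (r * r) / Q"
        unfolding Gamma_series_def Q_def
        by (simp only: pochhammer_prod Suc_eq_plus1[symmetric] atLeastLessThanSuc_atLeastAtMost atMost_atLeast0)
      have G2: "Gamma_series (1 / 2) n = fact n * r / P"
        by (simp add: Gamma_series_def r_def P_def pochhammer_prod atLeastLessThanSuc_atLeastAtMost
            atMost_atLeast0 mult.commute)
      have QP: "(\<Prod>k\<le>n. (1 + real k) / (1 / 2 + real k)) = Q / P"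
        by (simp add: P_def Q_def prod_dividef)
      have r: "exp (- (ln (real n) / 2)) = 1 / r" "r \<noteq> 0"
        unfolding r_def exp_minus by (rule inverse_eq_divide, rule exp_not_eq_zero)
      show ?thesis unfolding G1 G2 QP r(1) using r(2) by (simp add: divide_simps)
    qed
    finally show ?thesis .
  qed
  then have "norm (Gamma z / Gamma (z + 1 / 2)) \<le> Gamma (1 / 2) / Gamma (1 :: real)"
    by (intro LIMSEQ_le[OF lim lim']) (auto intro: exI[of _ 1])
  then show ?thesis by (simp add: Gamma_one_half_real)
qed

definition euler_factor :: "complex \<Rightarrow> nat \<Rightarrow> complex" where
  "euler_factor s p = (if prime p then inverse (1 - of_nat p powr (- s)) else 1)"

lemma norm_prime_powr_le:
  assumes "prime p" "Re s \<ge> \<sigma>" "\<sigma> > 1"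
  shows "norm (of_nat p powr (- s) :: complex) \<le> real p powr - \<sigma>" "real p powr - \<sigma> \<le> 1 / 2"
proof -
  have p: "p \<ge> 2" using assms(1) by (rule prime_ge_2_nat)
  have "norm (of_nat p powr (- s) :: complex) = real p powr - Re s"
    using p by (subst norm_powr_real_powr) auto
  also have "\<dots> \<le> real p powr - \<sigma>" using p assms(2) by (intro powr_mono) auto
  finally show "norm (of_nat p powr (- s) :: complex) \<le> real p powr - \<sigma>" .
  have "real p powr - \<sigma> \<le> real p powr - 1" using p assms(3) by (intro powr_mono) auto
  also have "\<dots> = 1 / real p" using p by (simp add: powr_minus divide_inverse)
  also have "\<dots> \<le> 1 / 2" using p by (intro divide_left_mono) auto
  finally show "real p powr - \<sigma> \<le> 1 / 2" .
qed

lemma convergent_euler_product: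
  assumes "Re s > 1"
  shows "convergent_prod (euler_factor s)" "prodinf (euler_factor s) \<noteq> 0"
proof -
  have s1: "summable (\<lambda>p. 2 * real p powr - Re s)"
    using assms by (intro summable_mult) (simp add: summable_real_powr_iff)
  have s2: "norm (euler_factor s p - 1) \<le> 2 * real p powr - Re s" for p
  proof (cases "prime p")
    case True
    define x where "x = (of_nat p powr (- s) :: complex)"
    have x: "norm x \<le> real p powr - Re s" "norm x \<le> 1 / 2"
      using norm_prime_powr_le[OF True order.refl assms] by (auto simp: x_def)
    then have "1 - x \<noteq> 0" by (auto simp: norm_minus_commute)
    then have "euler_factor s p - 1 = x / (1 - x)"
      using True by (simp add: euler_factor_def field_simps flip: x_def)
    moreover have "norm (1 - x) \<ge> 1 / 2"
      using norm_triangle_ineq2[of 1 x] x(2) by simp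
    then have "norm (x / (1 - x)) \<le> norm x / (1 / 2)"
      unfolding norm_divide by (intro divide_left_mono mult_pos_pos) auto
    ultimately show ?thesis using x by simp
  qed (simp add: euler_factor_def)
  have "summable (\<lambda>p. norm (euler_factor s p - 1))"
    by (rule summable_comparison_test'[OF s1, of 0]) (use s2 in simp)
  then show conv: "convergent_prod (euler_factor s)"
    by (intro abs_convergent_prod_imp_convergent_prod summable_imp_abs_convergent_prod)
  have "euler_factor s p \<noteq> 0" for p
    using norm_prime_powr_le[of p "Re s" s] assms by (auto simp: euler_factor_def)
  with conv show "prodinf (euler_factor s) \<noteq> 0" by (rule prodinf_nonzero)
qed

text \<open>The product is compared with the real series \<open>\<Sum> n\<^sup>-\<^sup>\<sigma>\<close>: the quotient of Euler factors
  \<open>(1 - p\<^sup>-\<^sup>1\<^sup>-\<^sup>s) / (1 - p\<^sup>-\<^sup>s)\<close> is at most \<open>(1 + x) / (1 - x) \<le> exp (4 x)\<close> for \<open>x = p\<^sup>-\<^sup>\<sigma> \<le> 1/2\<close>.\<close>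

lemma norm_euler_quotient_le:
  assumes "\<sigma> > 1" "Re s \<ge> \<sigma>"
  shows "norm (prodinf (euler_factor s) / prodinf (euler_factor (s + 1))) \<le> exp (4 * (\<Sum>n. real n powr - \<sigma>))"
proof -
  have summ: "summable (\<lambda>p. real p powr - \<sigma>)"
    using assms by (simp add: summable_real_powr_iff)
  have lim: "(\<lambda>n. norm ((\<Prod>p\<le>n. euler_factor s p) / (\<Prod>p\<le>n. euler_factor (s + 1) p)))
      \<longlonglongrightarrow> norm (prodinf (euler_factor s) / prodinf (euler_factor (s + 1)))"
    using assms convergent_euler_product[of s] convergent_euler_product[of "s + 1"]
    by (intro tendsto_norm tendsto_divide convergent_prod_LIMSEQ) auto
  have factor: "norm (euler_factor s p / euler_factor (s + 1) p) \<le> exp (4 * real p powr - \<sigma>)" for p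
  proof (cases "prime p")
    case True
    define x y and X where "x = (of_nat p powr (- s) :: complex)"
      and "y = (of_nat p powr (- (s + 1)) :: complex)" and "X = real p powr - \<sigma>"
    have X: "norm x \<le> X" "norm y \<le> X" "X \<le> 1 / 2" "X \<ge> 0"
      using norm_prime_powr_le[OF True assms(2,1)] norm_prime_powr_le[OF True _ assms(1), of "s + 1"] assms
      by (auto simp: x_def y_def X_def)
    have "norm (1 - y) \<le> 1 + X" using norm_triangle_ineq4[of 1 y] X by simp
    moreover have "norm (1 - x) \<ge> 1 - X" using norm_triangle_ineq2[of 1 x] X by simp
    ultimately have "norm ((1 - y) / (1 - x)) \<le> (1 + X) / (1 - X)"
      unfolding norm_divide using X by (intro frac_le) auto
    also have "\<dots> \<le> 1 + 4 * X"
    proof -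
      have "X * (1 / 2 - X) \<ge> 0" using X by simp
      then show ?thesis using X by (simp add: field_simps)
    qed
    also have "\<dots> \<le> exp (4 * X)" by (rule exp_ge_add_one_self)
    also have "(1 - y) / (1 - x) = euler_factor s p / euler_factor (s + 1) p"
      using True by (simp add: euler_factor_def x_def y_def divide_inverse mult.commute)
    finally show ?thesis by (simp add: X_def)
  qed (simp add: euler_factor_def)
  have "norm ((\<Prod>p\<le>n. euler_factor s p) / (\<Prod>p\<le>n. euler_factor (s + 1) p))
      \<le> exp (4 * (\<Sum>n. real n powr - \<sigma>))" for n
  proof -
    have "norm ((\<Prod>p\<le>n. euler_factor s p) / (\<Prod>p\<le>n. euler_factor (s + 1) p))
        = (\<Prod>p\<le>n. norm (euler_factor s p / euler_factor (s + 1) p))"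
      by (simp add: prod_norm flip: prod_dividef)
    also have "\<dots> \<le> (\<Prod>p\<le>n. exp (4 * real p powr - \<sigma>))"
      by (intro prod_mono) (auto intro: factor)
    also have "\<dots> = exp (4 * (\<Sum>p\<le>n. real p powr - \<sigma>))"
      by (simp add: exp_sum sum_distrib_left)
    also have "\<dots> \<le> exp (4 * (\<Sum>n. real n powr - \<sigma>))"
      using sum_le_suminf[OF summ, of "{..n}"] by simp
    finally show ?thesis .
  qed
  then show ?thesis by (intro LIMSEQ_le_const2[OF lim]) auto
qed

lemma norm_completed_zeta_quotient_bounded:
  assumes "\<sigma> > 1"
  obtains C where "C \<ge> 1"
    "\<And>s. Re s \<ge> \<sigma> \<Longrightarrow> norm (completed_zeta s / completed_zeta (1 + s)) \<le> C"
proof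
  define C where "C = sqrt pi * sqrt pi * exp (4 * (\<Sum>n. real n powr - \<sigma>))"
  show "max 1 C \<ge> 1" by simp
  fix s assume s: "Re s \<ge> \<sigma>"
  have half: "(1 + s) / 2 = s / 2 + 1 / 2" by (simp add: field_simps)
  have "completed_zeta s / completed_zeta (1 + s)
     = (of_real pi powr (- s / 2) / of_real pi powr (- (1 + s) / 2)) * (Gamma (s / 2) / Gamma (s / 2 + 1 / 2))
       * (prodinf (euler_factor s) / prodinf (euler_factor (s + 1)))"
    unfolding completed_zeta_def half[symmetric] add.commute[of s 1]
    by (simp add: euler_factor_def[abs_def])
  moreover have "of_real pi powr (- s / 2) / of_real pi powr (- (1 + s) / 2) = (of_real pi powr (1 / 2) :: complex)"
    by (simp add: field_simps flip: powr_diff powr_add)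
  moreover have "norm (of_real pi powr (1 / 2) :: complex) = sqrt pi"
    by (subst norm_powr_real_powr) (auto simp: powr_half_sqrt)
  moreover have "norm (Gamma (s / 2) / Gamma (s / 2 + 1 / 2)) \<le> sqrt pi"
    using s assms by (intro norm_Gamma_quotient_le) simp
  ultimately have "norm (completed_zeta s / completed_zeta (1 + s)) \<le> C"
    unfolding C_def using norm_euler_quotient_le[OF assms s]
    by (simp only: norm_mult) (intro mult_mono; simp)
  then show "norm (completed_zeta s / completed_zeta (1 + s)) \<le> max 1 C" by simp
qed

lemma (in complex_space) lin_span:
  assumes "lin T" "\<And>s. s \<in> S \<Longrightarrow> T s \<in> span U" "x \<in> span S"
  shows "T x \<in> span U"
  using assms(3)
  by (induction rule: span_induct_alt)
     (auto simp: lin_zero[OF assms(1)] lin_add[OF assms(1)] lin_scale[OF assms(1)]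
       intro: span_zero span_add span_scale assms(2))

section \<open>Roots of the Kac--Moody algebra\<close>

definition nat_vec :: "(2 \<Rightarrow> nat) \<Rightarrow> complex^2" where
  "nat_vec k = (\<chi> i. of_nat (k i))"

lemma nat_vec_nth: "nat_vec k $ i = of_nat (k i)"
  by (simp add: nat_vec_def)

lemma nat_vec_inj: "nat_vec k = nat_vec k' \<Longrightarrow> k = k'"
  by (auto simp: vec_eq_iff nat_vec_nth)

lemma nat_vec_upd: "nat_vec (k(i := Suc (k i))) = nat_vec k + simple_coroot i"
  by (auto simp: vec_eq_iff nat_vec_nth simple_coroot_def axis_def)

lemma nat_vec_single: "nat_vec (\<lambda>j. if j = i then 1 else 0) = simple_coroot i"
  by (auto simp: vec_eq_iff nat_vec_nth simple_coroot_def axis_def)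

lemma rt_nat_vec: "rt m (nat_vec k) = (\<Sum>i\<in>UNIV. of_nat (k i) *s simple_root m i)"
  by (simp add: rt_def nat_vec_nth)

text \<open>The left-normed brackets \<open>[e\<^sub>i\<^sub>1, [e\<^sub>i\<^sub>2, \<dots>, e\<^sub>i\<^sub>r]]\<close>, indexed by the multiplicities of their letters.\<close>

inductive e_monomial :: "('g, 'z) km_algebra_scheme \<Rightarrow> (2 \<Rightarrow> nat) \<Rightarrow> 'g \<Rightarrow> bool" for L where
  gen: "e_monomial L (\<lambda>j. if j = i then 1 else 0) (egen L i)"
| step: "e_monomial L k x \<Longrightarrow> e_monomial L (k(i := Suc (k i))) (bracket L (egen L i) x)"

lemma e_monomial_egen: "\<exists>k. e_monomial L k (egen L i)"
  by (rule exI[of _ "\<lambda>j. if j = i then 1 else 0"]) (rule e_monomial.gen)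

text \<open>The same algebra with the roles of raising and lowering operators exchanged; its \<open>e\<close>-monomials are the
  monomials in the \<open>f\<^sub>i\<close>. Every statement about raising operators thereby has a counterpart for lowering operators.\<close>

definition chevalley_involution :: "('g, 'z) km_algebra_scheme \<Rightarrow> ('g, 'z) km_algebra_scheme" where
  "chevalley_involution L = L\<lparr>cartan := \<lambda>h. cartan L (- h), egen := fgen L, fgen := egen L\<rparr>"

lemma chevalley_involution_simps:
  "gscale (chevalley_involution L) = gscale L" "bracket (chevalley_involution L) = bracket L"
  "cartan (chevalley_involution L) = (\<lambda>h. cartan L (- h))"
  "egen (chevalley_involution L) = fgen L" "fgen (chevalley_involution L) = egen L"
  by (simp_all add: chevalley_involution_def)

locale hyperbolic_algebra = kac_moody_algebra m L
  for m :: nat and L :: "('g::ab_group_add, 'z) km_algebra_scheme" +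
  assumes m_ge: "m \<ge> 3"
begin

abbreviation "br \<equiv> bracket L"

lemma complex_space: "complex_space (gscale L)"
  using lie by (simp add: lie_algebra_def complex_space_def)

sublocale ad: weight_module "gscale L" "\<lambda>x. br (cartan L x)"
  using lie complex_space
  by (auto simp: weight_module_def weight_module_axioms_def lie_algebra_def lie_algebra_axioms_def)

lemma br_lin: "ad.lin (br x)"
  using lie by (simp add: lie_algebra_def lie_algebra_axioms_def)

lemma br_lin_left: "ad.lin (\<lambda>x. br x y)"
  using lie by (simp add: lie_algebra_def lie_algebra_axioms_def)

lemmas br_simps = ad.lin_add[OF br_lin] ad.lin_scale[OF br_lin] ad.lin_diff[OF br_lin]
  ad.lin_neg[OF br_lin] ad.lin_zero[OF br_lin] ad.lin_add[OF br_lin_left] ad.lin_scale[OF br_lin_left]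
  ad.lin_diff[OF br_lin_left] ad.lin_neg[OF br_lin_left] ad.lin_zero[OF br_lin_left]

lemma br_self: "br x x = 0"
  using lie by (simp add: lie_algebra_def lie_algebra_axioms_def)

lemma br_anticommute: "br x y = - br y x"
proof -
  have "br (x + y) (x + y) = br x x + br y x + (br x y + br y y)"
    by (simp only: br_simps)
  then have "br x y + br y x = 0" by (simp add: br_self add.commute)
  then show ?thesis by (simp only: eq_neg_iff_add_eq_0)
qed

lemma br_derivation: "br x (br y z) = br (br x y) z + br y (br x z)"
proof -
  have "br x (br y z) + br y (br z x) + br z (br x y) = 0"
    using lie by (simp add: lie_algebra_def lie_algebra_axioms_def)
  moreover have "br y (br z x) = - br y (br x z)"
    using br_anticommute[of z x] by (simp add: br_simps)
  moreover have "br z (br x y) = - br (br x y) z" by (rule br_anticommute)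
  ultimately show ?thesis by (simp add: algebra_simps)
qed

lemma involution: "hyperbolic_algebra m (chevalley_involution L)"
proof (intro hyperbolic_algebra.intro hyperbolic_algebra_axioms.intro kac_moody_algebra.intro m_ge;
    unfold chevalley_involution_simps)
  have c: "Vector_Spaces.linear (*s) (gscale L) (cartan L)" by (rule cartan_linear)
  have cneg: "cartan L (- h) = - cartan L h" for h
  proof -
    have "cartan L ((-1) *s h) = gscale L (-1) (cartan L h)"
      using c by (simp only: Vector_Spaces.linear_iff)
    then show ?thesis by simp
  qed
  show "lie_algebra (gscale L) br" by (rule lie)
  show "Vector_Spaces.linear (*s) (gscale L) (\<lambda>h. cartan L (- h))"
    using c by (simp add: Vector_Spaces.linear_iff cneg)
  show "inj (\<lambda>h. cartan L (- h))"
    by (rule injI) (use injD[OF cartan_inj] in fastforce)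
  have r: "range (\<lambda>h. cartan L (- h)) = range (cartan L)"
    by (auto simp: image_iff) (metis minus_minus)
  show "br (cartan L (- h)) (cartan L (- h')) = 0" for h h' by (rule cartan_cartan)
  show "br (cartan L (- h)) (fgen L i) = gscale L (pairing (simple_root m i) h) (fgen L i)" for h i
    by (simp add: cartan_f pairing_simps)
  show "br (cartan L (- h)) (egen L i) = gscale L (- pairing (simple_root m i) h) (egen L i)" for h i
    by (simp add: cartan_e pairing_simps)
  show "br (fgen L i) (egen L j) = (if i = j then cartan L (- simple_coroot i) else 0)" for i j
    using e_f[of j i] br_anticommute[of "fgen L i" "egen L j"] by (auto simp: cneg)
  show "S = UNIV" if "ad.subspace S" "\<And>x y. x \<in> S \<Longrightarrow> y \<in> S \<Longrightarrow> br x y \<in> S"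
    "range (\<lambda>h. cartan L (- h)) \<subseteq> S" "range (fgen L) \<subseteq> S" "range (egen L) \<subseteq> S" for S
    using that generated[of S] unfolding r by blast
  show "I = {0}" if "ad.subspace I" "\<And>x y. y \<in> I \<Longrightarrow> br x y \<in> I" "I \<inter> range (\<lambda>h. cartan L (- h)) = {0}" for I
    using that no_ideal[of I] unfolding r by blast
qed

lemma cartan_zero: "cartan L 0 = 0"
proof -
  have "cartan L (0 *s 0) = gscale L 0 (cartan L 0)"
    using cartan_linear by (simp only: Vector_Spaces.linear_iff)
  then show ?thesis by simp
qed

text \<open>The elements of the algebra that preserve a subspace of a representation form a subalgebra.\<close>

lemma stable_under_generators:
  fixes A :: "'g \<Rightarrow> 'v::ab_group_add \<Rightarrow> 'v"
  assumes "vector_space sc" "\<And>v. Vector_Spaces.linear (gscale L) sc (\<lambda>x. A x v)"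
    and "\<And>x y v. A (br x y) v = A x (A y v) - A y (A x v)"
    and S: "module.subspace sc S" "\<And>h v. v \<in> S \<Longrightarrow> A (cartan L h) v \<in> S"
      "\<And>i v. v \<in> S \<Longrightarrow> A (egen L i) v \<in> S" "\<And>i v. v \<in> S \<Longrightarrow> A (fgen L i) v \<in> S"
    and "v \<in> S"
  shows "A x v \<in> S"
proof -
  interpret V: vector_space sc by (rule assms(1))
  have lin: "A (x + y) v = A x v + A y v" "A (gscale L c x) v = sc c (A x v)" for x y c v
    using assms(2)[of v] by (simp_all add: Vector_Spaces.linear_iff)
  have zero: "A 0 v = 0" for v using lin(2)[of 0 0 v] by simp
  have "{x. \<forall>v\<in>S. A x v \<in> S} = UNIV"
  proof (rule generated)
    show "ad.subspace {x. \<forall>v\<in>S. A x v \<in> S}"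
      using S(1) by (auto simp: ad.subspace_def V.subspace_def lin zero)
    show "br x y \<in> {x. \<forall>v\<in>S. A x v \<in> S}"
      if "x \<in> {x. \<forall>v\<in>S. A x v \<in> S}" "y \<in> {x. \<forall>v\<in>S. A x v \<in> S}" for x y
      using that V.subspace_diff[OF S(1)] by (auto simp: assms(3))
  qed (use S in auto)
  then show ?thesis using assms(8) by blast
qed

lemma ad_stable:
  assumes "ad.subspace S" "\<And>h v. v \<in> S \<Longrightarrow> br (cartan L h) v \<in> S"
      "\<And>i v. v \<in> S \<Longrightarrow> br (egen L i) v \<in> S" "\<And>i v. v \<in> S \<Longrightarrow> br (fgen L i) v \<in> S" "v \<in> S"
  shows "br x v \<in> S"
proof (rule stable_under_generators[of "gscale L" br, OF _ _ _ assms])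
  show "vector_space (gscale L)" by (rule ad.vector_space_axioms)
  show "ad.lin (\<lambda>x. br x v)" for v by (rule br_lin_left)
  show "br (br x y) v = br x (br y v) - br y (br x v)" for x y v
    using br_derivation[of x y v] by simp
qed

lemma simple_root_coroot: "pairing (simple_root m i) (simple_coroot i) = 2"
  by (simp add: pairing_coroot simple_root_nth cartan_matrix_def)

lemma ad_sl2:
  "sl2_module (gscale L) (\<lambda>x. br (cartan L x)) (br (egen L i)) (br (fgen L i)) (simple_root m i) (simple_coroot i)"
proof (intro sl2_module.intro sl2_module_axioms.intro ad.weight_module_axioms br_lin simple_root_coroot)
  show "br (cartan L x) (br (egen L i) v) = br (egen L i) (br (cartan L x) v)
      + gscale L (pairing (simple_root m i) x) (br (egen L i) v)" for x v
    using br_derivation[of "cartan L x" "egen L i" v] by (simp add: cartan_e br_simps)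
  show "br (cartan L x) (br (fgen L i) v) = br (fgen L i) (br (cartan L x) v)
      - gscale L (pairing (simple_root m i) x) (br (fgen L i) v)" for x v
    using br_derivation[of "cartan L x" "fgen L i" v] by (simp add: cartan_f br_simps)
  show "br (egen L i) (br (fgen L i) v) = br (fgen L i) (br (egen L i) v) + br (cartan L (simple_coroot i)) v" for v
    using br_derivation[of "egen L i" "fgen L i" v] by (simp add: e_f)
qed

lemma egen_wspace: "egen L i \<in> ad.wspace (simple_root m i)"
  by (rule ad.wspaceI) (rule cartan_e)

lemma cartan_wspace: "cartan L h \<in> ad.wspace 0"
  by (rule ad.wspaceI) (simp add: cartan_cartan pairing_simps)

lemma e_monomial_wspace: "e_monomial L k x \<Longrightarrow> x \<in> ad.wspace (rt m (nat_vec k))"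
proof (induction rule: e_monomial.induct)
  case (gen i)
  then show ?case unfolding nat_vec_single by (simp add: rt_coroot egen_wspace)
next
  case (step k x i)
  then show ?case unfolding nat_vec_upd
    using sl2_module.e_wspace[OF ad_sl2 step.IH, of i] by (simp add: rt_linear rt_coroot)
qed

lemma e_monomial_pure:
  "e_monomial L k x \<Longrightarrow> \<forall>j. j \<noteq> i \<longrightarrow> k j = 0 \<Longrightarrow> x = 0 \<or> (x = egen L i \<and> k i = 1)"
proof (induction rule: e_monomial.induct)
  case (gen l)
  then have "l = i" by (metis zero_neq_one)
  then show ?case by simp
next
  case (step k x l)
  then have "l = i" by (metis fun_upd_same nat.distinct(1))
  moreover have "\<forall>j. j \<noteq> i \<longrightarrow> k j = 0" using step.prems \<open>l = i\<close> by (metis fun_upd_other)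
  ultimately show ?case using step.IH by (auto simp: br_simps br_self)
qed

lemma fgen_egen: "br (fgen L j) (egen L i) = (if i = j then - cartan L (simple_coroot i) else 0)"
  using br_anticommute[of "fgen L j" "egen L i"] by (auto simp: e_f)

lemma e_stable_borel:
  assumes "x \<in> ad.span (range (cartan L) \<union> {x. \<exists>k. e_monomial L k x})"
  shows "br (egen L i) x \<in> ad.span (range (cartan L) \<union> {x. \<exists>k. e_monomial L k x})"
proof (rule ad.lin_span[OF br_lin _ assms])
  fix s assume "s \<in> range (cartan L) \<union> {x. \<exists>k. e_monomial L k x}"
  then consider h where "s = cartan L h" | k where "e_monomial L k s" by blast
  then show "br (egen L i) s \<in> ad.span (range (cartan L) \<union> {x. \<exists>k. e_monomial L k x})"
  proof cases
    case 1
    have "br (egen L i) s = - gscale L (pairing (simple_root m i) h) (egen L i)"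
      unfolding 1 using br_anticommute[of "egen L i" "cartan L h"] by (simp only: cartan_e)
    moreover have "egen L i \<in> ad.span (range (cartan L) \<union> {x. \<exists>k. e_monomial L k x})"
      by (intro ad.span_base UnI2 CollectI e_monomial_egen)
    ultimately show ?thesis by (simp add: ad.span_neg ad.span_scale)
  next
    case 2
    then have "e_monomial L (k(i := Suc (k i))) (br (egen L i) s)" by (rule e_monomial.step)
    then show ?thesis by (intro ad.span_base UnI2 CollectI exI)
  qed
qed

text \<open>A lowering operator passes the letters of a monomial one at a time. Where it meets its partner, it leaves
  an element of the Cartan subalgebra, which acts on the rest of the monomial by a scalar.\<close>

lemma f_e_monomial:
  "e_monomial L k x \<Longrightarrow> br (fgen L j) x \<in> ad.span (range (cartan L) \<union> {x. \<exists>k. e_monomial L k x})"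
proof (induction rule: e_monomial.induct)
  case (gen i)
  have "cartan L h \<in> ad.span (range (cartan L) \<union> {x. \<exists>k. e_monomial L k x})" for h
    by (rule ad.span_base) simp
  then show ?case by (simp add: fgen_egen ad.span_neg ad.span_zero)
next
  case (step k x i)
  have "br (br (fgen L j) (egen L i)) x \<in> ad.span (range (cartan L) \<union> {x. \<exists>k. e_monomial L k x})"
  proof -
    have "x \<in> ad.span (range (cartan L) \<union> {x. \<exists>k. e_monomial L k x})"
      by (rule ad.span_base) (use step.hyps in blast)
    then show ?thesis
      using ad.wspaceD[OF e_monomial_wspace[OF step.hyps]]
      by (simp add: fgen_egen br_simps ad.span_neg ad.span_scale ad.span_zero)
  qed
  then show ?case
    using e_stable_borel[OF step.IH] by (simp add: br_derivation[of "fgen L j"] ad.span_add)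
qed

definition monomials :: "'g set" where
  "monomials = range (cartan L) \<union> {x. \<exists>k. e_monomial L k x}
     \<union> {x. \<exists>k. e_monomial (chevalley_involution L) k x}"

lemma monomials_involution: "hyperbolic_algebra.monomials (chevalley_involution L) = monomials"
proof -
  interpret I: hyperbolic_algebra m "chevalley_involution L" by (rule involution)
  have r: "range (\<lambda>h. cartan L (- h)) = range (cartan L)"
    by (auto simp: image_iff) (metis minus_minus)
  have "chevalley_involution (chevalley_involution L) = L"
    by (simp add: chevalley_involution_def)
  then show ?thesis
    unfolding I.monomials_def monomials_def by (simp add: chevalley_involution_simps r Un_ac)
qed

lemma e_stable_monomials:
  assumes "x \<in> ad.span monomials"
  shows "br (egen L i) x \<in> ad.span monomials"
proof (rule ad.lin_span[OF br_lin _ assms])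
  interpret I: hyperbolic_algebra m "chevalley_involution L" by (rule involution)
  have r: "range (\<lambda>h. cartan L (- h)) = range (cartan L)"
    by (auto simp: image_iff) (metis minus_minus)
  fix s assume "s \<in> monomials"
  then consider "s \<in> range (cartan L) \<union> {x. \<exists>k. e_monomial L k x}"
    | k where "e_monomial (chevalley_involution L) k s" unfolding monomials_def by blast
  then show "br (egen L i) s \<in> ad.span monomials"
  proof cases
    case 1
    then have "br (egen L i) s \<in> ad.span (range (cartan L) \<union> {x. \<exists>k. e_monomial L k x})"
      by (rule e_stable_borel[OF ad.span_base])
    moreover have "range (cartan L) \<union> {x. \<exists>k. e_monomial L k x} \<subseteq> monomials"
      unfolding monomials_def by blast
    ultimately show ?thesis using ad.span_mono by blast
  next
    case 2
    from I.f_e_monomial[OF 2, of i]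
    have "br (egen L i) s \<in> ad.span (range (cartan L) \<union> {x. \<exists>k. e_monomial (chevalley_involution L) k x})"
      by (simp add: chevalley_involution_simps r)
    moreover have "range (cartan L) \<union> {x. \<exists>k. e_monomial (chevalley_involution L) k x} \<subseteq> monomials"
      unfolding monomials_def by blast
    ultimately show ?thesis using ad.span_mono by blast
  qed
qed

lemma f_monomial_wspace:
  assumes "e_monomial (chevalley_involution L) k x"
  shows "x \<in> ad.wspace (- rt m (nat_vec k))"
proof -
  interpret I: hyperbolic_algebra m "chevalley_involution L" by (rule involution)
  have *: "br (cartan L (- h)) x = gscale L (pairing (rt m (nat_vec k)) h) x" for h
    using I.ad.wspaceD[OF I.e_monomial_wspace[OF assms], of h] by (simp add: chevalley_involution_simps)
  show ?thesis
  proof (rule ad.wspaceI)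
    fix h
    show "br (cartan L h) x = gscale L (pairing (- rt m (nat_vec k)) h) x"
      using *[of "- h"] by (simp add: pairing_simps)
  qed
qed

lemma monomials_weight: "s \<in> monomials \<Longrightarrow> \<exists>\<mu>. s \<in> ad.wspace \<mu>"
  unfolding monomials_def using cartan_wspace e_monomial_wspace f_monomial_wspace by blast

text \<open>The triangular decomposition: the span is stable under the generators, hence an ideal, and contains the generators.\<close>

lemma span_monomials: "ad.span monomials = UNIV"
proof (rule generated)
  interpret I: hyperbolic_algebra m "chevalley_involution L" by (rule involution)
  show sub: "ad.subspace (ad.span monomials)" by (rule ad.subspace_span)
  have f: "br (fgen L i) x \<in> ad.span monomials" if "x \<in> ad.span monomials" for i x
    using I.e_stable_monomials[of x i] that unfolding monomials_involution
    by (simp add: chevalley_involution_simps)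
  have h: "br (cartan L h) x \<in> ad.span monomials" if "x \<in> ad.span monomials" for h x
  proof (rule ad.lin_span[OF br_lin _ that])
    fix s assume s: "s \<in> monomials"
    then obtain \<mu> where "s \<in> ad.wspace \<mu>" using monomials_weight by blast
    then show "br (cartan L h) s \<in> ad.span monomials"
      using s by (simp add: ad.wspaceD ad.span_scale ad.span_base)
  qed
  show "br x y \<in> ad.span monomials" if "y \<in> ad.span monomials" for x y
    using ad_stable[OF sub h e_stable_monomials f that] .
  show "range (cartan L) \<subseteq> ad.span monomials" "range (egen L) \<subseteq> ad.span monomials"
    "range (fgen L) \<subseteq> ad.span monomials"
    using e_monomial_egen[of L] e_monomial_egen[of "chevalley_involution L"]
    by (auto simp: monomials_def chevalley_involution_simps intro!: ad.span_base)
qed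

lemma roots_alt: "roots L = {\<alpha>. \<alpha> \<noteq> 0 \<and> (\<exists>x. x \<noteq> 0 \<and> x \<in> ad.wspace \<alpha>)}"
  by (auto simp: roots_def ad.wspace_def)

text \<open>A root space is spanned by the monomials in it. As \<open>[e\<^sub>i, e\<^sub>i] = 0\<close>, the only nonzero monomials whose
  weight is a multiple of a simple root are the generators.\<close>

lemma root_cases:
  assumes "\<alpha> \<in> roots L"
  obtains k where "\<alpha> = rt m (nat_vec k) \<or> \<alpha> = - rt m (nat_vec k)"
    "\<And>i. (\<forall>j. j \<noteq> i \<longrightarrow> k j = 0) \<Longrightarrow> k i = 1"
proof -
  interpret I: hyperbolic_algebra m "chevalley_involution L" by (rule involution)
  from assms obtain x where x: "\<alpha> \<noteq> 0" "x \<noteq> 0" "x \<in> ad.wspace \<alpha>" by (auto simp: roots_alt)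
  obtain s where s: "s \<in> monomials" "s \<in> ad.wspace \<alpha>" "s \<noteq> 0"
    using ad.span_weight_component_nonzero[OF _ monomials_weight x(3,2)] span_monomials by blast
  then consider "s \<in> range (cartan L)" | k where "e_monomial L k s"
    | k where "e_monomial (chevalley_involution L) k s" unfolding monomials_def by blast
  then show ?thesis
  proof cases
    case 1
    then show ?thesis using cartan_wspace ad.wspace_disjoint[OF s(2) _ s(3)] x(1) by blast
  next
    case (2 k)
    then show ?thesis
      using that[of k] ad.wspace_disjoint[OF s(2) e_monomial_wspace s(3)] e_monomial_pure s(3) by blast
  next
    case (3 k)
    then show ?thesis
      using that[of k] ad.wspace_disjoint[OF s(2) f_monomial_wspace s(3)] I.e_monomial_pure s(3) by blast
  qed
qed

text \<open>The vector \<open>\<theta> = (ad e\<^sub>i)\<^sup>m\<^sup>+\<^sup>1 e\<^sub>j\<close> is annihilated by both lowering operators. For \<open>f\<^sub>j\<close> this holds as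
  \<open>(ad e\<^sub>i)\<^sup>2\<close> annihilates the Cartan subalgebra, for \<open>f\<^sub>i\<close> by the commutation rule for \<open>e\<^sup>n\<close> and \<open>f\<close>, since
  \<open>\<alpha>\<^sub>j(h\<^sub>i) = -m\<close>. So the raising operators alone generate from \<open>\<theta>\<close> an ideal with positive weights only.
  It meets the Cartan subalgebra trivially and hence vanishes.\<close>

lemma serre_relation:
  assumes "i \<noteq> j"
  shows "(br (egen L i) ^^ (m + 1)) (egen L j) = 0"
proof -
  interpret S: sl2_module "gscale L" "\<lambda>x. br (cartan L x)" "br (egen L i)" "br (fgen L i)"
      "simple_root m i" "simple_coroot i"
    by (rule ad_sl2)
  define \<theta> where "\<theta> = (br (egen L i) ^^ (m + 1)) (egen L j)"
  have mono: "e_monomial L (\<lambda>l. if l = j then 1 else if l = i then n else 0) ((br (egen L i) ^^ n) (egen L j))" for n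
  proof (induction n)
    case 0
    have "(\<lambda>l. if l = j then 1 else if l = i then 0 else 0) = (\<lambda>l. if l = j then 1 else (0::nat))" by auto
    then show ?case using e_monomial.gen[of L j] by simp
  next
    case (Suc n)
    have "(\<lambda>l. if l = j then 1 else if l = i then Suc n else 0)
        = (\<lambda>l. if l = j then 1 else if l = i then n else 0)(i := Suc ((\<lambda>l. if l = j then 1 else if l = i then n else 0) i))"
      using assms by auto
    then show ?case using e_monomial.step[OF Suc, of i] by simp
  qed
  \<comment> \<open>The vector \<open>\<theta>\<close> is annihilated by both lowering operators.\<close>
  have fi: "br (fgen L i) \<theta> = 0"
  proof -
    have "br (fgen L i) (egen L j) = 0" using assms by (simp add: fgen_egen)
    then have "br (fgen L i) \<theta> = gscale L (of_nat (m + 1) * (of_nat (m + 1) - 1)) ((br (egen L i) ^^ m) (egen L j))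
        - gscale L (of_nat (m + 1)) (br (cartan L (simple_coroot i)) ((br (egen L i) ^^ m) (egen L j)))"
      using S.e_pow_f[of "m + 1" "egen L j"] ad.lin_zero[OF linear_compow[OF br_lin]]
      by (simp add: \<theta>_def br_simps algebra_simps)
    also have "br (cartan L (simple_coroot i)) ((br (egen L i) ^^ m) (egen L j))
        = gscale L (of_nat m) ((br (egen L i) ^^ m) (egen L j))"
      using ad.wspaceD[OF e_monomial_wspace[OF mono], of "simple_coroot i" m] assms
      by (simp add: pairing_coroot rt_nth) (simp add: pairing_def sum_2_index[of _ i] nat_vec_nth
        simple_root_nth cartan_matrix_def other_index(3))
    finally show ?thesis by simp
  qed
  have fj: "br (fgen L j) \<theta> = 0"
  proof -
    have "br (fgen L j) (br (egen L i) y) = br (egen L i) (br (fgen L j) y)" for y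
      using br_derivation[of "fgen L j" "egen L i" y] assms by (simp add: fgen_egen br_simps)
    then have "br (fgen L j) ((br (egen L i) ^^ n) y) = (br (egen L i) ^^ n) (br (fgen L j) y)" for n y
      by (induction n) auto
    then have "br (fgen L j) \<theta> = (br (egen L i) ^^ (m + 1)) (- cartan L (simple_coroot j))"
      by (simp add: \<theta>_def fgen_egen del: funpow.simps)
    also have "\<dots> = (br (egen L i) ^^ m) (br (egen L i) (- cartan L (simple_coroot j)))"
      by (simp add: funpow_swap1)
    also have "br (egen L i) (- cartan L (simple_coroot j))
        = gscale L (pairing (simple_root m i) (simple_coroot j)) (egen L i)"
      using br_anticommute[of "egen L i" "cartan L (simple_coroot j)"] by (simp add: br_simps cartan_e)
    also have "(br (egen L i) ^^ m) \<dots> = 0"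
    proof -
      obtain n where "m = Suc n" using m_ge by (cases m) auto
      then show ?thesis
        by (simp add: funpow_swap1 br_simps br_self ad.lin_zero[OF linear_compow[OF br_lin]] del: funpow.simps)
           (simp add: funpow_Suc_right br_simps br_self ad.lin_zero[OF linear_compow[OF br_lin]] del: funpow.simps)
    qed
    finally show ?thesis .
  qed
  \<comment> \<open>Hence the subspace spanned by its images under the raising operators is an ideal of positive weights.\<close>
  define T where "T = {foldr (\<lambda>l. br (egen L l)) ls \<theta> | ls. True}"
  have Tmono: "\<exists>k. e_monomial L k s \<and> k j \<noteq> 0" if sT: "s \<in> T" for s
  proof -
    obtain ls where s: "s = foldr (\<lambda>l. br (egen L l)) ls \<theta>" using sT by (auto simp: T_def)
    show ?thesis unfolding s
    proof (induction ls)
      case Nil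
      show ?case using mono[of "m + 1"] unfolding \<theta>_def
        by (intro exI[of _ "\<lambda>l. if l = j then 1 else if l = i then m + 1 else 0"]) simp
    next
      case (Cons l ls)
      then obtain k where "e_monomial L k (foldr (\<lambda>l. br (egen L l)) ls \<theta>)" "k j \<noteq> 0" by blast
      then have "e_monomial L (k(l := Suc (k l))) (foldr (\<lambda>l. br (egen L l)) (l # ls) \<theta>)"
        "(k(l := Suc (k l))) j \<noteq> 0"
        using e_monomial.step[of L k "foldr (\<lambda>l. br (egen L l)) ls \<theta>" l] by (simp_all only: foldr.simps o_apply fun_upd_apply) auto
      then show ?case by blast
    qed
  qed
  then have Tweight: "\<exists>\<mu>. s \<in> ad.wspace \<mu>" if "s \<in> T" for s using e_monomial_wspace that by blast
  have e: "br (egen L l) x \<in> ad.span T" if "x \<in> ad.span T" for l x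
  proof (rule ad.lin_span[OF br_lin _ that])
    fix s assume "s \<in> T"
    then obtain ls where "s = foldr (\<lambda>l. br (egen L l)) ls \<theta>" by (auto simp: T_def)
    then have "br (egen L l) s = foldr (\<lambda>l. br (egen L l)) (l # ls) \<theta>" by simp
    then show "br (egen L l) s \<in> ad.span T" unfolding T_def by (intro ad.span_base) blast
  qed
  have h: "br (cartan L h) x \<in> ad.span T" if "x \<in> ad.span T" for h x
  proof (rule ad.lin_span[OF br_lin _ that])
    fix s assume s: "s \<in> T"
    then obtain \<mu> where "s \<in> ad.wspace \<mu>" using Tweight by blast
    then show "br (cartan L h) s \<in> ad.span T"
      using s by (simp add: ad.wspaceD ad.span_scale ad.span_base)
  qed
  have f: "br (fgen L l) x \<in> ad.span T" if "x \<in> ad.span T" for l x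
  proof (rule ad.lin_span[OF br_lin _ that])
    fix s assume "s \<in> T"
    then obtain ls where s: "s = foldr (\<lambda>l. br (egen L l)) ls \<theta>" by (auto simp: T_def)
    show "br (fgen L l) s \<in> ad.span T" unfolding s
    proof (induction ls)
      case Nil
      show ?case using fi fj exhaust_2[of i] exhaust_2[of j] exhaust_2[of l] assms
        by (auto simp: ad.span_zero)
    next
      case (Cons l' ls)
      let ?t = "foldr (\<lambda>l. br (egen L l)) ls \<theta>"
      have t: "?t \<in> ad.span T" by (rule ad.span_base) (auto simp: T_def)
      have "br (br (fgen L l) (egen L l')) ?t \<in> ad.span T"
        using h[OF t] by (simp add: fgen_egen br_simps ad.span_neg ad.span_zero)
      then show ?case
        using e[OF Cons] by (simp add: br_derivation[of "fgen L l"] ad.span_add)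
    qed
  qed
  have "ad.span T = {0}"
  proof (rule no_ideal)
    show "ad.subspace (ad.span T)" by (rule ad.subspace_span)
    show "br x y \<in> ad.span T" if "y \<in> ad.span T" for x y
      by (rule ad_stable[OF ad.subspace_span h e f that])
    have "x = 0" if x: "x \<in> ad.span T" "x \<in> range (cartan L)" for x
    proof (rule ccontr)
      assume "x \<noteq> 0"
      moreover have "x \<in> ad.wspace 0" using x(2) cartan_wspace by blast
      ultimately obtain s where s: "s \<in> T" "s \<in> ad.wspace 0" "s \<noteq> 0"
        using ad.span_weight_component_nonzero[OF x(1) Tweight] by blast
      then obtain k where k: "e_monomial L k s" "k j \<noteq> 0" using Tmono by blast
      have "rt m (nat_vec k) = rt m 0"
        using ad.wspace_disjoint[OF e_monomial_wspace[OF k(1)] s(2,3)] by (simp add: vec_eq_iff rt_nth pairing_def)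
      then have "nat_vec k = 0" by (rule rt_inj[OF m_ge])
      then show False using k(2) nat_vec_nth[of k j] by simp
    qed
    then show "ad.span T \<inter> range (cartan L) = {0}"
      using cartan_zero ad.span_zero by force
  qed
  moreover have "\<theta> \<in> ad.span T"
    by (rule ad.span_base) (auto simp: T_def intro: exI[of _ "[]"])
  ultimately show ?thesis by (simp add: \<theta>_def)
qed

text \<open>Distributing the derivation over the bracket, each term has absorbed at least \<open>a\<close> copies in the first or \<open>b\<close> copies in the
  second factor.\<close>

lemma derivation_nilpotent_bracket:
  assumes "(br z ^^ a) x = 0" "(br z ^^ b) y = 0"
  shows "(br z ^^ (a + b)) (br x y) = 0"
  using assms
proof (induction "a + b" arbitrary: a b x y)
  case 0
  then show ?case by (simp add: br_simps)
next
  case (Suc n)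
  note lz = ad.lin_zero[OF linear_compow[OF br_lin]]
  show ?case
  proof (cases "a = 0 \<or> b = 0")
    case True
    then have "x = 0 \<or> y = 0" using Suc.prems by auto
    then show ?thesis using lz by (auto simp: br_simps)
  next
    case False
    then obtain a' b' where ab: "a = Suc a'" "b = Suc b'" by (metis nat.exhaust)
    have n: "n = a' + b" "n = a + b'" using Suc.hyps(2) ab by auto
    have "(br z ^^ n) (br (br z x) y) = 0"
      using Suc.hyps(1)[OF n(1), of "br z x" y] Suc.prems n by (simp add: ab funpow_Suc_right del: funpow.simps)
    moreover have "(br z ^^ n) (br x (br z y)) = 0"
      using Suc.hyps(1)[OF n(2), of x "br z y"] Suc.prems n by (simp add: ab funpow_Suc_right del: funpow.simps)
    ultimately have "(br z ^^ n) (br z (br x y)) = 0"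
      by (simp add: br_derivation[of z] ad.lin_add[OF linear_compow[OF br_lin]])
    then show ?thesis by (simp add: Suc.hyps(2)[symmetric] funpow_Suc_right del: funpow.simps)
  qed
qed

text \<open>The elements annihilated by some power of \<open>ad e\<^sub>i\<close> form a subalgebra. It contains the generators, \<open>e\<^sub>j\<close> by the Serre
  relation.\<close>

lemma ad_egen_nilpotent: "\<exists>n. (br (egen L i) ^^ n) x = 0"
proof -
  let ?N = "{x. \<exists>n. (br (egen L i) ^^ n) x = 0}"
  note lp = linear_compow[OF br_lin[of "egen L i"]]
  have "?N = UNIV"
  proof (rule generated)
    show "ad.subspace ?N"
      unfolding ad.subspace_def
    proof (intro conjI ballI allI)
      show "0 \<in> ?N" by (auto intro: exI[of _ 0])
      show "gscale L c x \<in> ?N" if "x \<in> ?N" for c x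
        using that by (auto simp: ad.lin_scale[OF lp])
      fix x y assume "x \<in> ?N" "y \<in> ?N"
      then obtain a b where "(br (egen L i) ^^ a) x = 0" "(br (egen L i) ^^ b) y = 0" by blast
      then have "(br (egen L i) ^^ (max a b)) x = 0" "(br (egen L i) ^^ (max a b)) y = 0"
        by (auto intro: ad.compow_eq_0_mono[OF br_lin])
      then have "(br (egen L i) ^^ (max a b)) (x + y) = 0" by (simp add: ad.lin_add[OF lp])
      then show "x + y \<in> ?N" by blast
    qed
    show "br x y \<in> ?N" if "x \<in> ?N" "y \<in> ?N" for x y
      using that derivation_nilpotent_bracket by blast
    have c: "br (egen L i) (cartan L h) = - gscale L (pairing (simple_root m i) h) (egen L i)" for h
      using br_anticommute[of "egen L i" "cartan L h"] by (simp only: cartan_e)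
    then have c2: "(br (egen L i) ^^ 2) (cartan L h) = 0" for h
      by (simp add: numeral_2_eq_2 br_simps br_self)
    then show "range (cartan L) \<subseteq> ?N" by blast
    show "range (egen L) \<subseteq> ?N"
    proof
      fix x assume "x \<in> range (egen L)"
      then obtain j where x: "x = egen L j" by blast
      show "x \<in> ?N"
      proof (cases "i = j")
        case True
        then have "(br (egen L i) ^^ 1) x = 0" by (simp add: x br_self)
        then show ?thesis by blast
      next
        case False
        then show ?thesis using serre_relation[OF False] unfolding x by blast
      qed
    qed
    show "range (fgen L) \<subseteq> ?N"
    proof
      fix x assume "x \<in> range (fgen L)"
      then obtain j where x: "x = fgen L j" by blast
      have "br (egen L i) x = (if i = j then cartan L (simple_coroot i) else 0)" by (simp add: x e_f)
      then have "(br (egen L i) ^^ 3) x = 0"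
        using c2[of "simple_coroot i"] by (cases "i = j") (auto simp: numeral_3_eq_3 numeral_2_eq_2 br_simps)
      then show "x \<in> ?N" by blast
    qed
  qed
  then show ?thesis by blast
qed

lemma ad_integrable:
  "integrable_sl2_module (gscale L) (\<lambda>x. br (cartan L x)) (br (egen L i)) (br (fgen L i)) (simple_root m i) (simple_coroot i)"
proof -
  interpret I: hyperbolic_algebra m "chevalley_involution L" by (rule involution)
  show ?thesis
    using ad_sl2[of i] ad_egen_nilpotent[of i] I.ad_egen_nilpotent[of i]
    by (simp add: integrable_sl2_module_def integrable_sl2_module_axioms_def chevalley_involution_simps)
qed

text \<open>The adjoint representation is integrable, so the operator lifting the simple reflection is a bijection between the two
  root spaces.\<close>

lemma roots_dual_reflection:
  assumes "\<alpha> \<in> roots L"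
  shows "dual_reflection m i \<alpha> \<in> roots L"
proof -
  interpret S: integrable_sl2_module "gscale L" "\<lambda>x. br (cartan L x)" "br (egen L i)" "br (fgen L i)"
      "simple_root m i" "simple_coroot i"
    by (rule ad_integrable)
  from assms obtain x where x: "\<alpha> \<noteq> 0" "x \<noteq> 0" "x \<in> ad.wspace \<alpha>" by (auto simp: roots_alt)
  have "S.reflect \<alpha> = dual_reflection m i \<alpha>" by (simp add: S.reflect_def dual_reflection_def pairing_coroot)
  then have "S.weyl_op x \<in> ad.wspace (dual_reflection m i \<alpha>)" using S.weyl_op_wspace[OF x(3)] by simp
  moreover have "S.weyl_op x \<noteq> 0"
    using x(2) injD[OF bij_is_inj[OF S.weyl_op_bij], of x 0] ad.lin_zero[OF S.weyl_op_lin] by auto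
  moreover have "dual_reflection m i \<alpha> \<noteq> 0"
  proof
    assume "dual_reflection m i \<alpha> = 0"
    then have "\<alpha> = dual_reflection m i 0" using dual_reflection_dual_reflection[of m i \<alpha>] by simp
    then show False using x(1) by (simp add: dual_reflection_def)
  qed
  ultimately show ?thesis by (auto simp: roots_alt)
qed

lemma pos_roots_alt: "pos_roots m L = {\<alpha> \<in> roots L. \<exists>k. \<alpha> = rt m (nat_vec k)}"
  and neg_roots_alt: "neg_roots m L = {\<alpha> \<in> roots L. \<exists>k. \<alpha> = - rt m (nat_vec k)}"
  by (simp_all add: pos_roots_def neg_roots_def rt_nat_vec)

text \<open>A positive root other than \<open>\<alpha>\<^sub>i\<close> is no multiple of \<open>\<alpha>\<^sub>i\<close>, so its other coordinate is positive. The reflection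
  keeps this coordinate, and all coordinates of a root have the same sign.\<close>

lemma pos_roots_dual_reflection:
  assumes "\<alpha> \<in> pos_roots m L" "\<alpha> \<noteq> simple_root m i"
  shows "dual_reflection m i \<alpha> \<in> pos_roots m L"
proof -
  from assms(1) obtain k where k: "\<alpha> = rt m (nat_vec k)" "\<alpha> \<in> roots L" by (auto simp: pos_roots_alt)
  obtain k' where k': "\<alpha> = rt m (nat_vec k') \<or> \<alpha> = - rt m (nat_vec k')"
    "\<And>i. (\<forall>j. j \<noteq> i \<longrightarrow> k' j = 0) \<Longrightarrow> k' i = 1"
    using root_cases[OF k(2)] by metis
  have "\<alpha> = rt m (nat_vec k')"
  proof (rule ccontr)
    assume "\<alpha> \<noteq> rt m (nat_vec k')"
    then have "rt m (nat_vec k) = rt m (- nat_vec k')" using k' k by (simp add: rt_linear)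
    then have "nat_vec k $ l = - nat_vec k' $ l" for l using rt_inj[OF m_ge] by (metis vector_uminus_component)
    then have "of_nat (k l + k' l) = (0::complex)" for l by (simp add: nat_vec_nth)
    then have "k l + k' l = 0" for l by (simp only: of_nat_eq_0_iff)
    then show False using k'(2)[of i] by simp
  qed
  then have "k = k'" using k(1) rt_inj[OF m_ge] nat_vec_inj by metis
  obtain j where j: "j \<noteq> i" "k j \<noteq> 0"
  proof (rule ccontr)
    assume "\<not> thesis"
    then have z: "\<forall>j. j \<noteq> i \<longrightarrow> k j = 0" using that by blast
    then have "k = (\<lambda>j. if j = i then 1 else 0)" using k'(2)[of i] \<open>k = k'\<close> by auto
    then have "\<alpha> = simple_root m i" using k(1) nat_vec_single[of i] by (simp add: rt_coroot)
    then show False using assms(2) by simp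
  qed
  have r: "dual_reflection m i \<alpha> = rt m (reflection m i (nat_vec k))" by (simp add: rt_reflection k(1))
  have rj: "reflection m i (nat_vec k) $ j = of_nat (k j)"
    using j(1) by (simp add: reflection_def simple_coroot_def axis_def nat_vec_nth)
  have root: "dual_reflection m i \<alpha> \<in> roots L" by (rule roots_dual_reflection[OF k(2)])
  then obtain l where "dual_reflection m i \<alpha> = rt m (nat_vec l) \<or> dual_reflection m i \<alpha> = - rt m (nat_vec l)"
    using root_cases by metis
  moreover have "dual_reflection m i \<alpha> \<noteq> - rt m (nat_vec l)"
  proof
    assume "dual_reflection m i \<alpha> = - rt m (nat_vec l)"
    then have "reflection m i (nat_vec k) = - nat_vec l"
      unfolding r rt_linear(3)[symmetric] by (rule rt_inj[OF m_ge])
    then have e: "of_nat (k j) = - (of_nat (l j) :: complex)" using rj by (simp add: nat_vec_nth)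
    have "of_nat (k j + l j) = (0::complex)" unfolding of_nat_add e by simp
    then have "k j + l j = 0" by (simp only: of_nat_eq_0_iff)
    then show False using j(2) by simp
  qed
  ultimately show ?thesis using root by (auto simp: pos_roots_alt)
qed

text \<open>By induction on the word: the positive roots that \<open>w r\<^sub>i\<close> makes negative are \<open>\<alpha>\<^sub>i\<close> or images under \<open>r\<^sub>i\<close> of
  positive roots that \<open>w\<close> makes negative. In this way all of them are obtained from simple roots by reflections.\<close>

lemma inversion_set:
  defines "X \<equiv> \<lambda>is. {\<alpha> \<in> pos_roots m L. dual_word m is \<alpha> \<in> neg_roots m L}"
  shows "finite (X is) \<and> card (X is) \<le> length is
    \<and> (\<forall>\<alpha>\<in>X is. \<exists>js i. \<alpha> = dual_word m js (simple_root m i))"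
proof (induction "is" rule: rev_induct)
  case Nil
  have "X [] = {}"
  proof (rule ccontr)
    assume "X [] \<noteq> {}"
    then obtain \<alpha> where "\<alpha> \<in> pos_roots m L" "\<alpha> \<in> neg_roots m L"
      by (auto simp: X_def dual_word_simps)
    then obtain k l where a: "\<alpha> \<in> roots L" "\<alpha> = rt m (nat_vec k)" "\<alpha> = - rt m (nat_vec l)"
      unfolding pos_roots_alt neg_roots_alt by blast
    then have "rt m (nat_vec k) = rt m (- nat_vec l)" by (simp add: rt_linear)
    then have "nat_vec k = - nat_vec l" by (rule rt_inj[OF m_ge])
    then have "of_nat (k i + l i) = (0::complex)" for i by (metis nat_vec_nth vector_uminus_component
        of_nat_add add.right_inverse add.commute)
    then have "k i + l i = 0" for i by (simp only: of_nat_eq_0_iff)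
    then have "nat_vec k = 0" by (simp add: vec_eq_iff nat_vec_nth)
    then have "\<alpha> = 0" using a(2) by (simp add: vec_eq_iff rt_nth pairing_def)
    then show False using a(1) by (simp add: roots_alt)
  qed
  then show ?case by simp
next
  case (snoc i "is")
  have sub: "X (is @ [i]) \<subseteq> insert (simple_root m i) (dual_reflection m i ` X is)"
  proof
    fix \<alpha> assume \<alpha>: "\<alpha> \<in> X (is @ [i])"
    show "\<alpha> \<in> insert (simple_root m i) (dual_reflection m i ` X is)"
    proof (cases "\<alpha> = simple_root m i")
      case False
      then have "dual_reflection m i \<alpha> \<in> X is"
        using \<alpha> pos_roots_dual_reflection by (auto simp: X_def dual_word_append dual_word_simps)
      then show ?thesis by (metis dual_reflection_dual_reflection image_eqI insertCI)
    qed simp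
  qed
  have fin: "finite (insert (simple_root m i) (dual_reflection m i ` X is))" using snoc by simp
  have "card (X (is @ [i])) \<le> card (insert (simple_root m i) (dual_reflection m i ` X is))"
    by (rule card_mono[OF fin sub])
  also have "\<dots> \<le> Suc (card (dual_reflection m i ` X is))" by (rule card_insert_le_m1) simp_all
  also have "\<dots> \<le> Suc (card (X is))" using snoc by (simp add: card_image_le)
  finally have "card (X (is @ [i])) \<le> length (is @ [i])" using snoc by simp
  moreover have "\<exists>js l. \<alpha> = dual_word m js (simple_root m l)" if \<alpha>: "\<alpha> \<in> X (is @ [i])" for \<alpha>
  proof (cases "\<alpha> = simple_root m i")
    case True
    then have "\<alpha> = dual_word m [] (simple_root m i)" by (simp add: dual_word_simps)
    then show ?thesis by blast
  next
    case False
    then obtain \<beta> where \<beta>: "\<beta> \<in> X is" "\<alpha> = dual_reflection m i \<beta>" using sub \<alpha> by blast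
    then obtain js l where "\<beta> = dual_word m js (simple_root m l)" using snoc by blast
    then have "\<alpha> = dual_word m (i # js) (simple_root m l)" using \<beta>(2) by (simp add: dual_word_simps)
    then show ?thesis by blast
  qed
  ultimately show ?case using finite_subset[OF sub fin] by blast
qed

end

section \<open>The highest weight module\<close>

text \<open>The vectors \<open>f\<^sub>i\<^sub>1 \<cdots> f\<^sub>i\<^sub>r v\<close> with \<open>v\<close> the highest weight vector, indexed by the multiplicities of
  their letters.\<close>

inductive hw_monomial :: "('g, 'v, 'z) km_module_scheme \<Rightarrow> (2 \<Rightarrow> nat) \<Rightarrow> 'v \<Rightarrow> bool" for M where
  base: "hw_monomial M (\<lambda>_. 0) (hwv M)"
| step: "hw_monomial M k x \<Longrightarrow> hw_monomial M (k(i := Suc (k i))) (act M (fgen M i) x)"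

context kac_moody_setting
begin

sublocale hyperbolic_algebra m M
  by unfold_locales (rule m_ge_3)

sublocale V: weight_module "vscale M" "\<lambda>x. act M (cartan M x)"
  using vector_space act_linear_right
  by (simp add: weight_module_def weight_module_axioms_def complex_space_def)

lemma weight_space_eq: "weight_space M \<mu> = V.wspace \<mu>"
  by (simp add: weight_space_def V.wspace_def)

lemma act_left: "act M (x + y) v = act M x v + act M y v" "act M (gscale M c x) v = vscale M c (act M x v)"
  "act M 0 v = 0" "act M (- x) v = - act M x v"
proof -
  show *: "act M (x + y) v = act M x v + act M y v" "act M (gscale M c x) v = vscale M c (act M x v)" for x y c
    using act_linear_left[of v] by (simp_all add: Vector_Spaces.linear_iff)
  show "act M 0 v = 0" using *(2)[of 0 0] by simp
  show "act M (- x) v = - act M x v" using *(2)[of "-1" x] by simp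
qed

lemma act_lin: "V.lin (act M x)"
  by (rule act_linear_right)

lemmas act_simps = act_left V.lin_add[OF act_lin] V.lin_scale[OF act_lin] V.lin_zero[OF act_lin]

lemma V_integrable:
  "integrable_sl2_module (vscale M) (\<lambda>x. act M (cartan M x)) (act M (egen M i)) (act M (fgen M i))
     (simple_root m i) (simple_coroot i)"
proof (intro integrable_sl2_module.intro integrable_sl2_module_axioms.intro sl2_module.intro
    sl2_module_axioms.intro V.weight_module_axioms act_lin simple_root_coroot integrable_e integrable_f)
  show "act M (cartan M x) (act M (egen M i) v) = act M (egen M i) (act M (cartan M x) v)
      + vscale M (pairing (simple_root m i) x) (act M (egen M i) v)" for x v
    using act_bracket[of "cartan M x" "egen M i" v] by (simp add: cartan_e act_simps algebra_simps)
  show "act M (cartan M x) (act M (fgen M i) v) = act M (fgen M i) (act M (cartan M x) v)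
      - vscale M (pairing (simple_root m i) x) (act M (fgen M i) v)" for x v
    using act_bracket[of "cartan M x" "fgen M i" v] by (simp add: cartan_f act_simps algebra_simps)
  show "act M (egen M i) (act M (fgen M i) v) = act M (fgen M i) (act M (egen M i) v)
      + act M (cartan M (simple_coroot i)) v" for v
    using act_bracket[of "egen M i" "fgen M i" v] by (simp add: e_f algebra_simps)
qed

lemma V_span: "V.span (\<Union>\<mu>. V.wspace \<mu>) = UNIV"
  using integrable_diag by (simp add: weight_space_eq)

lemma e_f_act:
  "act M (egen M i) (act M (fgen M j) v) = act M (fgen M j) (act M (egen M i) v)
    + (if i = j then act M (cartan M (simple_coroot i)) v else 0)"
  using act_bracket[of "egen M i" "fgen M j" v] by (simp add: e_f act_simps algebra_simps split: if_splits)

lemma hw_monomial_wspace: "hw_monomial M k x \<Longrightarrow> x \<in> V.wspace (hw M - rt m (nat_vec k))"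
proof (induction rule: hw_monomial.induct)
  case base
  have "rt m (nat_vec (\<lambda>_. 0)) = 0" by (simp add: rt_nat_vec)
  then show ?case using hwv_weight by (simp add: weight_space_eq)
next
  case (step k x i)
  interpret S: integrable_sl2_module "vscale M" "\<lambda>x. act M (cartan M x)" "act M (egen M i)" "act M (fgen M i)"
      "simple_root m i" "simple_coroot i"
    by (rule V_integrable)
  show ?case unfolding nat_vec_upd
    using S.f_wspace[OF step.IH] by (simp add: rt_linear rt_coroot algebra_simps)
qed

lemma hw_monomial_zero:
  assumes "hw_monomial M k x" "k = (\<lambda>_. 0)"
  shows "x = hwv M"
proof -
  have "x = hwv M \<or> (\<exists>k' i. k = k'(i := Suc (k' i)))"
    using assms(1) by (cases rule: hw_monomial.cases) auto
  moreover have "k \<noteq> k'(i := Suc (k' i))" for k' i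
    unfolding assms(2) by (metis fun_upd_same nat.distinct(1))
  ultimately show ?thesis by blast
qed

text \<open>The span is stable under the generators, hence under the algebra, and \<open>V\<close> is irreducible.\<close>

lemma span_hw_monomials: "V.span {x. \<exists>k. hw_monomial M k x} = UNIV"
proof -
  let ?S = "V.span {x. \<exists>k. hw_monomial M k x}"
  have mono: "x \<in> ?S" if "hw_monomial M k x" for k x
    using that by (intro V.span_base) blast
  have f: "act M (fgen M i) v \<in> ?S" if "v \<in> ?S" for i v
  proof (rule V.lin_span[OF act_lin _ that])
    fix s assume "s \<in> {x. \<exists>k. hw_monomial M k x}"
    then obtain k where "hw_monomial M k s" by blast
    from mono[OF hw_monomial.step[OF this]] show "act M (fgen M i) s \<in> ?S" .
  qed
  have h: "act M (cartan M h) v \<in> ?S" if "v \<in> ?S" for h v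
  proof (rule V.lin_span[OF act_lin _ that])
    fix s assume "s \<in> {x. \<exists>k. hw_monomial M k x}"
    then obtain k where k: "hw_monomial M k s" by blast
    then show "act M (cartan M h) s \<in> ?S"
      using V.wspaceD[OF hw_monomial_wspace[OF k]] mono by (simp add: V.span_scale)
  qed
  have em: "act M (egen M i) x \<in> ?S" if "hw_monomial M k x" for i k x
    using that
  proof (induction rule: hw_monomial.induct)
    case base
    then show ?case by (simp add: hwv_e V.span_zero)
  next
    case (step k x j)
    show ?case using f[OF step.IH] h[OF mono[OF step.hyps]] by (cases "i = j") (auto simp: e_f_act intro: V.span_add)
  qed
  have e: "act M (egen M i) v \<in> ?S" if "v \<in> ?S" for i v
    by (rule V.lin_span[OF act_lin _ that]) (use em in blast)
  have "act M x v \<in> ?S" if "v \<in> ?S" for x v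
    by (rule stable_under_generators[of "vscale M" "act M", OF vector_space act_linear_left act_bracket
          V.subspace_span h e f that])
  then have "?S = {0} \<or> ?S = UNIV" by (rule irreducible[OF V.subspace_span])
  moreover have "hwv M \<in> ?S" by (rule mono[OF hw_monomial.base])
  ultimately show ?thesis using hwv_nonzero by blast
qed

lemma weights_below:
  assumes "v \<in> V.wspace \<mu>" "v \<noteq> 0"
  obtains k where "\<mu> = hw M - rt m (nat_vec k)"
proof -
  obtain s where s: "s \<in> {x. \<exists>k. hw_monomial M k x}" "s \<in> V.wspace \<mu>" "s \<noteq> 0"
    using V.span_weight_component_nonzero[of v "{x. \<exists>k. hw_monomial M k x}" \<mu>] assms
      hw_monomial_wspace span_hw_monomials by blast
  then obtain k where "hw_monomial M k s" by blast
  then show ?thesis using that V.wspace_disjoint[OF s(2) hw_monomial_wspace s(3)] by blast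
qed

lemma hw_space_one_dim:
  assumes "v \<in> V.wspace (hw M)"
  obtains c where "v = vscale M c (hwv M)"
proof -
  let ?H = "{x. \<exists>k. hw_monomial M k x}"
  have "v \<in> V.span (?H \<inter> V.wspace (hw M))"
    using V.span_weight_component[of v ?H, OF _ _ assms] span_hw_monomials hw_monomial_wspace by blast
  moreover have "?H \<inter> V.wspace (hw M) \<subseteq> {hwv M, 0}"
  proof
    fix s assume s: "s \<in> ?H \<inter> V.wspace (hw M)"
    then obtain k where k: "hw_monomial M k s" by blast
    show "s \<in> {hwv M, 0}"
    proof (cases "s = 0")
      case False
      then have "hw M = hw M - rt m (nat_vec k)"
        using V.wspace_disjoint[OF _ hw_monomial_wspace[OF k]] s by blast
      then have "rt m (nat_vec k) = rt m (nat_vec (\<lambda>_. 0))" by (simp add: rt_nat_vec)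
      then have "k = (\<lambda>_. 0)" using rt_inj[OF m_ge] nat_vec_inj by blast
      then show ?thesis using hw_monomial_zero[OF k] by simp
    qed simp
  qed
  ultimately have "v \<in> V.span {hwv M, 0}" using V.span_mono by blast
  then show ?thesis using that by (auto simp: V.span_insert_0 insert_commute[of "hwv M" 0] V.span_singleton)
qed

lemma herm_simps: "herm M (x + y) z = herm M x z + herm M y z" "herm M (vscale M c x) z = c * herm M x z"
  "herm M z (x + y) = herm M z x + herm M z y" "herm M z (vscale M c x) = cnj c * herm M z x"
  "herm M 0 z = 0" "herm M z 0 = 0"
proof -
  show *: "herm M (x + y) z = herm M x z + herm M y z" "herm M (vscale M c x) z = c * herm M x z" for x y z c
    using herm_linear[of z] by (simp_all add: Vector_Spaces.linear_iff)
  show "herm M z (x + y) = herm M z x + herm M z y"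
    using *(1)[of x y z] herm_sym[of z] by (metis complex_cnj_add)
  show "herm M z (vscale M c x) = cnj c * herm M z x"
    using *(2)[of c x z] herm_sym[of z] by (metis complex_cnj_mult)
  show **: "herm M 0 z = 0" for z using *(2)[of 0 0 z] by simp
  show "herm M z 0 = 0" using herm_sym[of z 0] ** by simp
qed

abbreviation fv :: "2 \<Rightarrow> 'v" where
  "fv i \<equiv> act M (fgen M i) (hwv M)"

lemma herm_fv: "herm M (fv i) (fv i) = hw M $ i"
proof -
  have "herm M (fv i) (fv i) = herm M (act M (egen M i) (fv i)) (hwv M)" by (simp add: herm_contra)
  also have "act M (egen M i) (fv i) = vscale M (hw M $ i) (hwv M)"
    using V.wspaceD[of "hwv M" "hw M" "simple_coroot i"] hwv_weight
    by (simp add: e_f_act hwv_e act_simps weight_space_eq pairing_coroot)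
  finally show ?thesis by (simp add: herm_simps herm_hwv)
qed

lemma herm_fv_hwv: "herm M (fv i) (hwv M) = 0" "herm M (hwv M) (fv i) = 0"
  using herm_contra[of i "hwv M" "hwv M"] herm_sym[of "fv i" "hwv M"] by (simp_all add: hwv_e herm_simps)

text \<open>As \<open>\<lambda>(h\<^sub>i)\<close> is the squared norm of \<open>f\<^sub>i v\<close>, positivity of the contravariant form makes \<open>\<lambda>\<close> dominant.\<close>

lemma hw_real: "hw M $ i = of_real (Re (hw M $ i))" "Re (hw M $ i) \<ge> 0" "Re (hw M $ i) > 0 \<Longrightarrow> fv i \<noteq> 0"
proof -
  have "cnj (hw M $ i) = hw M $ i" using herm_sym[of "fv i" "fv i"] by (simp add: herm_fv)
  then show "hw M $ i = of_real (Re (hw M $ i))" by (simp add: complex_eq_iff)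
  show "Re (hw M $ i) \<ge> 0"
  proof (cases "fv i = 0")
    case True
    then show ?thesis using herm_fv[of i] by (simp add: herm_simps)
  next
    case False
    then show ?thesis using herm_pos[OF False] by (simp add: herm_fv)
  qed
  show "fv i \<noteq> 0" if "Re (hw M $ i) > 0"
    using that herm_fv[of i] by (auto simp: herm_simps)
qed

lemma hw_pos:
  obtains j where "Re (hw M $ j) > 0"
proof -
  have "\<exists>j. hw M $ j \<noteq> 0" using hw_nonzero by (simp add: vec_eq_iff)
  then obtain j where "hw M $ j \<noteq> 0" by blast
  then have "Re (hw M $ j) > 0" using hw_real(1,2)[of j] by (metis of_real_0 order_le_less)
  then show ?thesis by (rule that)
qed

lemma hwv_wspace: "hwv M \<in> V.wspace (hw M)"
  using hwv_weight by (simp add: weight_space_eq)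

lemma fv_wspace: "fv i \<in> V.wspace (hw M - simple_root m i)"
proof -
  interpret S: integrable_sl2_module "vscale M" "\<lambda>x. act M (cartan M x)" "act M (egen M i)" "act M (fgen M i)"
      "simple_root m i" "simple_coroot i"
    by (rule V_integrable)
  show ?thesis by (rule S.f_wspace[OF hwv_wspace])
qed

section \<open>The torus\<close>

lemma w_elt_lin: "t \<noteq> 0 \<Longrightarrow> V.lin (w_elt M i t)"
  and w_elt_bij: "t \<noteq> 0 \<Longrightarrow> bij (w_elt M i t)"
  and w_elt_wspace_iff: "w_elt M i 1 v \<in> V.wspace (dual_reflection m i \<mu>) \<longleftrightarrow> v \<in> V.wspace \<mu>"
  and h_elt_wspace: "s > 0 \<Longrightarrow> v \<in> V.wspace \<mu> \<Longrightarrow> h_elt M i s v = vscale M (of_real s powr \<mu> $ i) v"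
proof -
  interpret S: integrable_sl2_module "vscale M" "\<lambda>x. act M (cartan M x)" "act M (egen M i)" "act M (fgen M i)"
      "simple_root m i" "simple_coroot i"
    by (rule V_integrable)
  have w: "w_elt M i t = integrable_sl2_module.weyl_op (vscale M) (\<lambda>v. vscale M (of_real t) (act M (egen M i) v))
      (\<lambda>v. vscale M (inverse (of_real t)) (act M (fgen M i) v))" if "t \<noteq> 0" for t
    unfolding integrable_sl2_module.weyl_op_def[OF S.rescale_integrable[of "of_real t", simplified, OF that]]
    by (simp add: w_elt_def chi_pos_def chi_neg_def)
  have w1: "w_elt M i 1 = S.weyl_op" using w[of 1] by simp
  show "V.lin (w_elt M i t)" "bij (w_elt M i t)" if "t \<noteq> 0"
    unfolding w[OF that]
    using integrable_sl2_module.weyl_op_lin[OF S.rescale_integrable[of "of_real t"]]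
      integrable_sl2_module.weyl_op_bij[OF S.rescale_integrable[of "of_real t"]] that by simp_all
  have "S.reflect \<mu> = dual_reflection m i \<mu>" for \<mu>
    by (simp add: S.reflect_def dual_reflection_def pairing_coroot)
  then show "w_elt M i 1 v \<in> V.wspace (dual_reflection m i \<mu>) \<longleftrightarrow> v \<in> V.wspace \<mu>"
    using S.weyl_op_wspace_iff[of v \<mu>] by (simp add: w1)
  show "h_elt M i s v = vscale M (of_real s powr \<mu> $ i) v" if "s > 0" "v \<in> V.wspace \<mu>"
    using S.torus_action[OF V_span that] that(1)
    by (simp add: h_elt_def w w1 pairing_coroot)
qed

text \<open>The logarithm of \<open>h\<^sub>1(x\<^sub>1) h\<^sub>2(x\<^sub>2)\<close> in the Cartan subalgebra, so that \<open>a\<^sup>\<mu> = exp (\<mu>(log a))\<close>.\<close>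

definition log_vec :: "real \<Rightarrow> real \<Rightarrow> complex^2" where
  "log_vec x1 x2 = (\<chi> i. of_real (ln (if i = 1 then x1 else x2)))"

lemma exp_log_vec:
  assumes "x1 > 0" "x2 > 0"
  shows "of_real x1 powr \<mu> $ 1 * of_real x2 powr \<mu> $ 2 = exp (pairing \<mu> (log_vec x1 x2))"
  using assms by (simp add: powr_def pairing_def UNIV_2 log_vec_def exp_add Ln_of_real)

text \<open>A description of \<open>h\<^sub>1(x\<^sub>1) h\<^sub>2(x\<^sub>2)\<close> by its eigenvalues, which is visibly stable under products and inverses.\<close>

definition torus_elt :: "('v \<Rightarrow> 'v) \<Rightarrow> real \<Rightarrow> real \<Rightarrow> bool" where
  "torus_elt a x1 x2 \<longleftrightarrow> V.lin a \<and> x1 > 0 \<and> x2 > 0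
     \<and> (\<forall>\<mu>. \<forall>v\<in>V.wspace \<mu>. a v = vscale M (exp (pairing \<mu> (log_vec x1 x2))) v)"

lemma h_elt_lin: "s > 0 \<Longrightarrow> V.lin (h_elt M i s)"
  unfolding h_elt_def
  using Vector_Spaces.linear_compose[OF V.lin_inv[OF w_elt_lin w_elt_bij] w_elt_lin, of 1 s i i] by simp

lemma h_elt_bij: "s > 0 \<Longrightarrow> bij (h_elt M i s)"
  unfolding h_elt_def by (intro bij_comp bij_imp_bij_inv w_elt_bij) auto

lemma torus_elt_h_elt:
  assumes "x1 > 0" "x2 > 0"
  shows "torus_elt (h_elt M 1 x1 \<circ> h_elt M 2 x2) x1 x2"
proof -
  have "h_elt M 1 x1 (h_elt M 2 x2 v) = vscale M (exp (pairing \<mu> (log_vec x1 x2))) v"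
    if "v \<in> V.wspace \<mu>" for v \<mu>
    using h_elt_wspace[OF assms(1) that, of 1] h_elt_wspace[OF assms(2) that, of 2]
    by (simp add: V.lin_scale[OF h_elt_lin[OF assms(1)]] mult.commute flip: exp_log_vec[OF assms])
  then show ?thesis
    using assms Vector_Spaces.linear_compose[OF h_elt_lin[OF assms(2)] h_elt_lin[OF assms(1)]]
    by (simp add: torus_elt_def)
qed

lemma torus_elt_unique:
  assumes "torus_elt a x1 x2" "torus_elt b x1 x2"
  shows "a = b"
proof
  fix v
  show "a v = b v"
    by (rule V.lin_eq_on_span[of a b "\<Union>\<mu>. V.wspace \<mu>"]) (use assms V_span in \<open>auto simp: torus_elt_def\<close>)
qed

lemma log_vec_mult:
  assumes "x1 > 0" "x2 > 0" "y1 > 0" "y2 > 0"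
  shows "log_vec (x1 * y1) (x2 * y2) = log_vec x1 x2 + log_vec y1 y2"
  using assms by (simp add: log_vec_def vec_eq_iff ln_mult)

lemma log_vec_one: "log_vec 1 1 = 0"
  by (simp add: log_vec_def vec_eq_iff)

lemma A_plus_torus_elt:
  assumes "a \<in> A_plus M"
  shows "\<exists>x1 x2. torus_elt a x1 x2"
proof -
  have "bij a \<and> (\<exists>x1 x2. torus_elt a x1 x2)"
    using assms unfolding A_plus_def
  proof (rule generate_bijection_group_induct[where P = "\<lambda>a. bij a \<and> (\<exists>x1 x2. torus_elt a x1 x2)"])
    fix g assume "g \<in> {h_elt M i s |i s. 0 < s}"
    then obtain i s where g: "g = h_elt M i s" "s > 0" by blast
    have "torus_elt g (if i = 1 then s else 1) (if i = 1 then 1 else s)"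
      unfolding torus_elt_def g(1)
    proof (intro conjI allI ballI h_elt_lin g(2))
      show "(if i = 1 then s else 1) > 0" "(if i = 1 then 1 else s) > 0" using g by auto
      fix \<mu> v assume "v \<in> V.wspace \<mu>"
      then show "h_elt M i s v = vscale M (exp (pairing \<mu> (log_vec (if i = 1 then s else 1) (if i = 1 then 1 else s)))) v"
        using h_elt_wspace[OF g(2), of v \<mu> i] g(2) exhaust_2[of i]
        by (auto simp flip: exp_log_vec)
    qed
    then show "bij g \<and> bij g \<and> (\<exists>x1 x2. torus_elt g x1 x2)" using h_elt_bij g by blast
  next
    have "torus_elt id 1 1"
      using V.linear_id by (simp add: torus_elt_def log_vec_one pairing_def)
    then show "bij id \<and> (\<exists>x1 x2. torus_elt (id :: 'v \<Rightarrow> 'v) x1 x2)" by auto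
  next
    fix g assume g: "bij g" "bij g \<and> (\<exists>x1 x2. torus_elt g x1 x2)"
    then obtain x1 x2 where x: "torus_elt g x1 x2" by blast
    have "torus_elt (inv_into UNIV g) (inverse x1) (inverse x2)"
      unfolding torus_elt_def
    proof (intro conjI allI ballI)
      show "V.lin (inv_into UNIV g)" using V.lin_inv g(1) x by (auto simp: torus_elt_def)
      show "inverse x1 > 0" "inverse x2 > 0" using x by (auto simp: torus_elt_def)
      fix \<mu> v assume v: "v \<in> V.wspace \<mu>"
      have "log_vec (inverse x1) (inverse x2) = - log_vec x1 x2"
        using x by (simp add: log_vec_def vec_eq_iff torus_elt_def ln_inverse)
      then have "g (vscale M (exp (pairing \<mu> (log_vec (inverse x1) (inverse x2)))) v) = v"
        using x v by (simp add: torus_elt_def V.lin_scale pairing_simps flip: exp_add)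
      then show "inv_into UNIV g v = vscale M (exp (pairing \<mu> (log_vec (inverse x1) (inverse x2)))) v"
        using g(1) by (metis bij_inv_eq_iff)
    qed
    then show "bij (inv_into UNIV g) \<and> (\<exists>x1 x2. torus_elt (inv_into UNIV g) x1 x2)"
      using g(1) bij_imp_bij_inv by blast
  next
    fix g h assume gh: "bij g \<and> (\<exists>x1 x2. torus_elt g x1 x2)" "bij h \<and> (\<exists>x1 x2. torus_elt h x1 x2)"
    then obtain x1 x2 y1 y2 where x: "torus_elt g x1 x2" and y: "torus_elt h y1 y2" by blast
    have "torus_elt (g \<circ> h) (x1 * y1) (x2 * y2)"
      using x y unfolding torus_elt_def
      by (auto simp: V.lin_scale log_vec_mult pairing_simps exp_add mult.commute
          intro: Vector_Spaces.linear_compose)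
    then show "bij (g \<circ> h) \<and> (\<exists>x1 x2. torus_elt (g \<circ> h) x1 x2)" using gh bij_comp by blast
  qed
  then show ?thesis by blast
qed

text \<open>The eigenvalues on the highest weight vector \<open>v\<close> and on some nonzero \<open>f\<^sub>j v\<close> determine an element of the
  torus, as \<open>\<lambda>\<close> is dominant and nonzero and hence linearly independent of \<open>\<alpha>\<^sub>j\<close>.\<close>

lemma torus_coordinates_unique:
  assumes x: "x1 > 0" "x2 > 0" and y: "y1 > 0" "y2 > 0" and j: "Re (hw M $ j) > 0"
    and hw: "exp (pairing (hw M) (log_vec x1 x2)) = exp (pairing (hw M) (log_vec y1 y2))"
    and rj: "exp (pairing (hw M - simple_root m j) (log_vec x1 x2))
      = exp (pairing (hw M - simple_root m j) (log_vec y1 y2))"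
  shows "x1 = y1 \<and> x2 = y2"
proof -
  define d where "d i = ln (if i = 1 then x1 else x2) - ln (if i = (1::2) then y1 else y2)" for i
  have ld: "log_vec x1 x2 - log_vec y1 y2 = (\<chi> i. of_real (d i))"
    by (simp add: log_vec_def d_def vec_eq_iff)
  have real: "pairing \<mu> (\<chi> i. of_real (d i)) = 0"
    if "exp (pairing \<mu> (log_vec x1 x2)) = exp (pairing \<mu> (log_vec y1 y2))" "\<And>i. \<mu> $ i \<in> \<real>" for \<mu>
  proof -
    have "exp (pairing \<mu> (\<chi> i. of_real (d i))) = 1"
      unfolding ld[symmetric] using that(1) by (simp add: pairing_simps exp_diff)
    moreover have "pairing \<mu> (\<chi> i. of_real (d i)) \<in> \<real>"
      unfolding pairing_def using that(2) by (auto intro: sum_in_Reals)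
    then obtain r where r: "pairing \<mu> (\<chi> i. of_real (d i)) = of_real r" by (auto elim: Reals_cases)
    ultimately have "exp (of_real r :: complex) = 1" by simp
    then have "complex_of_real (exp r) = of_real 1" by (simp only: exp_of_real of_real_1)
    then have "r = 0" by (simp only: of_real_eq_iff exp_eq_one_iff)
    with r show ?thesis by simp
  qed
  have hwr: "hw M $ i \<in> \<real>" for i using hw_real(1)[of i] by (metis Reals_of_real)
  have "pairing (hw M) (\<chi> i. of_real (d i)) = 0"
    by (rule real[OF hw hwr])
  moreover have "pairing (hw M) (\<chi> i. of_real (d i)) = of_real (Re (hw M $ j) * d j + Re (hw M $ (j + 1)) * d (j + 1))"
    using hw_real(1)[of j] hw_real(1)[of "j + 1"] by (simp add: pairing_def sum_2_index[of _ j])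
  ultimately have 1: "Re (hw M $ j) * d j + Re (hw M $ (j + 1)) * d (j + 1) = 0"
    by (simp only: of_real_eq_0_iff)
  have "pairing (hw M - simple_root m j) (\<chi> i. of_real (d i)) = 0"
    by (rule real[OF rj]) (use hwr in \<open>auto simp: simple_root_nth cartan_matrix_def\<close>)
  moreover have "pairing (hw M - simple_root m j) (\<chi> i. of_real (d i))
      = pairing (hw M) (\<chi> i. of_real (d i)) - of_real (2 * d j - real m * d (j + 1))"
    using other_index(1)[of j]
    by (simp add: pairing_simps) (simp add: pairing_def sum_2_index[of _ j] simple_root_nth cartan_matrix_def)
  ultimately have "(of_real (2 * d j - real m * d (j + 1)) :: complex) = 0"
    using real[OF hw hwr] by simp
  then have 2: "2 * d j = real m * d (j + 1)" by (simp only: of_real_eq_0_iff)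
  have "(Re (hw M $ j) * real m + 2 * Re (hw M $ (j + 1))) * d (j + 1) = 0"
    using 1 2 by algebra
  moreover have "Re (hw M $ j) * real m + 2 * Re (hw M $ (j + 1)) > 0"
    using j hw_real(2)[of "j + 1"] m_ge by (intro add_pos_nonneg) auto
  ultimately have "d (j + 1) = 0" by simp
  with 2 have "d j = 0" by simp
  with \<open>d (j + 1) = 0\<close> have "d 1 = 0" "d 2 = 0" using other_index(3)[of _ j] by metis+
  then show ?thesis using x y by (simp add: d_def)
qed

lemma A_coord_eq:
  assumes "torus_elt a x1 x2"
  shows "A_coord M a = (x1, x2)" "a = h_elt M 1 x1 \<circ> h_elt M 2 x2"
proof -
  have x: "x1 > 0" "x2 > 0" using assms by (auto simp: torus_elt_def)
  show a: "a = h_elt M 1 x1 \<circ> h_elt M 2 x2"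
    by (rule torus_elt_unique[OF assms torus_elt_h_elt[OF x]])
  have "y1 = x1 \<and> y2 = x2" if y: "y1 > 0" "y2 > 0" "a = h_elt M 1 y1 \<circ> h_elt M 2 y2" for y1 y2
  proof -
    have ay: "torus_elt a y1 y2" unfolding y(3) by (rule torus_elt_h_elt[OF y(1,2)])
    obtain j where j: "Re (hw M $ j) > 0" by (rule hw_pos)
    have eq: "exp (pairing \<mu> (log_vec y1 y2)) = exp (pairing \<mu> (log_vec x1 x2))"
      if "v \<in> V.wspace \<mu>" "v \<noteq> 0" for v \<mu>
      using ay assms that by (auto simp: torus_elt_def)
    show ?thesis
      by (rule torus_coordinates_unique[OF y(1,2) x j eq[OF hwv_wspace hwv_nonzero]
            eq[OF fv_wspace hw_real(3)[OF j]]])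
  qed
  then show "A_coord M a = (x1, x2)"
    unfolding A_coord_def using x a by (intro the_equality) auto
qed

lemma A_power_eq:
  assumes "torus_elt a x1 x2"
  shows "A_power M a \<mu> = exp (pairing \<mu> (log_vec x1 x2))"
proof -
  have "x1 > 0" "x2 > 0" using assms by (auto simp: torus_elt_def)
  then show ?thesis
    using exp_log_vec[of x1 x2 \<mu>] by (simp add: A_power_def A_coord_eq(1)[OF assms] pairing_coroot)
qed

end

context kac_moody_setting
begin

section \<open>Uniqueness of the torus component in the Iwasawa decomposition\<close>

lemma chi_pos_zero: "chi_pos M i 0 = id"
proof
  fix v
  have "V.lin (\<lambda>v. 0)" by (rule V.linI) simp_all
  from V.op_exp_eq_sum[OF this, of 1 v]
  show "chi_pos M i 0 v = id v" by (simp add: chi_pos_def)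
qed

lemma chi_pos_lin: "V.lin (chi_pos M i s)" and chi_pos_bij: "bij (chi_pos M i s)"
  and chi_pos_wspace: "v \<in> V.wspace \<mu> \<Longrightarrow> \<exists>N y. chi_pos M i s v = v + (\<Sum>n<N. y n)
    \<and> (\<forall>n. y n \<in> V.wspace (\<mu> + of_nat (Suc n) *s simple_root m i))"
proof -
  interpret S: integrable_sl2_module "vscale M" "\<lambda>x. act M (cartan M x)" "act M (egen M i)" "act M (fgen M i)"
      "simple_root m i" "simple_coroot i"
    by (rule V_integrable)
  have *: "V.lin (chi_pos M i s) \<and> bij (chi_pos M i s) \<and> (v \<in> V.wspace \<mu> \<longrightarrow> (\<exists>N y. chi_pos M i s v = v + (\<Sum>n<N. y n)
    \<and> (\<forall>n. y n \<in> V.wspace (\<mu> + of_nat (Suc n) *s simple_root m i))))" for v \<mu>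
  proof (cases "s = 0")
    case True
    have "\<exists>N y. v = v + (\<Sum>n<N. y n) \<and> (\<forall>n. y n \<in> V.wspace (\<mu> + of_nat (Suc n) *s simple_root m i))"
      by (rule exI[of _ 0], rule exI[of _ "\<lambda>_. 0"]) (simp add: V.subspace_0[OF V.wspace_subspace])
    then show ?thesis using V.linear_id unfolding True chi_pos_zero by simp
  next
    case False
    interpret R: integrable_sl2_module "vscale M" "\<lambda>x. act M (cartan M x)"
        "\<lambda>v. vscale M (of_real s) (act M (egen M i) v)" "\<lambda>v. vscale M (inverse (of_real s)) (act M (fgen M i) v)"
        "simple_root m i" "simple_coroot i"
      using S.rescale_integrable[of "of_real s"] False by simp
    show ?thesis unfolding chi_pos_def using R.expE_lin R.expE_bij R.expE_wspace[of v \<mu>] by metis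
  qed
  show "V.lin (chi_pos M i s)" "bij (chi_pos M i s)" using * by blast+
  show "v \<in> V.wspace \<mu> \<Longrightarrow> \<exists>N y. chi_pos M i s v = v + (\<Sum>n<N. y n)
    \<and> (\<forall>n. y n \<in> V.wspace (\<mu> + of_nat (Suc n) *s simple_root m i))" using * by blast
qed

lemma weyl_lift_simps: "weyl_lift M [] = id" "weyl_lift M (i # is) = w_elt M i 1 \<circ> weyl_lift M is"
  by (simp_all add: weyl_lift_def)

lemma weyl_lift_lin: "V.lin (weyl_lift M is)"
proof (induction "is")
  case Nil
  show ?case using V.linear_id by (simp only: weyl_lift_simps)
next
  case (Cons i "is")
  have "V.lin (w_elt M i 1)" by (rule w_elt_lin) simp
  then show ?case unfolding weyl_lift_simps by (rule Vector_Spaces.linear_compose[OF Cons])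
qed

lemma weyl_lift_bij: "bij (weyl_lift M is)"
proof (induction "is")
  case Nil
  show ?case by (simp only: weyl_lift_simps bij_id)
next
  case (Cons i "is")
  have "bij (w_elt M i 1)" by (rule w_elt_bij) simp
  with Cons show ?case unfolding weyl_lift_simps by (rule bij_comp)
qed

lemma weyl_lift_wspace_iff: "weyl_lift M is v \<in> V.wspace (dual_word m is \<mu>) \<longleftrightarrow> v \<in> V.wspace \<mu>"
  by (induction "is") (auto simp: weyl_lift_simps dual_word_simps w_elt_wspace_iff)

lemma chi_real_lin: "V.lin (chi_real M is i s)"
  unfolding chi_real_def o_assoc
  by (rule Vector_Spaces.linear_compose[OF V.lin_inv[OF weyl_lift_lin weyl_lift_bij]
        Vector_Spaces.linear_compose[OF chi_pos_lin weyl_lift_lin]])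

lemma chi_real_bij: "bij (chi_real M is i s)"
  unfolding chi_real_def by (intro bij_comp weyl_lift_bij chi_pos_bij bij_imp_bij_inv)

text \<open>The lift of \<open>w\<close> maps weight spaces to the reflected weight spaces. So \<open>\<chi>\<^sub>\<alpha>(s)\<close> for \<open>\<alpha> = w \<alpha>\<^sub>i\<close>
  changes weights by multiples of \<open>\<alpha>\<close>, as \<open>\<chi>\<close> for \<open>\<alpha>\<^sub>i\<close> does by multiples of \<open>\<alpha>\<^sub>i\<close>.\<close>

lemma chi_real_wspace:
  assumes v: "v \<in> V.wspace \<mu>"
  shows "\<exists>N y. chi_real M is i s v = v + (\<Sum>n<N. y n)
    \<and> (\<forall>n. y n \<in> V.wspace (\<mu> + of_nat (Suc n) *s dual_word m is (simple_root m i)))"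
proof -
  define u where "u = inv_into UNIV (weyl_lift M is) v"
  define \<kappa> where "\<kappa> = dual_word m (rev is) \<mu>"
  have lu: "weyl_lift M is u = v" using weyl_lift_bij by (simp add: u_def bij_is_surj surj_f_inv_f)
  have \<mu>: "dual_word m is \<kappa> = \<mu>" by (simp add: \<kappa>_def dual_word_rev_cancel)
  have "u \<in> V.wspace \<kappa>" using weyl_lift_wspace_iff[of "is" u \<kappa>] v by (simp add: lu \<mu>)
  from chi_pos_wspace[OF this, of i s] obtain N y where y: "chi_pos M i s u = u + (\<Sum>n<N. y n)"
    "\<And>n. y n \<in> V.wspace (\<kappa> + of_nat (Suc n) *s simple_root m i)" by blast
  have "chi_real M is i s v = weyl_lift M is (chi_pos M i s u)" by (simp add: chi_real_def u_def)
  also have "\<dots> = v + (\<Sum>n<N. weyl_lift M is (y n))"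
    by (simp only: y(1) V.lin_add[OF weyl_lift_lin] V.lin_sum[OF weyl_lift_lin] lu)
  finally have "chi_real M is i s v = v + (\<Sum>n<N. weyl_lift M is (y n))" .
  moreover have "weyl_lift M is (y n) \<in> V.wspace (\<mu> + of_nat (Suc n) *s dual_word m is (simple_root m i))" for n
    using weyl_lift_wspace_iff[of "is" "y n" "\<kappa> + of_nat (Suc n) *s simple_root m i"] y(2)[of n]
    by (simp only: dual_word_linear \<mu>)
  ultimately show ?thesis by blast
qed

text \<open>All weights lie in \<open>\<lambda> - \<nat> \<alpha>\<^sub>1 - \<nat> \<alpha>\<^sub>2\<close>. Adding a positive multiple of a positive root to \<open>\<lambda>\<close> leaves this
  set. Added to \<open>\<lambda> - \<alpha>\<^sub>j\<close>, it stays inside only if the sum is \<open>\<lambda>\<close>, whose weight space is a line.\<close>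

lemma weights_above:
  assumes "\<alpha> = rt m (nat_vec k)" "\<alpha> \<noteq> 0"
  shows "v \<in> V.wspace (hw M + of_nat (Suc n) *s \<alpha>) \<Longrightarrow> v = 0"
    and "v \<in> V.wspace (hw M - simple_root m j + of_nat (Suc n) *s \<alpha>) \<Longrightarrow> \<exists>c. v = vscale M c (hwv M)"
proof -
  have "nat_vec k \<noteq> 0" using assms by (auto simp: rt_def)
  then obtain i where "nat_vec k $ i \<noteq> 0" by (auto simp: vec_eq_iff)
  then have i: "k i \<noteq> 0" by (simp add: nat_vec_nth)
  have sc: "of_nat (Suc n) *s \<alpha> = rt m (of_nat (Suc n) *s nat_vec k)" by (simp add: assms(1) rt_linear)
  show "v = 0" if v: "v \<in> V.wspace (hw M + of_nat (Suc n) *s \<alpha>)"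
  proof (rule ccontr)
    assume "v \<noteq> 0"
    then obtain l where "hw M + of_nat (Suc n) *s \<alpha> = hw M - rt m (nat_vec l)" using weights_below v by blast
    then have "rt m (of_nat (Suc n) *s nat_vec k) = rt m (- nat_vec l)"
      unfolding sc by (simp add: rt_linear diff_conv_add_uminus del: of_nat_Suc add_uminus_conv_diff)
    then have "of_nat (Suc n) *s nat_vec k = - nat_vec l" by (rule rt_inj[OF m_ge])
    then have e: "of_nat (Suc n) * of_nat (k i) = - (of_nat (l i) :: complex)"
      by (metis nat_vec_nth vector_smult_component vector_uminus_component)
    have "of_nat (Suc n * k i + l i) = (0 :: complex)" unfolding of_nat_add of_nat_mult e by simp
    then have "Suc n * k i + l i = 0" by (simp only: of_nat_eq_0_iff)
    then show False using i by simp
  qed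
  show "\<exists>c. v = vscale M c (hwv M)" if v: "v \<in> V.wspace (hw M - simple_root m j + of_nat (Suc n) *s \<alpha>)"
  proof (cases "v = 0")
    case True
    then show ?thesis by (intro exI[of _ 0]) simp
  next
    case False
    then obtain l where l: "hw M - simple_root m j + of_nat (Suc n) *s \<alpha> = hw M - rt m (nat_vec l)"
      using weights_below v by blast
    then have "of_nat (Suc n) *s \<alpha> + rt m (nat_vec l) = simple_root m j" by (simp add: algebra_simps)
    then have "rt m (of_nat (Suc n) *s nat_vec k + nat_vec l) = rt m (simple_coroot j)"
      unfolding sc by (simp add: rt_linear rt_coroot)
    then have eq: "of_nat (Suc n) *s nat_vec k + nat_vec l = simple_coroot j" by (rule rt_inj[OF m_ge])
    have "Suc n * k r + l r = (if r = j then 1 else 0)" for r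
    proof -
      have "(of_nat (Suc n) *s nat_vec k + nat_vec l) $ r = simple_coroot j $ r" by (simp only: eq)
      then have "of_nat (Suc n) * of_nat (k r) + of_nat (l r) = (if r = j then 1 else 0 :: complex)"
        by (simp add: nat_vec_nth simple_coroot_def axis_def eq_commute[of j] del: of_nat_Suc)
      then have "of_nat (Suc n * k r + l r) = (of_nat (if r = j then 1 else 0) :: complex)"
        by (simp only: of_nat_add of_nat_mult if_distrib[of of_nat] of_nat_1 of_nat_0)
      then show ?thesis by (simp only: of_nat_eq_iff)
    qed
    note e = this
    have "i = j" using e[of i] i by (auto split: if_splits)
    then have "l r = 0" for r using e[of r] e[of i] i by (cases "r = j") (auto simp: add_eq_if split: if_splits)
    then have "nat_vec l = 0" by (simp add: vec_eq_iff nat_vec_nth)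
    then have "rt m (nat_vec l) = 0" by (simp add: vec_eq_iff rt_nth pairing_def)
    then have "v \<in> V.wspace (hw M)" using v l by simp
    then show ?thesis using hw_space_one_dim by blast
  qed
qed

text \<open>The eigenvalues on \<open>v\<close> and on the vectors \<open>f\<^sub>j v\<close> already separate the elements of the torus, so the
  triangularity of the unipotent group is recorded on these vectors.\<close>

definition unitriangular :: "('v \<Rightarrow> 'v) \<Rightarrow> bool" where
  "unitriangular g \<longleftrightarrow> V.lin g \<and> g (hwv M) = hwv M \<and> (\<forall>j. \<exists>c. g (fv j) = fv j + vscale M c (hwv M))"

lemma unitriangular_chi_real:
  assumes "weyl_dual (weyl_word m is) (simple_root m i) \<in> pos_roots m M"
  shows "unitriangular (chi_real M is i s)"
proof -
  define \<alpha> where "\<alpha> = dual_word m is (simple_root m i)"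
  have "\<alpha> \<in> pos_roots m M" using assms by (simp add: \<alpha>_def weyl_dual_word)
  then obtain k where k: "\<alpha> = rt m (nat_vec k)" "\<alpha> \<noteq> 0" by (auto simp: pos_roots_alt roots_alt)
  show ?thesis
    unfolding unitriangular_def
  proof (intro conjI allI)
    show "V.lin (chi_real M is i s)" by (rule chi_real_lin)
    obtain N y where y: "chi_real M is i s (hwv M) = hwv M + (\<Sum>n<N. y n)"
      "\<And>n. y n \<in> V.wspace (hw M + of_nat (Suc n) *s \<alpha>)"
      using chi_real_wspace[OF hwv_wspace, of "is" i s] unfolding \<alpha>_def by blast
    have "y n = 0" for n by (rule weights_above(1)[OF k y(2)])
    then show "chi_real M is i s (hwv M) = hwv M" using y(1) by simp
    fix j
    obtain N y where y: "chi_real M is i s (fv j) = fv j + (\<Sum>n<N. y n)"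
      "\<And>n. y n \<in> V.wspace (hw M - simple_root m j + of_nat (Suc n) *s \<alpha>)"
      using chi_real_wspace[OF fv_wspace, of "is" i s j] unfolding \<alpha>_def by blast
    have "\<forall>n. \<exists>c. y n = vscale M c (hwv M)" using weights_above(2)[OF k y(2)] by blast
    then obtain c where "\<And>n. y n = vscale M (c n) (hwv M)" by metis
    then have "(\<Sum>n<N. y n) = vscale M (\<Sum>n<N. c n) (hwv M)" by (simp add: V.scale_sum_left)
    then show "\<exists>c. chi_real M is i s (fv j) = fv j + vscale M c (hwv M)" using y(1) by auto
  qed
qed

lemma unitriangular_N0:
  assumes "g \<in> N0 m M"
  shows "unitriangular g"
  using assms unfolding N0_def
proof (rule generate_bijection_group_induct)
  fix s assume "s \<in> {chi_real M is i s |is i s. weyl_dual (weyl_word m is) (simple_root m i) \<in> pos_roots m M}"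
  then show "bij s \<and> unitriangular s" using chi_real_bij unitriangular_chi_real by blast
next
  show "unitriangular id"
    using V.linear_id by (auto simp: unitriangular_def intro: exI[of _ 0])
next
  fix g assume g: "bij g" "unitriangular g"
  have inv: "inv_into UNIV g x = y" if "g y = x" for x y using g(1) that by (metis bij_inv_eq_iff)
  show "unitriangular (inv_into UNIV g)"
    unfolding unitriangular_def
  proof (intro conjI allI)
    show "V.lin (inv_into UNIV g)" using V.lin_inv g by (auto simp: unitriangular_def)
    show "inv_into UNIV g (hwv M) = hwv M" using g by (intro inv) (auto simp: unitriangular_def)
    fix j
    obtain c where "g (fv j) = fv j + vscale M c (hwv M)" using g(2) by (auto simp: unitriangular_def)
    then have "g (fv j + vscale M (- c) (hwv M)) = fv j"
      using g(2) by (simp add: unitriangular_def V.lin_diff V.lin_scale)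
    then show "\<exists>c. inv_into UNIV g (fv j) = fv j + vscale M c (hwv M)" using inv by blast
  qed
next
  fix g h assume gh: "unitriangular g" "unitriangular h"
  show "unitriangular (g \<circ> h)"
    unfolding unitriangular_def
  proof (intro conjI allI)
    show "V.lin (g \<circ> h)" using gh by (auto simp: unitriangular_def intro: Vector_Spaces.linear_compose)
    show "(g \<circ> h) (hwv M) = hwv M" using gh by (simp add: unitriangular_def)
    fix j
    obtain c d where "g (fv j) = fv j + vscale M c (hwv M)" "h (fv j) = fv j + vscale M d (hwv M)"
      using gh unfolding unitriangular_def by meson
    then have "(g \<circ> h) (fv j) = fv j + vscale M (c + d) (hwv M)"
      using gh by (simp add: unitriangular_def V.lin_add V.lin_scale V.scale_left_distrib add.assoc)
    then show "\<exists>c. (g \<circ> h) (fv j) = fv j + vscale M c (hwv M)" by blast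
  qed
qed

lemma module_int: "module (\<lambda>k::int. vscale M (of_int k))"
  by unfold_locales (simp_all add: V.scale_right_distrib V.scale_left_distrib)

text \<open>Each vector of the lattice is an integral combination of finitely many basis vectors, so an element of the completion
  agrees on it with an element of the subgroup.\<close>

lemma V_Z_approx:
  assumes "v \<in> V_Z M"
  shows "\<exists>t. \<forall>g h. V.lin g \<longrightarrow> V.lin h \<longrightarrow> (\<forall>n<t. g (Psi M n) = h (Psi M n)) \<longrightarrow> g v = h v"
proof -
  interpret Z: module "\<lambda>k::int. vscale M (of_int k)" by (rule module_int)
  have "v \<in> Z.span (range (Psi M))" using assms Psi_span by simp
  then show ?thesis
  proof (induction rule: Z.span_induct_alt)
    case base
    then show ?case by (auto simp: V.lin_zero)
  next
    case (step c x y)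
    then obtain l t where l: "x = Psi M l"
      and t: "\<And>g h. V.lin g \<Longrightarrow> V.lin h \<Longrightarrow> (\<forall>n<t. g (Psi M n) = h (Psi M n)) \<Longrightarrow> g y = h y" by blast
    show ?case
    proof (intro exI[of _ "max t (Suc l)"] allI impI)
      fix g h assume gh: "V.lin g" "V.lin h" "\<forall>n<max t (Suc l). g (Psi M n) = h (Psi M n)"
      then have "g y = h y" "g x = h x" using t[OF gh(1,2)] by (auto simp: l)
      then show "g (vscale M (of_int c) x + y) = h (vscale M (of_int c) x + y)"
        using gh by (simp add: V.lin_add V.lin_scale)
    qed
  qed
qed

lemma hwv_V_Z: "hwv M \<in> V_Z M" and fv_V_Z: "fv j \<in> V_Z M"
proof -
  show "hwv M \<in> V_Z M" unfolding V_Z_def using U_minus_Z.one[of M] by (rule image_eqI[rotated]) simp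
  show "fv j \<in> V_Z M"
    unfolding V_Z_def using U_minus_Z.divided_power[of M 1 j] by (rule image_eqI[rotated]) simp
qed

lemma unitriangular_N:
  assumes "g \<in> N_grp m M"
  shows "unitriangular g"
proof -
  have lin: "V.lin g" using assms by (simp add: N_grp_def completion_def Aut_V_R_def)
  have agree: "\<exists>h\<in>N0 m M. g (hwv M) = h (hwv M) \<and> g (fv j) = h (fv j)" for j
  proof -
    obtain s where s: "\<And>g h. V.lin g \<Longrightarrow> V.lin h \<Longrightarrow> (\<forall>n<s. g (Psi M n) = h (Psi M n)) \<Longrightarrow> g (hwv M) = h (hwv M)"
      using V_Z_approx[OF hwv_V_Z] by blast
    obtain t where t: "\<And>g h. V.lin g \<Longrightarrow> V.lin h \<Longrightarrow> (\<forall>n<t. g (Psi M n) = h (Psi M n)) \<Longrightarrow> g (fv j) = h (fv j)"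
      using V_Z_approx[OF fv_V_Z] by blast
    obtain h where h: "h \<in> N0 m M" "\<forall>n<max s t. g (Psi M n) = h (Psi M n)"
      using assms unfolding N_grp_def completion_def by blast
    have "V.lin h" using unitriangular_N0[OF h(1)] by (simp add: unitriangular_def)
    then show ?thesis using s[OF lin] t[OF lin] h by auto
  qed
  show ?thesis
    unfolding unitriangular_def
  proof (intro conjI allI lin)
    show "g (hwv M) = hwv M" using agree unitriangular_N0 unfolding unitriangular_def by metis
    fix j
    show "\<exists>c. g (fv j) = fv j + vscale M c (hwv M)"
      using agree[of j] unitriangular_N0 unfolding unitriangular_def by metis
  qed
qed

lemma exp_real_pairing:
  assumes "\<And>i. \<mu> $ i \<in> \<real>"
  obtains p where "p > 0" "exp (pairing \<mu> (log_vec x1 x2)) = of_real p"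
proof -
  have "pairing \<mu> (log_vec x1 x2) \<in> \<real>"
    unfolding pairing_def log_vec_def using assms by (auto intro: sum_in_Reals)
  then obtain r where "pairing \<mu> (log_vec x1 x2) = of_real r" by (auto elim: Reals_cases)
  then have "exp (pairing \<mu> (log_vec x1 x2)) = of_real (exp r)" by (simp add: exp_of_real)
  then show ?thesis using that[of "exp r"] by simp
qed

text \<open>For \<open>g = k a n\<close> the vectors \<open>g v\<close> and \<open>g f\<^sub>j v\<close> are the images under the isometry \<open>k\<close> of \<open>p v\<close> and
  \<open>q f\<^sub>j v + c p v\<close>, with \<open>p\<close> and \<open>q\<close> the positive eigenvalues of \<open>a\<close>. Their Gram matrix determines \<open>p\<close> and \<open>q\<close>,
  and so \<open>a\<close>.\<close>

lemma iwasawa_unique: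
  assumes k: "k \<in> K_grp M" "k' \<in> K_grp M" and a: "a \<in> A_plus M" "a' \<in> A_plus M"
    and n: "n \<in> N_grp m M" "n' \<in> N_grp m M" and eq: "k \<circ> a \<circ> n = k' \<circ> a' \<circ> n'"
  shows "a = a'"
proof -
  obtain j where j: "Re (hw M $ j) > 0" by (rule hw_pos)
  obtain x1 x2 where x: "torus_elt a x1 x2" using A_plus_torus_elt[OF a(1)] by blast
  obtain y1 y2 where y: "torus_elt a' y1 y2" using A_plus_torus_elt[OF a(2)] by blast
  define u where "u = fv j"
  define U where "U = Re (hw M $ j)"
  have uu: "herm M u u = of_real U" "herm M u (hwv M) = 0" "herm M (hwv M) u = 0"
    using herm_fv[of j] herm_fv_hwv[of j] hw_real(1)[of j] by (simp_all add: u_def U_def)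
  have hwr: "hw M $ i \<in> \<real>" for i using hw_real(1)[of i] by (metis Reals_of_real)
  then have hwr': "(hw M - simple_root m j) $ i \<in> \<real>" for i
    by (auto simp: simple_root_nth cartan_matrix_def)
  have *: "\<exists>p q c. p > 0 \<and> q > 0 \<and> exp (pairing (hw M) (log_vec z1 z2)) = of_real p
      \<and> exp (pairing (hw M - simple_root m j) (log_vec z1 z2)) = of_real q
      \<and> herm M ((k \<circ> a \<circ> n) (hwv M)) ((k \<circ> a \<circ> n) (hwv M)) = of_real (p * p)
      \<and> herm M ((k \<circ> a \<circ> n) u) ((k \<circ> a \<circ> n) (hwv M)) = c * of_real (p * p)
      \<and> herm M ((k \<circ> a \<circ> n) u) ((k \<circ> a \<circ> n) u) = of_real (q * q * U) + c * cnj c * of_real (p * p)"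
    if k: "k \<in> K_grp M" and z: "torus_elt a z1 z2" and n: "n \<in> N_grp m M" for k a n z1 z2
  proof -
    have iso: "herm M (k v) (k w) = herm M v w" for v w using k by (simp add: K_grp_def)
    obtain p where p: "p > 0" "exp (pairing (hw M) (log_vec z1 z2)) = of_real p"
      using exp_real_pairing[OF hwr] by blast
    obtain q where q: "q > 0" "exp (pairing (hw M - simple_root m j) (log_vec z1 z2)) = of_real q"
      using exp_real_pairing[OF hwr'] by blast
    have av: "a (hwv M) = vscale M (of_real p) (hwv M)" "a u = vscale M (of_real q) u" "V.lin a"
      using z hwv_wspace fv_wspace[of j] p(2) q(2) by (auto simp: torus_elt_def u_def)
    obtain c where c: "n (hwv M) = hwv M" "n u = u + vscale M c (hwv M)"
      using unitriangular_N[OF n] unfolding unitriangular_def u_def by blast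
    have an: "a (n (hwv M)) = vscale M (of_real p) (hwv M)"
      "a (n u) = vscale M (of_real q) u + vscale M (c * of_real p) (hwv M)"
      by (simp_all add: c av(1,2) V.lin_add[OF av(3)] V.lin_scale[OF av(3)])
    have "herm M ((k \<circ> a \<circ> n) (hwv M)) ((k \<circ> a \<circ> n) (hwv M)) = of_real (p * p)"
      "herm M ((k \<circ> a \<circ> n) u) ((k \<circ> a \<circ> n) (hwv M)) = c * of_real (p * p)"
      "herm M ((k \<circ> a \<circ> n) u) ((k \<circ> a \<circ> n) u) = of_real (q * q * U) + c * cnj c * of_real (p * p)"
      by (simp_all add: iso an herm_simps herm_hwv uu algebra_simps)
    then show ?thesis using p q by blast
  qed
  obtain p q c where P: "p > 0" "q > 0" "exp (pairing (hw M) (log_vec x1 x2)) = of_real p"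
      "exp (pairing (hw M - simple_root m j) (log_vec x1 x2)) = of_real q"
      "herm M ((k \<circ> a \<circ> n) (hwv M)) ((k \<circ> a \<circ> n) (hwv M)) = of_real (p * p)"
      "herm M ((k \<circ> a \<circ> n) u) ((k \<circ> a \<circ> n) (hwv M)) = c * of_real (p * p)"
      "herm M ((k \<circ> a \<circ> n) u) ((k \<circ> a \<circ> n) u) = of_real (q * q * U) + c * cnj c * of_real (p * p)"
    using *[OF k(1) x n(1)] by blast
  obtain p' q' c' where P': "p' > 0" "q' > 0" "exp (pairing (hw M) (log_vec y1 y2)) = of_real p'"
      "exp (pairing (hw M - simple_root m j) (log_vec y1 y2)) = of_real q'"
      "herm M ((k \<circ> a \<circ> n) (hwv M)) ((k \<circ> a \<circ> n) (hwv M)) = of_real (p' * p')"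
      "herm M ((k \<circ> a \<circ> n) u) ((k \<circ> a \<circ> n) (hwv M)) = c' * of_real (p' * p')"
      "herm M ((k \<circ> a \<circ> n) u) ((k \<circ> a \<circ> n) u) = of_real (q' * q' * U) + c' * cnj c' * of_real (p' * p')"
    using *[OF k(2) y n(2)] unfolding eq by blast
  have "complex_of_real (p * p) = of_real (p' * p')" using P(5) P'(5) by simp
  then have "p * p = p' * p'" by (simp only: of_real_eq_iff)
  then have p: "p = p'" using P(1) P'(1) by (metis abs_of_pos abs_mult_self_eq power2_eq_square power2_eq_iff_nonneg less_imp_le)
  have "c = c'" using P(6) P'(6) P(1) by (simp add: p)
  then have "complex_of_real (q * q * U) = of_real (q' * q' * U)" using P(7) P'(7) by (simp add: p)
  then have "q * q * U = q' * q' * U" by (simp only: of_real_eq_iff)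
  then have "q * q = q' * q'" using j by (simp add: U_def)
  then have q: "q = q'" using P(2) P'(2) by (metis power2_eq_square power2_eq_iff_nonneg less_imp_le)
  have "x1 = y1 \<and> x2 = y2"
    using x y P(3,4) P'(3,4) p q by (intro torus_coordinates_unique[OF _ _ _ _ j]) (auto simp: torus_elt_def)
  then show ?thesis using torus_elt_unique x y by blast
qed

lemma iwasawa_A_eq:
  assumes "k \<in> K_grp M" "a \<in> A_plus M" "n \<in> N_grp m M"
  shows "iwasawa_A m M (k \<circ> a \<circ> n) = a"
  unfolding iwasawa_A_def
proof (rule the_equality)
  show "a \<in> A_plus M \<and> (\<exists>k'\<in>K_grp M. \<exists>n'\<in>N_grp m M. k \<circ> a \<circ> n = k' \<circ> a \<circ> n')"
    using assms by blast
  show "b = a" if "b \<in> A_plus M \<and> (\<exists>k'\<in>K_grp M. \<exists>n'\<in>N_grp m M. k \<circ> a \<circ> n = k' \<circ> b \<circ> n')" for b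
    using that iwasawa_unique assms by metis
qed

section \<open>Estimates for the terms of the series\<close>

lemma rho_nth: "rho m $ i = 1"
proof -
  have "(2 - of_nat m :: complex) \<noteq> 0"
  proof
    assume "(2 - of_nat m :: complex) = 0"
    then have "(of_nat m :: complex) = of_nat 2" by simp
    then have "m = 2" by (simp only: of_nat_eq_iff)
    then show False using m_ge by simp
  qed
  moreover have "(simple_root m 1 + simple_root m 2) $ i = 2 - of_nat m"
    using exhaust_2[of i] by (auto simp: simple_root_nth cartan_matrix_def)
  ultimately show ?thesis by (simp only: rho_def vector_smult_component) simp
qed

text \<open>The coroot of an inverted root is \<open>k\<^sub>1 h\<^sub>1 + k\<^sub>2 h\<^sub>2\<close> with natural numbers \<open>k\<^sub>1 + k\<^sub>2 \<ge> 1\<close>. Hence all arguments of \<open>\<xi>\<close> in the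
  numerators have real part at least the smaller of the numbers \<open>-Re (\<nu> + \<rho>)(h\<^sub>i) > 1\<close>.\<close>

lemma norm_c_fun_le:
  assumes \<nu>: "\<And>i. Re (pairing \<nu> (simple_coroot i)) < -2"
  obtains C where "C \<ge> 1" "\<And>is. norm (c_fun m M \<nu> (weyl_word m is)) \<le> C ^ length is"
proof -
  define \<sigma> where "\<sigma> = min (- Re (\<nu> $ 1) - 1) (- Re (\<nu> $ 2) - 1)"
  have \<sigma>: "\<sigma> > 1" using \<nu>[of 1] \<nu>[of 2] by (simp add: \<sigma>_def pairing_coroot)
  obtain C where C: "C \<ge> 1" "\<And>s. Re s \<ge> \<sigma> \<Longrightarrow> norm (completed_zeta s / completed_zeta (1 + s)) \<le> C"
    using norm_completed_zeta_quotient_bounded[OF \<sigma>] by blast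
  have "norm (c_fun m M \<nu> (weyl_word m is)) \<le> C ^ length is" for "is"
  proof -
    let ?X = "{\<alpha> \<in> pos_roots m M. dual_word m is \<alpha> \<in> neg_roots m M}"
    let ?f = "\<lambda>\<alpha>. completed_zeta (- pairing (\<nu> + rho m) (coroot m \<alpha>)) /
      completed_zeta (1 - pairing (\<nu> + rho m) (coroot m \<alpha>))"
    have X: "card ?X \<le> length is" "\<And>\<alpha>. \<alpha> \<in> ?X \<Longrightarrow> \<exists>js i. \<alpha> = dual_word m js (simple_root m i)"
      using inversion_set[of "is"] by auto
    have "norm (?f \<alpha>) \<le> C" if \<alpha>: "\<alpha> \<in> ?X" for \<alpha>
    proof -
      obtain k where k: "\<alpha> = rt m (nat_vec k)" "\<alpha> \<noteq> 0" using \<alpha> by (auto simp: pos_roots_alt roots_alt)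
      obtain js i where "\<alpha> = dual_word m js (simple_root m i)" using X(2)[OF \<alpha>] by blast
      then have h: "coroot m \<alpha> = nat_vec k" using coroot_rt[OF m_ge, of "nat_vec k"] k(1) by simp
      have "k \<noteq> (\<lambda>_. 0)" using k by (auto simp: rt_nat_vec)
      then have "k 1 + k 2 \<noteq> 0" using exhaust_2 by (metis add_is_0 ext)
      then have "1 \<le> real (k 1) + real (k 2)" by linarith
      then have "\<sigma> * 1 \<le> \<sigma> * (real (k 1) + real (k 2))" using \<sigma> by (intro mult_left_mono) auto
      also have "\<dots> \<le> (- Re (\<nu> $ 1) - 1) * real (k 1) + (- Re (\<nu> $ 2) - 1) * real (k 2)"
        unfolding distrib_left by (intro add_mono mult_right_mono) (auto simp: \<sigma>_def)
      also have "\<dots> = Re (- pairing (\<nu> + rho m) (coroot m \<alpha>))"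
        by (simp add: h pairing_def UNIV_2 nat_vec_nth rho_nth algebra_simps)
      finally show ?thesis using C(2)[of "- pairing (\<nu> + rho m) (coroot m \<alpha>)"] by simp
    qed
    then have "(\<Prod>\<alpha>\<in>?X. norm (?f \<alpha>)) \<le> (\<Prod>\<alpha>\<in>?X. C)" by (intro prod_mono) auto
    also have "\<dots> = C ^ card ?X" by simp
    also have "\<dots> \<le> C ^ length is" using X(1) C(1) by (rule power_increasing)
    finally show ?thesis by (simp only: c_fun_def weyl_dual_word prod_norm)
  qed
  then show ?thesis using that C(1) by blast
qed

end

lemma summable_double_exponential:
  fixes C \<kappa> :: real
  assumes "C \<ge> 1" "\<kappa> > 0"
  shows "summable (\<lambda>n. C ^ n * exp (- (2 ^ n * \<kappa>)))"
proof -
  obtain N where N: "2 * C / \<kappa> < 2 ^ N" using real_arch_pow[of 2 "2 * C / \<kappa>"] by auto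
  show ?thesis
  proof (rule summable_ratio_test[of "1 / 2" N])
    fix n assume "n \<ge> N"
    then have "(2 :: real) ^ N \<le> 2 ^ n" by simp
    then have "2 * C / \<kappa> \<le> 2 ^ n" using N by linarith
    then have "2 * C \<le> 2 ^ n * \<kappa>" using assms(2) by (simp add: field_simps)
    also have "\<dots> \<le> exp (2 ^ n * \<kappa>)" using exp_ge_add_one_self[of "2 ^ n * \<kappa>"] by linarith
    finally have "C * exp (- (2 ^ n * \<kappa>)) \<le> 1 / 2" by (simp add: exp_minus field_simps)
    then have "C ^ n * exp (- (2 ^ n * \<kappa>)) * (C * exp (- (2 ^ n * \<kappa>)))
        \<le> C ^ n * exp (- (2 ^ n * \<kappa>)) * (1 / 2)"
      using assms(1) by (intro mult_left_mono) auto
    moreover have "exp (- (2 ^ Suc n * \<kappa>)) = exp (- (2 ^ n * \<kappa>)) * exp (- (2 ^ n * \<kappa>))"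
      by (simp flip: exp_add)
    ultimately show "norm (C ^ Suc n * exp (- (2 ^ Suc n * \<kappa>))) \<le> 1 / 2 * norm (C ^ n * exp (- (2 ^ n * \<kappa>)))"
      using assms(1) by (simp add: abs_mult mult_ac)
  qed simp
qed

text \<open>Sums over the Weyl group are compared with sums over word lengths; different lengths may give the same element, so the
  range is indexed by a set of representatives.\<close>

lemma summable_on_range:
  fixes f :: "'a \<Rightarrow> real" and g :: "nat \<Rightarrow> 'a"
  assumes "summable (\<lambda>n. f (g n))" "\<And>x. f x \<ge> 0"
  shows "f summable_on range g"
proof -
  have "(f \<circ> g) summable_on UNIV"
    using assms by (simp add: summable_on_UNIV_nonneg_real_iff o_def)
  moreover obtain U where U: "inj_on g U" "range g = g ` U"
    using subset_image_inj[of "range g" g UNIV] by auto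
  ultimately have "(f \<circ> g) summable_on U" using summable_on_subset_banach by blast
  then show ?thesis using summable_on_reindex[OF U(1), of f] U(2) by simp
qed

theorem theorem5p1:
  fixes m :: nat
    and M :: "('g::ab_group_add, 'v::ab_group_add) km_module"
    and \<nu> :: "complex^2"
  assumes "kac_moody_setting m M"
    and "\<forall>i. Re (pairing \<nu> (simple_coroot i)) < -2"
  shows "\<forall>g \<in> KAN_cone m M. constant_term_converges_absolutely m M \<nu> g"
proof
  interpret kac_moody_setting m M by (rule assms(1))
  fix g assume "g \<in> KAN_cone m M"
  then obtain k a n where g: "g = k \<circ> a \<circ> n" "k \<in> K_grp M" "a \<in> A_cone m M" "n \<in> N_grp m M"
    by (auto simp: KAN_cone_def)
  have a: "a \<in> A_plus M" "\<And>i. Re (A_power M a (simple_root m i)) < 1" using g(3) by (auto simp: A_cone_def)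
  have ag: "iwasawa_A m M g = a" unfolding g(1) by (rule iwasawa_A_eq[OF g(2) a(1) g(4)])
  obtain x1 x2 where x: "torus_elt a x1 x2" using A_plus_torus_elt[OF a(1)] by blast
  define l where "l i = ln (if i = (1::2) then x1 else x2)" for i
  define H where "H = log_vec x1 x2"
  have H: "H $ i = of_real (l i)" for i by (simp add: H_def log_vec_def l_def)
  have "2 * l i < real m * l (i + 1)" for i
  proof -
    have "pairing (simple_root m i) H = of_real (2 * l i - real m * l (i + 1))"
      using other_index(1)[of i]
      by (simp add: pairing_def sum_2_index[of _ i] simple_root_nth cartan_matrix_def H)
    then have "A_power M a (simple_root m i) = of_real (exp (2 * l i - real m * l (i + 1)))"
      by (simp only: A_power_eq[OF x] H_def[symmetric] exp_of_real)
    then have "exp (2 * l i - real m * l (i + 1)) < 1" using a(2)[of i] by (simp only: Re_complex_of_real)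
    then show ?thesis by simp
  qed
  \<comment> \<open>Thus \<open>H = log a\<close> is antidominant, and its orbit grows.\<close>
  then obtain \<kappa> where \<kappa>: "\<kappa> > 0" "\<And>i n. \<exists>a b. inv_into UNIV (weyl_word m (alternating_word i n)) H $ i = of_real a
    \<and> inv_into UNIV (weyl_word m (alternating_word i n)) H $ (i + 1) = of_real b
    \<and> a > 0 \<and> b > 0 \<and> a + b \<ge> 2 ^ n * \<kappa>"
    using orbit_growth[OF m_ge_3 H] by blast
  have \<nu>: "Re ((\<nu> + rho m) $ i) < -1" for i
    using assms(2)[rule_format, of i] by (simp add: pairing_coroot rho_nth)
  obtain C where C: "C \<ge> 1" "\<And>is. norm (c_fun m M \<nu> (weyl_word m is)) \<le> C ^ length is"
    using norm_c_fun_le[of \<nu>] assms(2) by blast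
  let ?f = "\<lambda>w. norm (constant_term_summand m M \<nu> g w)"
  define D where "D = exp (- Re (pairing (rho m) H))"
  have bound: "?f (weyl_word m (alternating_word i n)) \<le> D * (C ^ n * exp (- (2 ^ n * \<kappa>)))" for i n
  proof -
    let ?js = "alternating_word i n"
    obtain a1 b1 where ab: "inv_into UNIV (weyl_word m ?js) H $ i = of_real a1"
      "inv_into UNIV (weyl_word m ?js) H $ (i + 1) = of_real b1" "a1 > 0" "b1 > 0" "a1 + b1 \<ge> 2 ^ n * \<kappa>"
      using \<kappa>(2)[of i n] by blast
    have "Re (pairing (\<nu> + rho m) (inv_into UNIV (weyl_word m ?js) H))
        = Re ((\<nu> + rho m) $ i) * a1 + Re ((\<nu> + rho m) $ (i + 1)) * b1"
      by (simp add: pairing_def sum_2_index[of _ i] ab)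
    also have "\<dots> \<le> -1 * a1 + -1 * b1"
      using \<nu>[of i] \<nu>[of "i + 1"] ab by (intro add_mono mult_right_mono) auto
    finally have le: "Re (pairing (\<nu> + rho m) (inv_into UNIV (weyl_word m ?js) H)) \<le> - (2 ^ n * \<kappa>)"
      using ab(5) by linarith
    have "A_power M a (weyl_dual (weyl_word m ?js) (\<nu> + rho m) - rho m)
        = exp (pairing (\<nu> + rho m) (inv_into UNIV (weyl_word m ?js) H) - pairing (rho m) H)"
      by (simp only: A_power_eq[OF x] weyl_dual_word pairing_diff_left pairing_dual_word H_def)
    then have "norm (A_power M a (weyl_dual (weyl_word m ?js) (\<nu> + rho m) - rho m))
        = D * exp (Re (pairing (\<nu> + rho m) (inv_into UNIV (weyl_word m ?js) H)))"
      by (simp add: D_def flip: exp_add)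
    also have "\<dots> \<le> D * exp (- (2 ^ n * \<kappa>))" using le by (simp add: D_def)
    finally have "norm (A_power M a (weyl_dual (weyl_word m ?js) (\<nu> + rho m) - rho m))
        \<le> D * exp (- (2 ^ n * \<kappa>))" .
    then have "?f (weyl_word m ?js) \<le> (D * exp (- (2 ^ n * \<kappa>))) * C ^ n"
      unfolding constant_term_summand_def ag norm_mult
      using C(2)[of ?js] by (intro mult_mono) (auto simp: length_alternating_word D_def)
    then show ?thesis by (simp add: mult_ac)
  qed
  have "?f summable_on range (\<lambda>n. weyl_word m (alternating_word i n))" for i
  proof (rule summable_on_range)
    show "summable (\<lambda>n. ?f (weyl_word m (alternating_word i n)))"
      using bound[of i]
      by (intro summable_comparison_test'[OF summable_mult[OF summable_double_exponential[OF C(1) \<kappa>(1)], of D], of 0])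
        simp
  qed simp
  then have "?f summable_on range (\<lambda>n. weyl_word m (alternating_word 1 n)) \<union> range (\<lambda>n. weyl_word m (alternating_word 2 n))"
    by (intro summable_on_union)
  moreover have "weyl_group m = range (\<lambda>n. weyl_word m (alternating_word 1 n)) \<union> range (\<lambda>n. weyl_word m (alternating_word 2 n))"
    unfolding weyl_group_eq_alternating UNIV_2 by simp
  ultimately show "constant_term_converges_absolutely m M \<nu> g"
    by (simp only: constant_term_converges_absolutely_def)
qed

end
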